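(* Let $q$ be an odd prime power. Then: (1) if $q^2-q+1$ is prime, then $PSU_4(q)$ has a minimal logarithmic signature; (2) if $q > 5$ and $q+1 = 2p$ for some prime $p$, then $PSU_4(q)$ has a minimal logarithmic signature.
   Context: All groups are finite. For a finite group $G$, a logarithmic signature of $G$ is an ordered tuple $[A_1,\ldots,A_s]$ of subsets $A_i \subseteq G$ such that every element $g \in G$ can be written uniquely as a product $g = a_1a_2\cdots a_s$ with $a_i \in A_i$ for each $i$. Its length is $\sum_{i=1}^s |A_i|$. If $|G| = p_1^{\beta_1}\cdots p_k^{\beta_k}$ with $p_1,\ldots,p_k$ distinct primes and $\beta_j \ge 1$, every logarithmic signature has length at least $\sum_{j=1}^k \beta_j p_j$, and a logarithmic signature is called minimal (an MLS) if its length equals $\sum_{j=1}^k \beta_j p_j$. $PSU_4(q)$ is the projective special unitary group $SU_4(q)/Z(SU_4(q))$, where $SU_4(q)$ is the special unitary group of dimension $4$ over $GF(q^2)$. *)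

theory Defs
  imports "HOL-Analysis.Determinants" "HOL-Algebra.Coset"
    "HOL-Computational_Algebra.Primes"
begin

text \<open>Conjugate transpose of a 4x4 matrix over GF(q^2), where the field involution
  is the Frobenius map x \<mapsto> x^q.\<close>
definition conjT :: "nat \<Rightarrow> 'a::field ^4^4 \<Rightarrow> 'a ^4^4" where
  "conjT q A = (\<chi> i j. (A $ j $ i) ^ q)"

definition SU4 :: "nat \<Rightarrow> ('a::field ^4^4) monoid" where
  "SU4 q = \<lparr>carrier = {A. det A = 1 \<and> A ** conjT q A = mat 1},
            mult = (\<lambda>A B. A ** B), one = mat 1\<rparr>"

definition group_center :: "('a, 'b) monoid_scheme \<Rightarrow> 'a set" where
  "group_center G = {z \<in> carrier G. \<forall>g \<in> carrier G. z \<otimes>\<^bsub>G\<^esub> g = g \<otimes>\<^bsub>G\<^esub> z}"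

definition PSU4 :: "nat \<Rightarrow> ('a::field ^4^4) set monoid" where
  "PSU4 q = SU4 q Mod group_center (SU4 q)"

definition is_log_sig :: "('a, 'b) monoid_scheme \<Rightarrow> 'a set list \<Rightarrow> bool" where
  "is_log_sig G As \<longleftrightarrow> (\<forall>A \<in> set As. A \<subseteq> carrier G) \<and>
     bij_betw (\<lambda>xs. foldr (\<lambda>a b. a \<otimes>\<^bsub>G\<^esub> b) xs \<one>\<^bsub>G\<^esub>) (listset As) (carrier G)"

definition log_sig_length :: "'a set list \<Rightarrow> nat" where
  "log_sig_length As = sum_list (map card As)"

definition has_MLS :: "('a, 'b) monoid_scheme \<Rightarrow> bool" where
  "has_MLS G \<longleftrightarrow> (\<exists>As. is_log_sig G As \<and>
     log_sig_length As = (\<Sum>p \<in> prime_factors (card (carrier G)).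
                              multiplicity p (card (carrier G)) * p))"

end

theory Submission
  imports "HOL-Algebra.Algebraic_Closure_Type" Defs "HOL-Number_Theory.Residues"
begin

text \<open>
  A finite set with a prime number of elements, or with four, costs exactly its prime weight, and so
  do the first \<open>n\<close> powers of a group element, for any \<open>n\<close>. It therefore suffices to peel off such
  factors from \<open>SU\<^sub>4(q)\<close> until only the centre is left.

  The group acts transitively on the \<open>(q + 1)\<^sup>2 (q\<^sup>2 - q + 1)\<close> totally isotropic lines. Each of them
  has exactly one point in the Hermitian curve \<open>H\<close> cut out by the plane \<open>x\<^sub>4 = 0\<close>. If \<open>q\<^sup>2 - q + 1\<close>
  is prime, the secants of \<open>H\<close> through a fixed non-isotropic point, together with its polar line,
  partition \<open>H\<close> into \<open>q\<^sup>2 - q + 1\<close> blocks of \<open>q + 1\<close> points, and a single set of that prime size moves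
  one block to all the others. If \<open>q + 1 = 2 p\<close>, a cyclic group of order \<open>q\<^sup>2 - q + 1\<close> (a Singer cycle)
  acts freely on \<open>H\<close> with \<open>2 p\<close> orbits; since any two points of \<open>H\<close> are equivalent to any other two,
  a single set of \<open>p\<close> elements moves one pair of points to representatives of all the orbits. Diagonal
  matrices and one set of four elements deal with the remaining lines.

  The stabilizer of a line acts on its \<open>q\<^sup>2 + 1\<close> points; a non-split torus of \<open>SL\<^sub>2(q\<^sup>2)\<close> has two orbits
  there. The stabilizer of a point on a line is a product of three abelian groups, the last of which
  contains the centre.
\<close>

text \<open>Most intermediate sets are not subgroups: each consists of the group elements that send
  a fixed line into a prescribed set of lines. Hence \<open>mls_rel\<close> relates arbitrary
  subsets, and a partition of a set of lines into translates of a smaller one becomes a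
  factorization of sets of matrices.

  The proof is shaped by the price of unrelated elements: a run of powers may have any length, but a
  family without structure is affordable only in prime size or size four. Determinant one forces the
  diagonal tori to act by squares, which leaves a defect of two in each of two directions and
  explains the four. The factor q^2 - q + 1 must be prime or come from a cyclic group; in the latter
  case one factor q + 1 becomes unstructured, and pairing brings it down to p.

  The condition q > 5 removes q = 5, p = 3, where 3 divides both q + 1 and q^2 - q + 1, so that a
  nontrivial power of the Singer cycle is a scalar on the plane and fixes all of \<open>H\<close>.

  The chain is built in SU_4(q) because one that ends in the centre descends to the quotient factor
  by factor, with unchanged sizes.\<close>

no_notation fps_nth (infixl \<open>$\<close> 75)

section \<open>Minimal factorizations relative to a subset\<close>

text \<open>The sum of the prime factors counted with multiplicity, also called the integer
  logarithm; its additivity on products is what makes chains of factors composable.\<close>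

definition prime_weight :: "nat \<Rightarrow> nat" where
  "prime_weight n = (\<Sum>p\<in>prime_factors n. multiplicity p n * p)"

lemma sum_mset_eq_sum_count:
  fixes M :: "nat multiset"
  shows "sum_mset M = (\<Sum>x\<in>set_mset M. count M x * x)"
proof (induction M)
  case (add y M)
  have "(\<Sum>x\<in>set_mset (add_mset y M). count (add_mset y M) x * x) =
        (\<Sum>x\<in>set_mset (add_mset y M). count M x * x + (if x = y then y else 0))"
    by (rule sum.cong) auto
  also have "\<dots> = (\<Sum>x\<in>set_mset (add_mset y M). count M x * x) + y" by (subst sum.distrib) simp
  also have "(\<Sum>x\<in>set_mset (add_mset y M). count M x * x) = (\<Sum>x\<in>set_mset M. count M x * x)"
    by (rule sum.mono_neutral_right) (auto simp: not_in_iff)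
  finally show ?case using add by simp
qed simp

lemma prime_weight_eq_sum_mset: "prime_weight n = sum_mset (prime_factorization n)"
  unfolding prime_weight_def sum_mset_eq_sum_count
  by (rule sum.cong) (auto simp: count_prime_factorization in_prime_factors_iff)

lemma prime_weight_mult:
  "m > 0 \<Longrightarrow> n > 0 \<Longrightarrow> prime_weight (m * n) = prime_weight m + prime_weight n"
  by (simp add: prime_weight_eq_sum_mset prime_factorization_mult)

lemma prime_weight_1 [simp]: "prime_weight (Suc 0) = 0" by (simp add: prime_weight_def)

lemma prime_weight_prime: "prime p \<Longrightarrow> prime_weight p = p"
  by (simp add: prime_weight_eq_sum_mset prime_factorization_prime)

lemma prime_weight_4: "prime_weight 4 = 4"
  using prime_weight_mult[of 2 2] by (simp add: prime_weight_prime)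

text \<open>Factors are split off on the left one at a time, with bijectivity demanded at every
  stage; unique factorization of the whole follows stage by stage, and \<open>K\<close> remains as
  an unfactored tail.\<close>

fun factor_chain :: "('a, 'b) monoid_scheme \<Rightarrow> 'a set list \<Rightarrow> 'a set \<Rightarrow> 'a set \<Rightarrow> bool" where
  "factor_chain G [] K H \<longleftrightarrow> H = K"
| "factor_chain G (A # As) K H \<longleftrightarrow> (\<exists>H'. factor_chain G As K H' \<and> A \<subseteq> carrier G \<and>
      bij_betw (\<lambda>(a, h). a \<otimes>\<^bsub>G\<^esub> h) (A \<times> H') H)"

text \<open>The length is compared with the weight of the product of the factor sizes, not with that
  of a group order, so no order has to be computed on the way. Finite nonempty factors keep the
  product positive, as additivity of the weight requires.\<close>

definition mls_rel :: "('a, 'b) monoid_scheme \<Rightarrow> 'a set \<Rightarrow> 'a set \<Rightarrow> bool" where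
  "mls_rel G H K \<longleftrightarrow> (\<exists>As. factor_chain G As K H \<and> (\<forall>A\<in>set As. finite A \<and> A \<noteq> {}) \<and>
     sum_list (map card As) = prime_weight (prod_list (map card As)))"

lemma factor_chain_append:
  "factor_chain G As K H \<Longrightarrow> factor_chain G Bs L K \<Longrightarrow> factor_chain G (As @ Bs) L H"
  by (induction As arbitrary: H) auto

lemma prod_list_card_pos:
  "(\<forall>A\<in>set As. finite A \<and> A \<noteq> {}) \<Longrightarrow> prod_list (map card As) > 0"
  by (induction As) (auto simp: card_gt_0_iff)

lemma mls_rel_refl: "mls_rel G H H"
  unfolding mls_rel_def by (rule exI[of _ "[]"]) simp

lemma mls_rel_trans [trans]:
  assumes "mls_rel G H K" "mls_rel G K L"
  shows "mls_rel G H L"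
proof -
  obtain As where As: "factor_chain G As K H" "\<forall>A\<in>set As. finite A \<and> A \<noteq> {}"
    "sum_list (map card As) = prime_weight (prod_list (map card As))"
    using assms(1) unfolding mls_rel_def by blast
  obtain Bs where Bs: "factor_chain G Bs L K" "\<forall>A\<in>set Bs. finite A \<and> A \<noteq> {}"
    "sum_list (map card Bs) = prime_weight (prod_list (map card Bs))"
    using assms(2) unfolding mls_rel_def by blast
  have "factor_chain G (As @ Bs) L H" using factor_chain_append[OF As(1) Bs(1)] .
  moreover have "sum_list (map card (As @ Bs)) = prime_weight (prod_list (map card (As @ Bs)))"
    using As Bs by (simp add: prime_weight_mult prod_list_card_pos)
  ultimately show ?thesis
    unfolding mls_rel_def using As(2) Bs(2) by (intro exI[of _ "As @ Bs"]) auto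
qed

text \<open>The family is indexed so that \<open>I\<close> may consist of points, pairs or numbers.
  Its members are distinct because, for a fixed \<open>k\<close>, distinct indices have distinct
  products with \<open>k\<close>.\<close>

lemma mls_rel_single:
  assumes I: "finite I" "prime (card I) \<or> card I = 4"
    and b: "\<And>i. i \<in> I \<Longrightarrow> b i \<in> carrier G" and K: "K \<noteq> {}"
    and bij: "bij_betw (\<lambda>(i, k). b i \<otimes>\<^bsub>G\<^esub> k) (I \<times> K) H"
  shows "mls_rel G H K"
proof -
  obtain k where k: "k \<in> K"
    using K by blast
  have inj: "inj_on b I" using bij k unfolding bij_betw_def inj_on_def by fastforce
  have "bij_betw (\<lambda>(a, h). a \<otimes>\<^bsub>G\<^esub> h) (b ` I \<times> K) H"
  proof -
    have "bij_betw (map_prod b id) (I \<times> K) (b ` I \<times> K)"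
      by (intro bij_betw_map_prod) (auto simp: inj bij_betw_def)
    moreover have "bij_betw ((\<lambda>(a, h). a \<otimes>\<^bsub>G\<^esub> h) \<circ> map_prod b id) (I \<times> K) H"
      using bij by (simp add: comp_def case_prod_beta')
    ultimately show ?thesis by (simp add: bij_betw_comp_iff)
  qed
  then have "factor_chain G [b ` I] K H" using b by auto
  moreover have "card (b ` I) = card I" by (simp add: card_image inj)
  moreover have "prime_weight (card I) = card I" "I \<noteq> {}"
    using I by (auto simp: prime_weight_prime prime_weight_4)
  ultimately show ?thesis
    unfolding mls_rel_def using I(1) by (intro exI[of _ "[b ` I]"]) simp
qed

text \<open>Mixed radix notation for exponents: with \<open>n = p * m\<close> and \<open>p\<close>
  prime, writing an exponent as \<open>j + p * i\<close> splits off the first \<open>p\<close>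
  powers of \<open>x\<close> and leaves the first \<open>m\<close> powers of the \<open>p\<close>-th
  power of \<open>x\<close>.\<close>

lemma (in monoid) mls_rel_powers:
  assumes "x \<in> carrier G" "K \<subseteq> carrier G" "K \<noteq> {}" "n > 0"
    and "bij_betw (\<lambda>(i, k). x [^] i \<otimes> k) ({..<n::nat} \<times> K) H"
  shows "mls_rel G H K"
  using assms(1,4,5)
proof (induction n arbitrary: x H rule: less_induct)
  case (less n)
  show ?case
  proof (cases "n = 1")
    case True
    have "H = (\<lambda>(i, k). x [^] i \<otimes> k) ` ({..<n} \<times> K)"
      using less.prems(3) by (simp add: bij_betw_def)
    also have "\<dots> = (\<lambda>k. \<one> \<otimes> k) ` K" using True by (auto simp: image_iff)
    also have "\<dots> = K" using assms(2) by force
    finally show ?thesis by (simp add: mls_rel_refl)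
  next
    case False
    obtain p where p: "prime p" "p dvd n"
      using False prime_factor_nat by blast
    define m where "m = n div p"
    have n: "n = p * m" using p by (simp add: m_def)
    have m: "m > 0" "m < n" using n less.prems(2) p prime_gt_1_nat[OF p(1)] by (auto intro: gr0I)
    have p0: "p > 0" using p prime_gt_0_nat by blast
    define f where "f = (\<lambda>(i, k). x [^] (p * i) \<otimes> k)"
    define H' where "H' = f ` ({..<m} \<times> K)"
    have inj: "\<And>i i' k k'. i < n \<Longrightarrow> i' < n \<Longrightarrow> k \<in> K \<Longrightarrow> k' \<in> K \<Longrightarrow>
        x [^] i \<otimes> k = x [^] i' \<otimes> k' \<Longrightarrow> i = i' \<and> k = k'"
      using less.prems(3) unfolding bij_betw_def inj_on_def by auto
    have im: "(\<lambda>(i, k). x [^] i \<otimes> k) ` ({..<n} \<times> K) = H"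
      using less.prems(3) by (simp add: bij_betw_def)
    have lt: "j + p * i < n" if "j < p" "i < m" for i j
    proof -
      have "j + p * i < p * Suc i" using that by simp
      also have "\<dots> \<le> p * m" using that by (intro mult_left_mono) auto
      finally show ?thesis using n by simp
    qed
    have eqx: "x [^] j \<otimes> (x [^] (p * i) \<otimes> k) = x [^] (j + p * i) \<otimes> k" if "k \<in> K" for i j k
    proof -
      have "k \<in> carrier G" using that assms(2) by blast
      then show ?thesis using less.prems(1) by (simp add: m_assoc flip: nat_pow_mult)
    qed
    have pi: "p * i < n" if "i < m" for i using lt[of 0 i] that p0 by simp
    have b1: "bij_betw f ({..<m} \<times> K) H'"
      unfolding bij_betw_def H'_def
    proof (intro conjI refl inj_onI, clarify)
      fix i k i' k' assume "i < m" "i' < m" "k \<in> K" "k' \<in> K" "f (i, k) = f (i', k')"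
      then show "i = i' \<and> k = k'" using inj[of "p * i" "p * i'" k k'] pi p0 by (auto simp: f_def)
    qed
    have "(\<lambda>(i, k). (x [^] p) [^] i \<otimes> k) = f"
      using less.prems(1) by (auto simp: f_def nat_pow_pow)
    then have r1: "mls_rel G H' K" using less.IH[OF m(2) _ m(1), of "x [^] p" H'] b1 less.prems(1) by simp
    have b2: "bij_betw (\<lambda>(j, h). x [^] j \<otimes> h) ({..<p} \<times> H') H"
      unfolding bij_betw_def
    proof (intro conjI inj_onI; clarify?)
      fix j h j' h' assume a: "j < p" "j' < p" "h \<in> H'" "h' \<in> H'" "x [^] j \<otimes> h = x [^] j' \<otimes> h'"
      obtain i k where ik: "i < m" "k \<in> K" "h = x [^] (p * i) \<otimes> k"
        using a by (auto simp: H'_def f_def)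
      obtain i' k' where ik': "i' < m" "k' \<in> K" "h' = x [^] (p * i') \<otimes> k'"
        using a by (auto simp: H'_def f_def)
      have "x [^] (j + p * i) \<otimes> k = x [^] (j' + p * i') \<otimes> k'" using a ik ik' eqx by simp
      then have "j + p * i = j' + p * i' \<and> k = k'" using inj lt a ik ik' by blast
      moreover from this have "(j + p * i) mod p = (j' + p * i') mod p" by metis
      then have "j = j'" using a by simp
      ultimately show "j = j' \<and> h = h'" using ik ik' a p0 by simp
    next
      show "(\<lambda>(j, h). x [^] j \<otimes> h) ` ({..<p} \<times> H') = H"
        unfolding im[symmetric]
      proof (intro equalityI subsetI)
        fix y assume "y \<in> (\<lambda>(j, h). x [^] j \<otimes> h) ` ({..<p} \<times> H')"
        then obtain j i k where "j < p" "i < m" "k \<in> K" "y = x [^] (j + p * i) \<otimes> k"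
          using eqx by (auto simp: H'_def f_def)
        then show "y \<in> (\<lambda>(i, k). x [^] i \<otimes> k) ` ({..<n} \<times> K)"
          using lt by (auto intro!: image_eqI[of _ _ "(j + p * i, k)"])
      next
        fix y assume "y \<in> (\<lambda>(i, k). x [^] i \<otimes> k) ` ({..<n} \<times> K)"
        then obtain i k where ik: "i < n" "k \<in> K" "y = x [^] i \<otimes> k" by auto
        have "i div p < m" using ik(1) n p0 by (simp add: less_mult_imp_div_less mult.commute)
        moreover have "y = x [^] (i mod p) \<otimes> (x [^] (p * (i div p)) \<otimes> k)" using ik eqx by simp
        ultimately have "y = (\<lambda>(j, h). x [^] j \<otimes> h) (i mod p, f (i div p, k))"
          "(i mod p, f (i div p, k)) \<in> {..<p} \<times> H'"
          using ik p0 unfolding H'_def by (auto simp: f_def)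
        then show "y \<in> (\<lambda>(j, h). x [^] j \<otimes> h) ` ({..<p} \<times> H')" by (rule image_eqI)
      qed
    qed
    have "H' \<noteq> {}" using m(1) assms(3) by (auto simp: H'_def)
    then have "mls_rel G H H'"
      using less.prems(1) p(1) b2 by (intro mls_rel_single[of "{..<p}" "\<lambda>j. x [^] j"]) auto
    then show ?thesis using r1 by (rule mls_rel_trans)
  qed
qed

section \<open>Cyclic extensions and abelian subgroups\<close>

lemma (in group) subgroup_adjoin_commuting:
  assumes Z: "subgroup Z G" and x: "x \<in> carrier G" and fin: "finite (carrier G)"
    and comm: "\<And>z. z \<in> Z \<Longrightarrow> x \<otimes> z = z \<otimes> x"
  defines "K \<equiv> (\<lambda>(i, z). x [^] i \<otimes> z) ` ((UNIV :: nat set) \<times> Z)"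
  shows "subgroup K G" "mls_rel G K Z"
proof -
  interpret Z: subgroup Z G by (fact Z)
  have xo: "x [^] Coset.order G = \<one>" using x fin by (simp add: pow_order_eq_1)
  have o: "Coset.order G > 0" using fin by (simp add: order_gt_0_iff_finite)
  have cm: "z \<otimes> x [^] i = x [^] i \<otimes> z" if "z \<in> Z" for z and i :: nat
  proof (induction i)
    case (Suc i)
    have "z \<otimes> x [^] Suc i = z \<otimes> x [^] i \<otimes> x" using that x by (simp add: m_assoc)
    also have "\<dots> = x [^] i \<otimes> (z \<otimes> x)" using Suc that x by (simp add: m_assoc)
    also have "\<dots> = x [^] Suc i \<otimes> z" using that x comm[OF that] by (simp add: m_assoc)
    finally show ?case .
  qed (use that in simp)
  show "subgroup K G"
  proof (rule subgroupI)
    show "K \<subseteq> carrier G" using x by (auto simp: K_def)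
    show "K \<noteq> {}" using Z.one_closed unfolding K_def by blast
  next
    fix a assume "a \<in> K"
    then obtain i z where a: "a = x [^] (i::nat) \<otimes> z" "z \<in> Z" by (auto simp: K_def)
    \<comment> \<open>Only natural exponents occur in \<open>K\<close>, so the inverse of a power is
      written as a power with the help of the group order.\<close>
    have "x [^] ((Coset.order G - 1) * i) \<otimes> x [^] i = (x [^] Coset.order G) [^] i"
      using x o by (simp add: nat_pow_mult nat_pow_pow algebra_simps)
    then have "inv (x [^] i) = x [^] ((Coset.order G - 1) * i)" using x xo by (intro inv_equality) simp_all
    then have "inv a = x [^] ((Coset.order G - 1) * i) \<otimes> inv z"
      using a x cm[of "inv z" "(Coset.order G - 1) * i"] by (simp add: inv_mult_group)
    then show "inv a \<in> K" using a by (auto simp: K_def)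
  next
    fix a b assume "a \<in> K" "b \<in> K"
    then obtain i z j y where a: "a = x [^] (i::nat) \<otimes> z" "z \<in> Z" and b: "b = x [^] (j::nat) \<otimes> y" "y \<in> Z"
      by (auto simp: K_def)
    have "a \<otimes> b = x [^] i \<otimes> (z \<otimes> x [^] j) \<otimes> y"
      using a b x by (simp add: m_assoc)
    also have "\<dots> = x [^] (i + j) \<otimes> (z \<otimes> y)"
      using a b x cm by (simp add: m_assoc flip: nat_pow_mult)
    finally show "a \<otimes> b \<in> K" using a b by (auto simp: K_def)
  qed
  \<comment> \<open>The order of \<open>x\<close> modulo \<open>Z\<close>: the exponents below
    \<open>n\<close> meet every coset of \<open>Z\<close> in \<open>K\<close> exactly once, so a run
    of powers is a complete factor.\<close>
  define n where "n = (LEAST n::nat. n > 0 \<and> x [^] n \<in> Z)"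
  have ex: "Coset.order G > 0 \<and> x [^] Coset.order G \<in> Z" using xo o by simp
  have n: "n > 0" "x [^] n \<in> Z"
    using LeastI[of "\<lambda>n. n > 0 \<and> x [^] n \<in> Z", OF ex] by (auto simp: n_def)
  have nmin: "\<not> (m > 0 \<and> m < n \<and> x [^] m \<in> Z)" for m
    using not_less_Least[of m "\<lambda>n. n > 0 \<and> x [^] n \<in> Z"] by (auto simp: n_def)
  have inj0: "i = j \<and> z = y" if "i \<le> j" "j < n" "z \<in> Z" "y \<in> Z" "x [^] i \<otimes> z = x [^] j \<otimes> y" for i j z y
  proof -
    have "x [^] i \<otimes> z = x [^] i \<otimes> (x [^] (j - i) \<otimes> y)"
      using that x by (simp add: nat_pow_mult flip: m_assoc)
    then have e: "z = x [^] (j - i) \<otimes> y" using that x by simp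
    then have "z \<otimes> inv y = x [^] (j - i)" using that x by (simp add: m_assoc)
    then have "x [^] (j - i) \<in> Z" using that by (metis Z.m_closed Z.m_inv_closed)
    then have "j - i = 0" using nmin[of "j - i"] that by linarith
    then show ?thesis using e that by simp
  qed
  have "bij_betw (\<lambda>(i, k). x [^] i \<otimes> k) ({..<n} \<times> Z) K"
    unfolding bij_betw_def
  proof (intro conjI inj_onI; clarify?)
    fix i z j y assume "i < n" "j < n" "z \<in> Z" "y \<in> Z" "x [^] i \<otimes> z = x [^] j \<otimes> y"
    then show "i = j \<and> z = y" using inj0[of i j z y] inj0[of j i y z] by (cases "i \<le> j") auto
  next
    show "(\<lambda>(i, k). x [^] i \<otimes> k) ` ({..<n} \<times> Z) = K"
    proof (intro equalityI subsetI)
      fix y assume "y \<in> K"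
      then obtain i z where y: "y = x [^] (i::nat) \<otimes> z" "z \<in> Z" by (auto simp: K_def)
      have "x [^] i = x [^] (i mod n) \<otimes> (x [^] n) [^] (i div n)"
        using x by (simp add: nat_pow_pow nat_pow_mult)
      moreover have "(x [^] n) [^] j \<in> Z" for j :: nat using n(2) by (induction j) auto
      ultimately have "y = x [^] (i mod n) \<otimes> ((x [^] n) [^] (i div n) \<otimes> z)"
        "(x [^] n) [^] (i div n) \<otimes> z \<in> Z"
        using y x by (auto simp: m_assoc)
      then show "y \<in> (\<lambda>(i, k). x [^] i \<otimes> k) ` ({..<n} \<times> Z)"
        using n by (intro image_eqI[of _ _ "(i mod n, (x [^] n) [^] (i div n) \<otimes> z)"]) auto
    qed (auto simp: K_def)
  qed
  then show "mls_rel G K Z" using x n Z.subset Z.one_closed by (intro mls_rel_powers[of x Z n]) auto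
qed

text \<open>Elements of \<open>T\<close> are adjoined to \<open>Z\<close> one at a time; each step
  is a cyclic extension, hence a run of powers, and the subgroups grow until they fill
  \<open>T\<close>.\<close>

lemma (in group) mls_rel_abelian:
  assumes fin: "finite (carrier G)" and T: "subgroup T G"
    and comm: "\<And>a b. a \<in> T \<Longrightarrow> b \<in> T \<Longrightarrow> a \<otimes> b = b \<otimes> a"
    and "subgroup Z G" "Z \<subseteq> T"
  shows "mls_rel G T Z"
  using assms(4,5)
proof (induction "card T - card Z" arbitrary: Z rule: less_induct)
  case less
  show ?case
  proof (cases "Z = T")
    case True
    then show ?thesis by (simp add: mls_rel_refl)
  next
    case False
    interpret T: subgroup T G by (fact T)
    interpret Z: subgroup Z G by (fact less.prems(1))
    obtain x where x: "x \<in> T" "x \<notin> Z"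
      using False less.prems by blast
    define K where "K = (\<lambda>(i, z). x [^] i \<otimes> z) ` ((UNIV :: nat set) \<times> Z)"
    have xz: "x \<otimes> z = z \<otimes> x" if "z \<in> Z" for z using that x less.prems comm by blast
    have xc: "x \<in> carrier G" using x by simp
    note K = subgroup_adjoin_commuting[OF less.prems(1) xc fin xz, folded K_def]
    have finT: "finite T" using fin T.subset finite_subset by blast
    have KT: "K \<subseteq> T"
    proof
      fix y assume "y \<in> K"
      then obtain i z where "y = x [^] (i::nat) \<otimes> z" "z \<in> Z" by (auto simp: K_def)
      moreover have "x [^] i \<in> T" for i :: nat using x by (induction i) (auto simp: T.m_closed)
      ultimately show "y \<in> T" using less.prems(2) by auto
    qed
    have "x \<in> K" using xc by (auto simp: K_def intro!: image_eqI[of _ _ "(1, \<one>)"])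
    moreover have "z \<in> K" if "z \<in> Z" for z
      using that by (auto simp: K_def intro!: image_eqI[of _ _ "(0, z)"])
    ultimately have "Z \<subset> K" using x by blast
    then have "card Z < card K" "card K \<le> card T"
      using KT finT by (auto intro: psubset_card_mono card_mono dest: finite_subset)
    then have "mls_rel G T K" using K(1) KT by (intro less.hyps) auto
    then show ?thesis using K(2) by (rule mls_rel_trans)
  qed
qed

section \<open>Chains under right multiplication and in central quotients\<close>

lemma (in monoid) factor_chain_closed:
  "factor_chain G As B A \<Longrightarrow> B \<subseteq> carrier G \<Longrightarrow> A \<subseteq> carrier G"
proof (induction As arbitrary: A)
  case (Cons C As)
  then obtain A' where A': "factor_chain G As B A'" "C \<subseteq> carrier G" "bij_betw (\<lambda>(a, h). a \<otimes> h) (C \<times> A') A"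
    by auto
  then have "A' \<subseteq> carrier G" using Cons by blast
  moreover have "A = (\<lambda>(a, h). a \<otimes> h) ` (C \<times> A')"
    using A'(3) by (simp add: bij_betw_def)
  ultimately show ?case using A'(2) by auto
qed simp

text \<open>The stabilizers to be factored are products in which only the left factor is abelian.
  Multiplying a chain for that factor by \<open>K\<close> on the right turns it into a chain for the
  product.\<close>

lemma (in monoid) factor_chain_mult:
  assumes "factor_chain G As B A" "\<forall>A\<in>set As. A \<noteq> {}" "B \<subseteq> carrier G" "K \<subseteq> carrier G"
    and "bij_betw (\<lambda>(a, k). a \<otimes> k) (A \<times> K) H"
  shows "factor_chain G As ((\<lambda>(a, k). a \<otimes> k) ` (B \<times> K)) H"
  using assms(1,2,5)
proof (induction As arbitrary: A H)
  case Nil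
  then show ?case by (auto simp: bij_betw_def)
next
  case (Cons C As)
  obtain A' where A': "factor_chain G As B A'" "C \<subseteq> carrier G" "bij_betw (\<lambda>(a, h). a \<otimes> h) (C \<times> A') A"
    using Cons.prems(1) by auto
  have A'c: "A' \<subseteq> carrier G" using factor_chain_closed[OF A'(1) assms(3)] .
  have Aeq: "A = (\<lambda>(a, h). a \<otimes> h) ` (C \<times> A')" using A'(3) by (simp add: bij_betw_def)
  have Heq: "H = (\<lambda>(a, h). a \<otimes> h) ` (A \<times> K)"
    using Cons.prems(3) by (simp add: bij_betw_def)
  have inj1: "c = c' \<and> a = a'" if "c \<in> C" "c' \<in> C" "a \<in> A'" "a' \<in> A'" "c \<otimes> a = c' \<otimes> a'" for c c' a a'
    using A'(3) that unfolding bij_betw_def inj_on_def by auto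
  have inj2: "a = a' \<and> k = k'" if "a \<in> A" "a' \<in> A" "k \<in> K" "k' \<in> K" "a \<otimes> k = a' \<otimes> k'" for a a' k k'
    using Cons.prems(3) that unfolding bij_betw_def inj_on_def by auto
  have inA: "c \<otimes> a \<in> A" if "c \<in> C" "a \<in> A'" for c a using that Aeq by auto
  have as: "c \<otimes> (a \<otimes> k) = c \<otimes> a \<otimes> k" if "c \<in> C" "a \<in> A'" "k \<in> K" for c a k
    using that A'(2) A'c assms(4) by (subst m_assoc) auto
  define H' where "H' = (\<lambda>(a, k). a \<otimes> k) ` (A' \<times> K)"
  \<comment> \<open>Uniqueness of a product of elements of \<open>A'\<close> and \<open>K\<close> is
    inherited from \<open>A\<close> only after multiplication by an element of \<open>C\<close> on
    the left, so one is fixed.\<close>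
  obtain c where c: "c \<in> C"
    using Cons.prems(2) by auto
  have "bij_betw (\<lambda>(a, k). a \<otimes> k) (A' \<times> K) H'"
    unfolding bij_betw_def H'_def
  proof (intro conjI refl inj_onI, clarify)
    fix a k a' k' assume h: "a \<in> A'" "k \<in> K" "a' \<in> A'" "k' \<in> K" "a \<otimes> k = a' \<otimes> k'"
    have "c \<otimes> a \<otimes> k = c \<otimes> a' \<otimes> k'" using h c as by metis
    then have "c \<otimes> a = c \<otimes> a' \<and> k = k'" using inj2 inA h c by blast
    then show "a = a' \<and> k = k'" using inj1 h c by blast
  qed
  then have "factor_chain G As ((\<lambda>(a, k). a \<otimes> k) ` (B \<times> K)) H'"
    using Cons A'(1) by auto
  moreover have "bij_betw (\<lambda>(a, h). a \<otimes> h) (C \<times> H') H"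
    unfolding bij_betw_def
  proof (intro conjI inj_onI; clarify?)
    fix c h c' h' assume x: "c \<in> C" "h \<in> H'" "c' \<in> C" "h' \<in> H'" "c \<otimes> h = c' \<otimes> h'"
    obtain a k where ak: "a \<in> A'" "k \<in> K" "h = a \<otimes> k"
      using x by (auto simp: H'_def)
    obtain a' k' where ak': "a' \<in> A'" "k' \<in> K" "h' = a' \<otimes> k'"
      using x by (auto simp: H'_def)
    have "c \<otimes> a \<otimes> k = c' \<otimes> a' \<otimes> k'" using x ak ak' as by metis
    then have "c \<otimes> a = c' \<otimes> a' \<and> k = k'" using inj2 inA x ak ak' by blast
    then show "c = c' \<and> h = h'" using inj1 x ak ak' by blast
  next
    show "(\<lambda>(a, h). a \<otimes> h) ` (C \<times> H') = H"
      unfolding Heq Aeq H'_def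
    proof (intro equalityI subsetI)
      fix y assume "y \<in> (\<lambda>(a, h). a \<otimes> h) ` (C \<times> (\<lambda>(a, k). a \<otimes> k) ` (A' \<times> K))"
      then obtain c a k where "c \<in> C" "a \<in> A'" "k \<in> K" "y = c \<otimes> (a \<otimes> k)" by auto
      then have "y = (\<lambda>(a, h). a \<otimes> h) (c \<otimes> a, k)" "(c \<otimes> a, k) \<in> (\<lambda>(a, h). a \<otimes> h) ` (C \<times> A') \<times> K"
        by (auto simp: as)
      then show "y \<in> (\<lambda>(a, h). a \<otimes> h) ` ((\<lambda>(a, h). a \<otimes> h) ` (C \<times> A') \<times> K)"
        by (rule image_eqI)
    next
      fix y assume "y \<in> (\<lambda>(a, h). a \<otimes> h) ` ((\<lambda>(a, h). a \<otimes> h) ` (C \<times> A') \<times> K)"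
      then obtain c a k where "c \<in> C" "a \<in> A'" "k \<in> K" "y = c \<otimes> a \<otimes> k" by auto
      then have "y = (\<lambda>(a, h). a \<otimes> h) (c, a \<otimes> k)" "(c, a \<otimes> k) \<in> C \<times> (\<lambda>(a, k). a \<otimes> k) ` (A' \<times> K)"
        by (auto simp: as)
      then show "y \<in> (\<lambda>(a, h). a \<otimes> h) ` (C \<times> (\<lambda>(a, k). a \<otimes> k) ` (A' \<times> K))"
        by (rule image_eqI)
    qed
  qed
  ultimately show ?case using A'(2) by auto
qed

lemma (in group) mls_rel_abelian_factor:
  assumes "finite (carrier G)" "subgroup T G" "\<And>a b. a \<in> T \<Longrightarrow> b \<in> T \<Longrightarrow> a \<otimes> b = b \<otimes> a"
    and "K \<subseteq> carrier G" "bij_betw (\<lambda>(a, k). a \<otimes> k) (T \<times> K) H"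
  shows "mls_rel G H K"
proof -
  have "mls_rel G T {\<one>}"
    using assms(1-3) by (intro mls_rel_abelian triv_subgroup) (auto simp: subgroup.one_closed)
  then obtain As where As: "factor_chain G As {\<one>} T" "\<forall>A\<in>set As. finite A \<and> A \<noteq> {}"
    "sum_list (map card As) = prime_weight (prod_list (map card As))"
    unfolding mls_rel_def by blast
  have "(\<lambda>(a, k). a \<otimes> k) ` ({\<one>} \<times> K) = K" using assms(4) by force
  then have "factor_chain G As K H" using factor_chain_mult[OF As(1) _ _ assms(4,5)] As(2) by auto
  then show ?thesis
    unfolding mls_rel_def using As by blast
qed

text \<open>Uniqueness modulo \<open>Z\<close> reduces to uniqueness upstairs: if the cosets of
  \<open>a \<otimes> h\<close> and \<open>a' \<otimes> h'\<close> agree, the two products differ by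
  some \<open>z\<close>, which is absorbed into \<open>h'\<close> because the tail is closed under
  multiplication by \<open>Z\<close>. That closure therefore travels through the same induction;
  injectivity on each factor keeps its size.\<close>

lemma (in group) factor_chain_quotient:
  assumes Z: "normal Z G" and central: "\<And>z g. z \<in> Z \<Longrightarrow> g \<in> carrier G \<Longrightarrow> z \<otimes> g = g \<otimes> z"
    and "factor_chain G As Z H" "\<forall>A\<in>set As. A \<noteq> {}" "H \<noteq> {}"
  shows "(\<forall>h\<in>H. \<forall>z\<in>Z. h \<otimes> z \<in> H) \<and>
    (\<forall>A\<in>set As. A \<subseteq> carrier G \<and> inj_on (\<lambda>a. Z #> a) A) \<and>
    bij_betw (\<lambda>xs. foldr (\<lambda>a b. a \<otimes>\<^bsub>G Mod Z\<^esub> b) xs \<one>\<^bsub>G Mod Z\<^esub>)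
      (listset (map (\<lambda>A. (\<lambda>a. Z #> a) ` A) As)) ((\<lambda>a. Z #> a) ` H)"
  using assms(3-)
proof (induction As arbitrary: H)
  case Nil
  interpret normal Z G by (fact Z)
  have "Z #> z = Z" if "z \<in> Z" for z using that by (simp add: coset_join2 is_subgroup)
  then have "(#>) Z ` Z = {Z}" using one_closed by blast
  then show ?case using Nil by (auto simp: FactGroup_def bij_betw_def)
next
  case (Cons A As)
  interpret normal Z G by (fact Z)
  obtain H' where H': "factor_chain G As Z H'" "A \<subseteq> carrier G" "bij_betw (\<lambda>(a, h). a \<otimes> h) (A \<times> H') H"
    using Cons.prems(1) by auto
  have Heq: "H = (\<lambda>(a, h). a \<otimes> h) ` (A \<times> H')" using H'(3) by (simp add: bij_betw_def)
  have H'ne: "H' \<noteq> {}" using Heq Cons.prems(3) by auto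
  have "\<forall>A\<in>set As. A \<noteq> {}" using Cons.prems(2) by simp
  note IH = Cons.IH[OF H'(1) this H'ne]
  have sat: "h \<otimes> z \<in> H'" if "h \<in> H'" "z \<in> Z" for h z using conjunct1[OF IH] that by blast
  have H'c: "H' \<subseteq> carrier G" using factor_chain_closed[OF H'(1) subset] .
  have inj1: "c = c' \<and> a = a'" if "c \<in> A" "c' \<in> A" "a \<in> H'" "a' \<in> H'" "c \<otimes> a = c' \<otimes> a'" for c c' a a'
    using H'(3) that unfolding bij_betw_def inj_on_def by auto
  have coset: "Z #> a = Z #> b \<longleftrightarrow> (\<exists>z\<in>Z. a = b \<otimes> z)" if ab: "a \<in> carrier G" "b \<in> carrier G" for a b
  proof
    assume "Z #> a = Z #> b"
    then have "a \<in> Z #> b" using rcos_self[OF ab(1) is_subgroup] by simp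
    then obtain z where "z \<in> Z" "a = z \<otimes> b" by (auto simp: r_coset_def)
    then show "\<exists>z\<in>Z. a = b \<otimes> z" using ab(2) by (auto simp: central)
  next
    assume "\<exists>z\<in>Z. a = b \<otimes> z"
    then obtain z where z: "z \<in> Z" "a = b \<otimes> z" by blast
    then have "a = z \<otimes> b" using central[OF z(1) ab(2)] by simp
    then have "a \<in> Z #> b"
      unfolding r_coset_def using z(1) by blast
    then show "Z #> a = Z #> b" using repr_independence[OF _ ab(2) is_subgroup] by simp
  qed
  have key: "a = a' \<and> Z #> h = Z #> h'"
    if k: "a \<in> A" "a' \<in> A" "h \<in> H'" "h' \<in> H'" "Z #> (a \<otimes> h) = Z #> (a' \<otimes> h')" for a a' h h'
  proof -
    have c: "a \<in> carrier G" "a' \<in> carrier G" "h \<in> carrier G" "h' \<in> carrier G"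
      using that H'(2) H'c by auto
    obtain z where z: "z \<in> Z" "a \<otimes> h = a' \<otimes> h' \<otimes> z"
      using iffD1[OF coset k(5)] c by blast
    then have "a \<otimes> h = a' \<otimes> (h' \<otimes> z)" using c by (simp add: m_assoc)
    then have "a = a' \<and> h = h' \<otimes> z" using inj1 k sat z by blast
    then show ?thesis using iffD2[OF coset[OF c(3,4)]] z(1) by blast
  qed
  have injA: "inj_on (\<lambda>a. Z #> a) A"
  proof (rule inj_onI)
    fix a a' assume h: "a \<in> A" "a' \<in> A" "Z #> a = Z #> a'"
    obtain k where k: "k \<in> H'"
      using H'ne by auto
    have c: "a \<in> carrier G" "a' \<in> carrier G" "k \<in> carrier G" using h k H'(2) H'c by auto
    have "Z #> (a \<otimes> k) = Z #> (a' \<otimes> k)"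
      using c h(3) coset_mult_assoc[OF subset c(1,3)] coset_mult_assoc[OF subset c(2,3)] by simp
    then show "a = a'" using key h k by blast
  qed
  have mult: "(Z #> a) <#> (Z #> h) = Z #> (a \<otimes> h)" if "a \<in> carrier G" "h \<in> carrier G" for a h
    using that by (rule rcos_sum)
  have inA: "a \<in> carrier G" if "a \<in> A" for a using that H'(2) by blast
  have inH: "h \<in> carrier G" if "h \<in> H'" for h using that H'c by blast
  let ?\<pi> = "\<lambda>a. Z #> a"
  let ?f = "\<lambda>xs. foldr (\<lambda>a b. a \<otimes>\<^bsub>G Mod Z\<^esub> b) xs \<one>\<^bsub>G Mod Z\<^esub>"
  let ?L = "listset (map (\<lambda>A. ?\<pi> ` A) As)"
  have bIH: "bij_betw ?f ?L (?\<pi> ` H')" using IH by blast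
  have "bij_betw ?f (set_Cons (?\<pi> ` A) ?L) (?\<pi> ` H)"
    unfolding bij_betw_def
  proof
    show "inj_on ?f (set_Cons (?\<pi> ` A) ?L)"
    proof (rule inj_onI)
      fix xs ys assume x: "xs \<in> set_Cons (?\<pi> ` A) ?L" "ys \<in> set_Cons (?\<pi> ` A) ?L" "?f xs = ?f ys"
      obtain a us where a: "a \<in> A" "us \<in> ?L" "xs = ?\<pi> a # us"
        using x(1) by (auto simp: set_Cons_def)
      obtain b vs where b: "b \<in> A" "vs \<in> ?L" "ys = ?\<pi> b # vs"
        using x(2) by (auto simp: set_Cons_def)
      obtain h where h: "h \<in> H'" "?f us = ?\<pi> h"
        using bIH a unfolding bij_betw_def by blast
      obtain k where k: "k \<in> H'" "?f vs = ?\<pi> k"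
        using bIH b unfolding bij_betw_def by blast
      have "?\<pi> (a \<otimes> h) = ?f xs" using a h by (simp add: FactGroup_def mult inA inH)
      moreover have "?\<pi> (b \<otimes> k) = ?f ys" using b k by (simp add: FactGroup_def mult inA inH)
      ultimately have "?\<pi> (a \<otimes> h) = ?\<pi> (b \<otimes> k)" using x(3) by simp
      from key[OF a(1) b(1) h(1) k(1) this] have "a = b" "?f us = ?f vs"
        using h(2) k(2) by simp_all
      moreover from this(2) have "us = vs" using inj_onD[OF bij_betw_imp_inj_on[OF bIH]] a(2) b(2) by blast
      ultimately show "xs = ys" using a(3) b(3) by simp
    qed
    show "?f ` set_Cons (?\<pi> ` A) ?L = ?\<pi> ` H"
    proof (intro equalityI subsetI)
      fix y assume "y \<in> ?f ` set_Cons (?\<pi> ` A) ?L"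
      then obtain a us where a: "a \<in> A" "us \<in> ?L" "y = ?f (?\<pi> a # us)"
        by (auto simp: set_Cons_def)
      obtain h where h: "h \<in> H'" "?f us = ?\<pi> h"
        using bIH a unfolding bij_betw_def by blast
      have "y = ?\<pi> (a \<otimes> h)" using a h by (simp add: FactGroup_def mult inA inH)
      then show "y \<in> ?\<pi> ` H" using Heq a h by auto
    next
      fix y assume "y \<in> ?\<pi> ` H"
      then obtain a h where a: "a \<in> A" "h \<in> H'" "y = ?\<pi> (a \<otimes> h)" using Heq by auto
      obtain us where us: "us \<in> ?L" "?f us = ?\<pi> h"
        using bIH a(2) unfolding bij_betw_def by (metis (no_types, lifting) image_iff)
      have "y = ?f (?\<pi> a # us)" using a us by (simp add: FactGroup_def mult inA inH)
      moreover have "?\<pi> a # us \<in> set_Cons (?\<pi> ` A) ?L" using a us by (auto simp: set_Cons_def)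
      ultimately show "y \<in> ?f ` set_Cons (?\<pi> ` A) ?L" by blast
    qed
  qed
  moreover have "h \<otimes> z \<in> H" if h: "h \<in> H" and z: "z \<in> Z" for h z
  proof -
    obtain a k where a: "a \<in> A" "k \<in> H'" "h = a \<otimes> k"
      using h Heq by auto
    then have "h \<otimes> z = a \<otimes> (k \<otimes> z)"
      using H'(2) H'c z by (subst m_assoc[symmetric]) auto
    then show ?thesis using a sat z Heq by auto
  qed
  ultimately show ?case using conjunct1[OF conjunct2[OF IH]] H'(2) injA by simp
qed

lemma card_listset: "card (listset As) = prod_list (map card As)"
proof (induction As)
  case (Cons A As)
  have "listset (A # As) = (\<lambda>(x, xs). x # xs) ` (A \<times> listset As)" by (auto simp: set_Cons_def)
  moreover have "inj_on (\<lambda>(x, xs). x # xs) (A \<times> listset As)" by (auto simp: inj_on_def)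
  ultimately show ?case using Cons by (simp add: card_image card_cartesian_product)
qed simp

lemma (in group) has_MLS_quotient:
  assumes Z: "normal Z G" and central: "\<And>z g. z \<in> Z \<Longrightarrow> g \<in> carrier G \<Longrightarrow> z \<otimes> g = g \<otimes> z"
    and m: "mls_rel G (carrier G) Z"
  shows "has_MLS (G Mod Z)"
proof -
  obtain As where As: "factor_chain G As Z (carrier G)" "\<forall>A\<in>set As. finite A \<and> A \<noteq> {}"
    "sum_list (map card As) = prime_weight (prod_list (map card As))"
    using m unfolding mls_rel_def by blast
  have "\<forall>A\<in>set As. A \<noteq> {}" "carrier G \<noteq> {}" using As(2) by auto
  note q = factor_chain_quotient[OF Z central As(1) this]
  define Bs where "Bs = map (\<lambda>A. (\<lambda>a. Z #> a) ` A) As"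
  have carr: "carrier (G Mod Z) = (\<lambda>a. Z #> a) ` carrier G" by (auto simp: FactGroup_def RCOSETS_def)
  have cards: "map card Bs = map card As"
    unfolding Bs_def using q by (auto intro!: card_image)
  have ls: "is_log_sig (G Mod Z) Bs"
    unfolding is_log_sig_def carr Bs_def using q by (auto intro!: image_eqI)
  \<comment> \<open>The signature itself yields the order of the quotient, so the bound in
    \<open>has_MLS\<close> becomes the weight of the product of the factor sizes.\<close>
  then have "card (carrier (G Mod Z)) = prod_list (map card As)"
    unfolding is_log_sig_def using card_listset[of Bs] cards by (metis bij_betw_same_card)
  then show ?thesis
    unfolding has_MLS_def log_sig_length_def
    using ls As(3) cards by (auto simp: prime_weight_def)
qed

lemma (in group) group_center_normal: "normal (group_center G) G"
proof -
  have "subgroup (group_center G) G"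
  proof (rule subgroupI)
    show "group_center G \<noteq> {}" by (auto simp: group_center_def intro!: exI[of _ \<one>])
  next
    fix a assume a: "a \<in> group_center G"
    have "inv a \<otimes> g = g \<otimes> inv a" if g: "g \<in> carrier G" for g
    proof -
      have c: "a \<in> carrier G" "a \<otimes> g = g \<otimes> a" using a g by (auto simp: group_center_def)
      have "inv a \<otimes> g = inv a \<otimes> (g \<otimes> a \<otimes> inv a)"
        using c(1) g by (simp add: m_assoc)
      also have "\<dots> = inv a \<otimes> (a \<otimes> g \<otimes> inv a)" by (simp only: c(2))
      also have "\<dots> = g \<otimes> inv a" using c(1) g by (simp add: m_assoc[symmetric])
      finally show ?thesis .
    qed
    moreover have "inv a \<in> carrier G" using a unfolding group_center_def by blast
    ultimately show "inv a \<in> group_center G"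
      unfolding group_center_def by blast
  next
    fix a b assume ab: "a \<in> group_center G" "b \<in> group_center G"
    have "a \<otimes> b \<otimes> g = g \<otimes> (a \<otimes> b)" if g: "g \<in> carrier G" for g
    proof -
      have c: "a \<in> carrier G" "b \<in> carrier G" "a \<otimes> g = g \<otimes> a" "b \<otimes> g = g \<otimes> b"
        using ab g by (auto simp: group_center_def)
      have "a \<otimes> b \<otimes> g = a \<otimes> g \<otimes> b" using c(1,2,4) g by (simp add: m_assoc)
      also have "\<dots> = g \<otimes> (a \<otimes> b)" by (simp only: c(3) m_assoc[OF g c(1,2)])
      finally show ?thesis .
    qed
    moreover have "a \<otimes> b \<in> carrier G" using ab unfolding group_center_def by blast
    ultimately show "a \<otimes> b \<in> group_center G"
      unfolding group_center_def by blast
  qed (simp add: group_center_def)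
  moreover have "x \<otimes> a \<otimes> inv x \<in> group_center G" if "x \<in> carrier G" "a \<in> group_center G" for x a
  proof -
    have c: "a \<in> carrier G" "a \<otimes> x = x \<otimes> a" using that by (auto simp: group_center_def)
    have "x \<otimes> a \<otimes> inv x = a \<otimes> x \<otimes> inv x" by (simp only: c(2))
    also have "\<dots> = a" using that(1) c(1) by (simp add: m_assoc)
    finally have "x \<otimes> a \<otimes> inv x = a" .
    then show ?thesis using that by simp
  qed
  ultimately show ?thesis by (rule normal_invI)
qed

text \<open>All cycles of \<open>\<gamma>\<close> on \<open>\<Omega>\<close> have length exactly
  \<open>n\<close>, so one point from each is enough. The statement concerns a bare map because it
  is applied to field elements, to pairs of them and to points alike.\<close>

lemma free_orbit_representatives:
  assumes "finite \<Omega>" and "n > 0" and "\<And>w. w \<in> \<Omega> \<Longrightarrow> \<gamma> w \<in> \<Omega>"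
    and "\<And>w. w \<in> \<Omega> \<Longrightarrow> (\<gamma> ^^ n) w = w"
    and "\<And>w i. w \<in> \<Omega> \<Longrightarrow> 0 < i \<Longrightarrow> i < n \<Longrightarrow> (\<gamma> ^^ i) w \<noteq> w"
  shows "\<exists>R\<subseteq>\<Omega>. bij_betw (\<lambda>(i, w). (\<gamma> ^^ i) w) ({..<n} \<times> R) \<Omega>"
  using assms
proof (induction "card \<Omega>" arbitrary: \<Omega> rule: less_induct)
  case less
  show ?case
  proof (cases "\<Omega> = {}")
    case True
    then show ?thesis by (intro exI[of _ "{}"]) (auto simp: bij_betw_def)
  next
    case False
    have closed: "(\<gamma> ^^ i) w \<in> \<Omega>" if "w \<in> \<Omega>" for i w
      using that less.prems(3) by (induction i) auto
    have per: "(\<gamma> ^^ (n * k)) w = w" if "w \<in> \<Omega>" for k w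
      using that less.prems(4) by (induction k) (auto simp: funpow_add)
    have red: "(\<gamma> ^^ i) w = (\<gamma> ^^ (i mod n)) w" if "w \<in> \<Omega>" for i w
    proof -
      have "(\<gamma> ^^ i) w = (\<gamma> ^^ (i mod n + n * (i div n))) w" by simp
      also have "\<dots> = (\<gamma> ^^ (i mod n)) w"
        unfolding funpow_add using per[OF that] by simp
      finally show ?thesis .
    qed
    have le: "i = j" if "w \<in> \<Omega>" "i \<le> j" "j < n" "(\<gamma> ^^ i) w = (\<gamma> ^^ j) w" for i j w
    proof (rule ccontr)
      assume "i \<noteq> j"
      have "(\<gamma> ^^ (n - i)) ((\<gamma> ^^ i) w) = w"
      proof -
        have "n = (n - i) + i" using that by simp
        then have "(\<gamma> ^^ n) w = (\<gamma> ^^ (n - i)) ((\<gamma> ^^ i) w)"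
          by (metis funpow_add o_apply)
        then show ?thesis using less.prems(4) that by simp
      qed
      then have "w = (\<gamma> ^^ (n - i)) ((\<gamma> ^^ j) w)" using that by simp
      also have "\<dots> = (\<gamma> ^^ (n - i + j)) w" by (simp add: funpow_add)
      also have "\<dots> = (\<gamma> ^^ (j - i)) w"
      proof -
        have "n - i + j = (j - i) + n * 1" using that by simp
        then show ?thesis using per[OF that(1), of 1] by (simp add: funpow_add)
      qed
      finally have "w = (\<gamma> ^^ (j - i)) w" .
      moreover have "0 < j - i" "j - i < n" using that(2,3) \<open>i \<noteq> j\<close> by simp_all
      ultimately show False using less.prems(5)[OF that(1)] by metis
    qed
    have inj: "i = j" if "w \<in> \<Omega>" "i < n" "j < n" "(\<gamma> ^^ i) w = (\<gamma> ^^ j) w" for i j w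
      using le[of w i j] le[of w j i] that by (metis nat_le_linear)
    obtain w0 where w0: "w0 \<in> \<Omega>"
      using False by blast
    define Orb where "Orb = (\<lambda>i. (\<gamma> ^^ i) w0) ` {..<n}"
    have orb: "(\<gamma> ^^ i) w0 \<in> Orb" for i using red[OF w0, of i] less.prems(2) by (simp add: Orb_def)
    have "Orb \<subseteq> \<Omega>" using closed w0 by (auto simp: Orb_def)
    \<comment> \<open>On \<open>\<Omega>\<close> the map is inverted by
      \<open>\<gamma> ^^ (n - 1)\<close>, so no point outside the orbit is sent into it.\<close>
    have inv: "\<gamma> w \<in> \<Omega> - Orb" if "w \<in> \<Omega> - Orb" for w
    proof -
      have False if g: "\<gamma> w \<in> Orb"
      proof -
        obtain i where i: "\<gamma> w = (\<gamma> ^^ i) w0"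
          using g by (auto simp: Orb_def)
        have "w = (\<gamma> ^^ n) w" using less.prems(4) \<open>w \<in> \<Omega> - Orb\<close> by simp
        also have "\<dots> = (\<gamma> ^^ (n - 1)) (\<gamma> w)"
          using less.prems(2) by (metis Suc_diff_1 funpow_Suc_right o_apply)
        also have "\<dots> = (\<gamma> ^^ (n - 1 + i)) w0" by (simp add: i funpow_add)
        finally show False using orb[of "n - 1 + i"] \<open>w \<in> \<Omega> - Orb\<close> by simp
      qed
      then show ?thesis using that less.prems(3) by auto
    qed
    have "w0 \<in> Orb" using orb[of 0] by simp
    then have "card (\<Omega> - Orb) < card \<Omega>" using w0 less.prems(1) by (intro psubset_card_mono) auto
    then obtain R where R: "R \<subseteq> \<Omega> - Orb" "bij_betw (\<lambda>(i, w). (\<gamma> ^^ i) w) ({..<n} \<times> R) (\<Omega> - Orb)"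
      using less.hyps[of "\<Omega> - Orb"] less.prems inv by auto
    have "bij_betw (\<lambda>(i, w). (\<gamma> ^^ i) w) ({..<n} \<times> {w0}) Orb"
      unfolding bij_betw_def using inj[OF w0] by (auto simp: inj_on_def Orb_def)
    then have "bij_betw (\<lambda>(i, w). (\<gamma> ^^ i) w) ({..<n} \<times> {w0} \<union> {..<n} \<times> R) (Orb \<union> (\<Omega> - Orb))"
      using R(2) by (rule bij_betw_combine) auto
    moreover have "{..<n} \<times> {w0} \<union> {..<n} \<times> R = {..<n} \<times> insert w0 R" "Orb \<union> (\<Omega> - Orb) = \<Omega>"
      using \<open>Orb \<subseteq> \<Omega>\<close> by auto
    ultimately show ?thesis using R(1) w0 by (intro exI[of _ "insert w0 R"]) auto
  qed
qed

section \<open>Roots of unity\<close>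

text \<open>A root \<open>a\<close> is divided out. At any root of the cofactor \<open>r\<close> the
  derivative of \<open>p\<close> is \<open>x - a\<close> times that of \<open>r\<close>, so
  \<open>r\<close> is separable again, and \<open>a\<close> itself is not a root of
  \<open>r\<close>.\<close>

lemma card_roots_of_separable:
  fixes p :: "'k::alg_closed_field poly"
  assumes "p \<noteq> 0" "\<And>a. poly p a = 0 \<Longrightarrow> poly (pderiv p) a \<noteq> 0"
  shows "card {x. poly p x = 0} = degree p"
  using assms
proof (induction "degree p" arbitrary: p)
  case 0
  then have "{x. poly p x = 0} = {}"
    by (metis (mono_tags, lifting) degree_eq_zeroE empty_Collect_eq pCons_0_0 poly_const_conv)
  then show ?case using 0 by (simp only: card.empty)
next
  case (Suc n)
  obtain a where a: "poly p a = 0"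
    using alg_closed_imp_poly_has_root[of p] Suc.hyps(2) by auto
  then obtain r where r: "p = [:-a, 1:] * r" by (auto simp: poly_eq_0_iff_dvd dvd_def)
  have r0: "r \<noteq> 0" using Suc.prems(1) r by auto
  have deg: "degree p = Suc (degree r)" using r0 by (subst r, subst degree_mult_eq) auto
  have pd: "poly (pderiv p) x = poly r x + (x - a) * poly (pderiv r) x" for x
    unfolding r pderiv_mult by (simp add: pderiv_pCons algebra_simps)
  have ra: "poly r a \<noteq> 0" using Suc.prems(2)[OF a] pd[of a] by simp
  have "card {x. poly r x = 0} = degree r"
  proof (rule Suc.hyps(1))
    show "n = degree r" using deg Suc.hyps(2) by simp
    fix x assume x: "poly r x = 0"
    then have "poly p x = 0" by (simp add: r)
    then show "poly (pderiv r) x \<noteq> 0" using Suc.prems(2)[of x] pd[of x] x by auto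
  qed (fact r0)
  moreover have "{x. poly p x = 0} = insert a {x. poly r x = 0}" by (auto simp: r)
  ultimately show ?case using ra deg poly_roots_finite[OF r0] by simp
qed

lemma card_roots_of_unity_alg_closed:
  assumes "of_nat n \<noteq> (0 :: 'k::alg_closed_field)"
  shows "card {x::'k. x ^ n = 1} = n"
proof -
  define p :: "'k poly" where "p = monom 1 n - 1"
  have n: "n > 0" using assms by (cases n) auto
  have coeffn: "coeff p n = 1" using n by (simp add: p_def)
  have deg: "degree p = n"
  proof (rule antisym)
    show "degree p \<le> n"
      unfolding p_def by (rule order_trans[OF degree_diff_le_max]) (simp add: degree_monom_eq)
    show "n \<le> degree p" using coeffn by (intro le_degree) simp
  qed
  have pv: "poly p x = x ^ n - 1" for x by (simp add: p_def poly_monom)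
  have "card {x. poly p x = 0} = degree p"
  proof (rule card_roots_of_separable)
    show "p \<noteq> 0" using coeffn by auto
    fix a assume "poly p a = 0"
    then have "a ^ n = 1" by (simp add: pv)
    then have "a \<noteq> 0" using n by (auto simp: power_0_left)
    moreover have "poly (pderiv p) a = of_nat n * a ^ (n - 1)"
      by (simp add: p_def pderiv_diff pderiv_monom poly_monom pderiv_1)
    ultimately show "poly (pderiv p) a \<noteq> 0" using assms by simp
  qed
  then show ?thesis by (simp add: pv deg)
qed

lemma card_power_eq_le:
  fixes y :: "'k::field"
  assumes "n > 0"
  shows "finite {x::'k. x ^ n = y}" "card {x::'k. x ^ n = y} \<le> n"
proof -
  define p :: "'k poly" where "p = monom 1 n - [:y:]"
  have "coeff p n = 1" using assms by (cases n) (auto simp: p_def)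
  then have p0: "p \<noteq> 0" by auto
  have eq: "{x. x ^ n = y} = {x. poly p x = 0}" by (auto simp: p_def poly_monom)
  show "finite {x::'k. x ^ n = y}"
    unfolding eq by (rule poly_roots_finite[OF p0])
  have "card {x. poly p x = 0} \<le> degree p" by (rule card_poly_roots_bound[OF p0])
  also have "\<dots> \<le> n"
    unfolding p_def by (rule order_trans[OF degree_diff_le_max]) (simp add: degree_monom_eq)
  finally show "card {x::'k. x ^ n = y} \<le> n" by (simp add: eq)
qed

lemma power_gcd_eq_1:
  fixes x :: "'k::field"
  assumes "x ^ a = 1" "x ^ b = 1"
  shows "x ^ gcd a b = 1"
proof (cases "a = 0")
  case True
  then show ?thesis using assms by simp
next
  case False
  then obtain u v where "a * u = b * v + gcd a b" using bezout_nat by blast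
  then have "x ^ (a * u) = x ^ (b * v) * x ^ gcd a b" by (simp add: power_add)
  then show ?thesis using assms by (simp add: power_mult)
qed

lemma power_prime_power_eq_1_iff:
  fixes y :: "'k::field"
  assumes "prime l" "k > 0" "y ^ (l ^ k) = 1" "y ^ (l ^ (k - 1)) \<noteq> 1" "y ^ m = 1"
  shows "l ^ k dvd m"
proof -
  have "gcd m (l ^ k) dvd l ^ k" by simp
  then obtain j where j: "j \<le> k" "gcd m (l ^ k) = l ^ j" using assms(1) divides_primepow_nat by blast
  have yj: "y ^ (l ^ j) = 1" using power_gcd_eq_1[OF assms(5,3)] j by simp
  have "j = k"
  proof (rule ccontr)
    assume "j \<noteq> k"
    then have "l ^ (k - 1) = l ^ j * l ^ (k - 1 - j)" using j by (simp flip: power_add)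
    then show False using yj assms(4) by (simp add: power_mult)
  qed
  then show ?thesis using j by (metis gcd_dvd1)
qed

text \<open>The classical proof of cyclicity: \<open>x ^ (n div l) = 1\<close> has too few
  solutions, which for each prime \<open>l\<close> gives an element whose order is the full
  \<open>l\<close>-part of \<open>n\<close>; the product over all \<open>l\<close> has order
  \<open>n\<close>. The root count is a hypothesis so that finite fields and the algebraic closure
  are both covered.\<close>

lemma primitive_root_of_unity_exists:
  assumes n: "n > 0" and c: "card {x::'k::field. x ^ n = 1} = n"
  shows "\<exists>u::'k. \<forall>i. u ^ i = 1 \<longleftrightarrow> n dvd i"
proof -
  define e where "e l = l ^ multiplicity l n" for l
  have el: "e l dvd n" for l by (simp add: e_def multiplicity_dvd)
  have mp: "multiplicity l n > 0" if "prime l" "l dvd n" for l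
    using that n by (simp add: prime_multiplicity_gt_zero_iff)
  have "\<exists>y::'k. y ^ e l = 1 \<and> y ^ (l ^ (multiplicity l n - 1)) \<noteq> 1" if l: "l \<in> prime_factors n" for l
  proof -
    have pl: "prime l" "l dvd n" using l by auto
    have "n div l > 0" "n div l < n"
      using pl n prime_gt_1_nat[OF pl(1)] by (auto simp: div_greater_zero_iff dvd_imp_le)
    then have "\<not> {x::'k. x ^ n = 1} \<subseteq> {x. x ^ (n div l) = 1}"
      using card_power_eq_le[of "n div l" "1::'k"] c card_mono by (metis leD order_trans)
    then obtain x :: 'k where x: "x ^ n = 1" "x ^ (n div l) \<noteq> 1" by blast
    have e2: "e l = l * l ^ (multiplicity l n - 1)" using mp[OF pl] by (simp add: e_def flip: power_Suc)
    have "(n div e l) * l ^ (multiplicity l n - 1) * l = n"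
      using el[of l] by (simp add: e2 mult_ac) (metis dvd_mult_div_cancel e2 mult.assoc mult.commute)
    then have "n div e l * l ^ (multiplicity l n - 1) = n div l"
      using pl by (metis mult.commute nonzero_mult_div_cancel_left not_prime_0)
    then show ?thesis using x el[of l] by (intro exI[of _ "x ^ (n div e l)"]) (simp flip: power_mult)
  qed
  then obtain y :: "nat \<Rightarrow> 'k" where y: "\<And>l. l \<in> prime_factors n \<Longrightarrow> y l ^ e l = 1"
    "\<And>l. l \<in> prime_factors n \<Longrightarrow> y l ^ (l ^ (multiplicity l n - 1)) \<noteq> 1"
    by metis
  define u where "u = (\<Prod>l\<in>prime_factors n. y l)"
  have "y l ^ n = 1" if "l \<in> prime_factors n" for l
    using y(1)[OF that] el[of l] by (metis dvd_def power_mult power_one)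
  then have un: "u ^ n = 1" by (simp add: u_def prod_power_distrib)
  have "n dvd i" if ui: "u ^ i = 1" for i
  proof (cases "i = 0")
    case False
    have "e l dvd i" if l: "l \<in> prime_factors n" for l
    proof -
      have pl: "prime l" "l dvd n" using l by auto
      define n' where "n' = n div e l"
      have nn: "n = e l * n'" using el[of l] by (simp add: n'_def)
      have cop: "coprime (e l) n'"
      proof -
        have "\<not> l dvd n'" using multiplicity_decompose[of n l] n pl unfolding n'_def e_def
          by (metis not_prime_unit not_gr_zero)
        then show ?thesis using pl(1) by (simp add: e_def prime_imp_coprime)
      qed
      have other: "y l' ^ n' = 1" if l': "l' \<in> prime_factors n - {l}" for l'
      proof -
        have "coprime (e l') (e l)" using l' pl primes_coprime[of l' l] by (auto simp: e_def)
        then have "e l' dvd n'" using el[of l'] nn by (metis coprime_dvd_mult_right_iff)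
        then show ?thesis using y(1)[of l'] l' by (metis DiffD1 dvd_def power_mult power_one)
      qed
      \<comment> \<open>The exponent \<open>n'\<close> annihilates every component except the one at
        \<open>l\<close>, and it is prime to the order of that one.\<close>
      have "1 = (u ^ i) ^ n'" using ui by simp
      also have "\<dots> = (\<Prod>l'\<in>prime_factors n. (y l' ^ n') ^ i)"
        by (simp add: u_def prod_power_distrib mult.commute flip: power_mult)
      also have "\<dots> = (y l ^ n') ^ i * (\<Prod>l'\<in>prime_factors n - {l}. (y l' ^ n') ^ i)"
        using l by (subst prod.remove[of _ l]) auto
      also have "(\<Prod>l'\<in>prime_factors n - {l}. (y l' ^ n') ^ i) = 1"
        using other by (intro prod.neutral) auto
      finally have "y l ^ (n' * i) = 1" by (simp add: power_mult)
      then have "e l dvd n' * i"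
        using power_prime_power_eq_1_iff[OF pl(1) mp[OF pl]] y[OF l] unfolding e_def by blast
      then show ?thesis using cop by (simp add: coprime_dvd_mult_right_iff)
    qed
    then have "multiplicity l n \<le> multiplicity l i" if l: "prime l" for l
    proof (cases "l dvd n")
      case True
      then have "l ^ multiplicity l n dvd i"
        using l n \<open>\<And>l. l \<in> prime_factors n \<Longrightarrow> e l dvd i\<close>[of l] unfolding e_def
        by (simp add: in_prime_factors_iff)
      then show ?thesis using False l by (intro multiplicity_geI) (auto simp: prime_nat_iff)
    qed (simp add: not_dvd_imp_multiplicity_0)
    then show ?thesis using n by (intro multiplicity_le_imp_dvd) auto
  qed simp
  then show ?thesis using un by (metis dvd_def power_mult power_one)
qed

text \<open>Both claims come from one count: for nonzero \<open>x\<close>, \<open>x ^ m\<close> is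
  an \<open>n\<close>-th root of unity with at most \<open>m\<close> preimages, so at least
  \<open>n\<close> such roots are hit, while at most \<open>n\<close> exist. With
  \<open>m = q + 1\<close> this gives surjectivity of the norm, with \<open>m = q - 1\<close>
  Hilbert's theorem 90.\<close>

lemma finite_field_power_image:
  fixes n m :: nat
  assumes "n * m = CARD('k::{field,finite}) - 1"
  shows "card {y::'k. y ^ n = 1} = n"
    and "y ^ n = 1 \<Longrightarrow> \<exists>x::'k. x \<noteq> 0 \<and> x ^ m = y"
proof -
  have c1: "CARD('k) > 1" using card_mono[of "UNIV :: 'k set" "{0, 1}"] by simp
  then have nm: "n > 0" "m > 0" using assms by (auto intro!: gr0I)
  let ?U = "UNIV - {0 :: 'k}"
  have cU: "card ?U = n * m" using assms by (simp add: card_Diff_singleton)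
  let ?im = "(\<lambda>x. x ^ m) ` ?U"
  \<comment> \<open>Fermat's argument: multiplication by \<open>x\<close> permutes the nonzero
    elements, so their product is unchanged.\<close>
  have one: "x ^ (CARD('k) - 1) = 1" if "x \<noteq> 0" for x :: 'k
  proof -
    have "(\<Prod>y\<in>?U. x * y) = (\<Prod>y\<in>?U. y)"
      by (rule prod.reindex_bij_witness[of _ "\<lambda>y. y / x" "\<lambda>y. x * y"]) (use that in auto)
    then have "x ^ card ?U * (\<Prod>y\<in>?U. y) = (\<Prod>y\<in>?U. y)" by (simp add: prod.distrib)
    moreover have "(\<Prod>y\<in>?U. y) \<noteq> 0" by simp
    ultimately show ?thesis using cU assms by simp
  qed
  have sub: "?im \<subseteq> {y. y ^ n = 1}"
    using one by (auto simp: assms mult.commute[of m n] simp flip: power_mult)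
  have "n * m \<le> card ?im * m"
  proof -
    have "card ?U = (\<Sum>y\<in>?im. card {x \<in> ?U. x ^ m = y})"
      using sum.image_gen[of ?U "\<lambda>_. 1 :: nat" "\<lambda>x. x ^ m"] by simp
    also have "\<dots> \<le> (\<Sum>y\<in>?im. m)"
    proof (rule sum_mono)
      fix y :: 'k
      have "card {x \<in> ?U. x ^ m = y} \<le> card {x. x ^ m = y}" by (rule card_mono) auto
      then show "card {x \<in> ?U. x ^ m = y} \<le> m" using card_power_eq_le(2)[OF nm(2), of y] by simp
    qed
    finally show ?thesis using cU by simp
  qed
  then have "n \<le> card ?im" using nm by simp
  moreover have "card ?im \<le> card {y::'k. y ^ n = 1}" by (rule card_mono[OF _ sub]) simp
  moreover have "card {y::'k. y ^ n = 1} \<le> n" by (rule card_power_eq_le(2)[OF nm(1)])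
  ultimately have "card {y::'k. y ^ n = 1} = n" "card ?im = card {y::'k. y ^ n = 1}" by auto
  then have im: "{y. y ^ n = 1} = ?im" by (intro card_subset_eq[OF _ sub, symmetric]) auto
  show "card {y::'k. y ^ n = 1} = n" by fact
  show "\<exists>x::'k. x \<noteq> 0 \<and> x ^ m = y" if "y ^ n = 1"
  proof -
    have "y \<in> ?im" using that unfolding im[symmetric] by simp
    then show ?thesis by blast
  qed
qed

section \<open>Hermitian geometry of dimension four\<close>

lemma det_4:
  fixes A :: "'b::comm_ring_1^4^4"
  shows "det A =
    A$1$1 * (A$2$2 * (A$3$3 * A$4$4 - A$3$4 * A$4$3) - A$2$3 * (A$3$2 * A$4$4 - A$3$4 * A$4$2) + A$2$4 * (A$3$2 * A$4$3 - A$3$3 * A$4$2))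
  - A$1$2 * (A$2$1 * (A$3$3 * A$4$4 - A$3$4 * A$4$3) - A$2$3 * (A$3$1 * A$4$4 - A$3$4 * A$4$1) + A$2$4 * (A$3$1 * A$4$3 - A$3$3 * A$4$1))
  + A$1$3 * (A$2$1 * (A$3$2 * A$4$4 - A$3$4 * A$4$2) - A$2$2 * (A$3$1 * A$4$4 - A$3$4 * A$4$1) + A$2$4 * (A$3$1 * A$4$2 - A$3$2 * A$4$1))
  - A$1$4 * (A$2$1 * (A$3$2 * A$4$3 - A$3$3 * A$4$2) - A$2$2 * (A$3$1 * A$4$3 - A$3$3 * A$4$1) + A$2$3 * (A$3$1 * A$4$2 - A$3$2 * A$4$1))"
proof -
  have f1234: "finite {2::4, 3, 4}" "1 \<notin> {2::4, 3, 4}" by auto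
  have f234: "finite {3::4, 4}" "2 \<notin> {3::4, 4}" by auto
  have f34: "finite {4::4}" "3 \<notin> {4::4}" by auto
  show ?thesis
    unfolding det_def UNIV_4
    unfolding sum_over_permutations_insert[OF f1234]
    unfolding sum_over_permutations_insert[OF f234]
    unfolding sum_over_permutations_insert[OF f34]
    unfolding permutes_sing
    by (simp add: sign_swap_id permutation_swap_id sign_compose sign_id swap_id_eq permutation_compose algebra_simps)
qed

definition vec4 :: "'b \<Rightarrow> 'b \<Rightarrow> 'b \<Rightarrow> 'b \<Rightarrow> 'b^4" where
  "vec4 a b c d = (\<chi> i. if i = 1 then a else if i = 2 then b else if i = 3 then c else d)"

lemma vec4_nth [simp]:
  "vec4 a b c d $ 1 = a" "vec4 a b c d $ 2 = b" "vec4 a b c d $ 3 = c" "vec4 a b c d $ 4 = d"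
  by (auto simp: vec4_def)

lemma vec4_eq_iff: "v = w \<longleftrightarrow> v$1 = w$1 \<and> v$2 = w$2 \<and> v$3 = w$3 \<and> v$4 = (w$4 :: 'b)" for v w :: "'b^4"
  by (simp add: vec_eq_iff forall_4)

definition cols :: "'b^4 \<Rightarrow> 'b^4 \<Rightarrow> 'b^4 \<Rightarrow> 'b^4 \<Rightarrow> 'b^4^4" where
  "cols v1 v2 v3 v4 = (\<chi> i. vec4 (v1$i) (v2$i) (v3$i) (v4$i))"

lemma cols_nth [simp]:
  "cols v1 v2 v3 v4 $ i $ 1 = v1 $ i" "cols v1 v2 v3 v4 $ i $ 2 = v2 $ i"
  "cols v1 v2 v3 v4 $ i $ 3 = v3 $ i" "cols v1 v2 v3 v4 $ i $ 4 = v4 $ i" by (auto simp: cols_def)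

lemma mat4_eq_iff:
  "A = B \<longleftrightarrow> (\<forall>i. A$i$1 = B$i$1 \<and> A$i$2 = B$i$2 \<and> A$i$3 = B$i$3 \<and> A$i$4 = B$i$(4::4))" for A B :: "'b^4^4"
  by (simp add: vec_eq_iff forall_4)

lemma cols_mult: "A ** cols v1 v2 v3 v4 = cols (A *v v1) (A *v v2) (A *v v3) (A *v v4)"
  for A :: "'b::comm_ring_1^4^4" by (simp add: mat4_eq_iff matrix_matrix_mult_def matrix_vector_mult_def)

lemma cols_vector_mult:
  "cols v1 v2 v3 v4 *v x = x$1 *s v1 + x$2 *s v2 + x$3 *s v3 + x$4 *s v4"
  for x :: "'b::comm_ring_1^4" by (simp add: vec_eq_iff matrix_vector_mult_def sum_4 mult.commute)

locale hermitian_field =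
  fixes q :: nat and ty :: "'a::{field,finite} itself"
  assumes odd_q: "odd q"
    and prime_power_q: "\<exists>p k. prime p \<and> k \<ge> 1 \<and> q = p ^ k"
    and card_field: "CARD('a) = q ^ 2"
begin

lemma prime_CHAR: "prime CHAR('a)"
  using finite_imp_CHAR_pos[where 'a = 'a] by (intro prime_CHAR_semidom) auto

lemma q_eq_CHAR_power: "\<exists>k. q = CHAR('a) ^ k"
proof -
  obtain p k where p: "prime p" "q = p ^ k"
    using prime_power_q by blast
  have "CHAR('a) dvd (p ^ k) ^ 2" using CHAR_dvd_CARD[where 'a = 'a] card_field p by simp
  then have "CHAR('a) dvd p" using prime_CHAR prime_dvd_power by blast
  then have "CHAR('a) = p" using prime_CHAR p primes_dvd_imp_eq by blast
  then show ?thesis using p by blast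
qed

lemma q_ge_3: "q \<ge> 3"
proof -
  obtain p k where p: "prime p" "q = p ^ k" "k \<ge> 1"
    using prime_power_q by blast
  have "p ^ 1 \<le> p ^ k" using p prime_gt_0_nat[OF p(1)] by (intro power_increasing) auto
  then have "q \<ge> 2" using p prime_ge_2_nat[OF p(1)] by simp
  then show ?thesis using odd_q by (cases "q = 2") auto
qed

lemma of_nat_eq_0_iff_dvd_q:
  assumes "coprime n q"
  shows "of_nat n \<noteq> (0 :: 'a)"
proof
  assume "of_nat n = (0 :: 'a)"
  then have d: "CHAR('a) dvd n" by (simp add: of_nat_eq_0_iff_char_dvd)
  obtain k where k: "q = CHAR('a) ^ k"
    using q_eq_CHAR_power by blast
  have "k \<noteq> 0" using k q_ge_3 by (cases k) auto
  then have "CHAR('a) dvd q" using k by (simp add: dvd_power)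
  then have "CHAR('a) dvd 1" using d assms by (metis coprime_common_divisor)
  then show False using prime_CHAR by auto
qed

lemma two_neq_0 [simp]: "(2::'a) \<noteq> 0"
  using of_nat_eq_0_iff_dvd_q[of 2] odd_q by simp

text \<open>The type is left open because additivity of the power map is needed in the field and in
  its algebraic closure.\<close>

lemma frob_add_gen:
  assumes "CHAR('k::comm_ring_1) = CHAR('a)"
  shows "(x + y :: 'k) ^ q = x ^ q + y ^ q"
proof -
  obtain k where "q = CHAR('k) ^ k"
    using q_eq_CHAR_power assms by metis
  then show ?thesis using freshmans_dream'[of q k x y] prime_CHAR assms by simp
qed

section \<open>Conjugation and norm of GF(q^2) over GF(q)\<close>

definition cj :: "'a \<Rightarrow> 'a" where "cj x = x ^ q"

lemma cj_simps [simp]: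
  "cj 0 = 0" "cj 1 = 1" "cj (x * y) = cj x * cj y" "cj (- x) = - cj x" "cj (x / y) = cj x / cj y"
  "cj (inverse x) = inverse (cj x)" "cj (x ^ n) = cj x ^ n" "cj x = 0 \<longleftrightarrow> x = 0"
  using q_ge_3 odd_q
  by (auto simp: cj_def power_mult_distrib power_divide power_inverse power_0_left power_commutes simp flip: power_mult)
     (simp add: mult.commute)

lemma cj_add [simp]: "cj (x + y) = cj x + cj y"
  using frob_add_gen[where 'k = 'a] by (simp add: cj_def)

lemma cj_diff [simp]: "cj (x - y) = cj x - cj y"
  using cj_add[of x "- y"] by simp

lemma cj_2 [simp]: "cj 2 = 2"
  using cj_add[of 1 1] by simp

lemma power_card_minus_1: "x \<noteq> 0 \<Longrightarrow> x ^ (q\<^sup>2 - 1) = (1 :: 'a)"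
proof -
  assume x: "x \<noteq> 0"
  have "card {y::'a. y ^ (q\<^sup>2 - 1) = 1} = q\<^sup>2 - 1"
    by (rule finite_field_power_image(1)[where m = 1]) (simp add: card_field)
  moreover have "{y::'a. y ^ (q\<^sup>2 - 1) = 1} \<subseteq> UNIV - {0}"
    using q_ge_3 power_strict_mono[of 1 q 2] by (auto simp: power_0_left)
  moreover have "card (UNIV - {0::'a}) = q\<^sup>2 - 1" by (simp add: card_Diff_singleton card_field)
  ultimately have "{y::'a. y ^ (q\<^sup>2 - 1) = 1} = UNIV - {0}" by (intro card_subset_eq) auto
  then show ?thesis using x by blast
qed

lemma q_sq_minus_1: "(q - 1) * (q + 1) = q\<^sup>2 - 1" "(q + 1) * (q - 1) = q\<^sup>2 - 1"
  by (auto simp: power2_eq_square algebra_simps)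

lemma cj_cj [simp]: "cj (cj x) = x"
proof (cases "x = 0")
  case False
  have "cj (cj x) = x ^ (Suc (q\<^sup>2 - 1))"
    using q_ge_3 by (simp add: cj_def power2_eq_square flip: power_mult)
  then show ?thesis using power_card_minus_1[OF False] by simp
qed simp

definition nrm :: "'a \<Rightarrow> 'a" where "nrm x = x * cj x"

lemma nrm_simps [simp]: "nrm 0 = 0" "nrm 1 = 1" "nrm (x * y) = nrm x * nrm y" "nrm (- x) = nrm x"
  "nrm (x / y) = nrm x / nrm y" "nrm (cj x) = nrm x" "cj (nrm x) = nrm x" "nrm x = 0 \<longleftrightarrow> x = 0"
  "nrm (x ^ n) = nrm x ^ n" "nrm (inverse x) = inverse (nrm x)" by (auto simp: nrm_def power_mult_distrib)

lemma nrm_eq_power: "nrm x = x ^ (q + 1)" by (simp add: nrm_def cj_def)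

text \<open>The condition \<open>cj y = y\<close> expresses that \<open>y\<close> lies in GF(q): a
  nonzero such \<open>y\<close> is a \<open>(q - 1)\<close>-th root of unity and hence a
  \<open>(q + 1)\<close>-th power.\<close>

lemma nrm_surj:
  assumes "cj y = y"
  shows "\<exists>x. nrm x = y"
proof (cases "y = 0")
  case False
  have "y ^ Suc (q - 1) = y" using assms q_ge_3 by (simp add: cj_def)
  then have "y ^ (q - 1) = 1" using False by simp
  then obtain x where "x ^ (q + 1) = y"
    using finite_field_power_image(2)[of "q - 1" "q + 1" y] q_sq_minus_1 card_field by auto
  then show ?thesis by (auto simp: nrm_eq_power)
qed (auto intro: exI[of _ 0])

lemma card_nrm_1: "card {x. nrm x = 1} = q + 1"
  unfolding nrm_eq_power
  by (rule finite_field_power_image(1)[where m = "q - 1"]) (simp only: q_sq_minus_1 card_field)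

lemma card_nrm_eq:
  assumes "cj y = y" "y \<noteq> 0"
  shows "card {x. nrm x = y} = q + 1"
proof -
  obtain x0 where x0: "nrm x0 = y"
    using nrm_surj assms by blast
  then have "x0 \<noteq> 0" using assms by auto
  then have "bij_betw (\<lambda>x. x0 * x) {x. nrm x = 1} {x. nrm x = y}"
    using x0 by (intro bij_betwI[where g = "\<lambda>x. x / x0"]) auto
  then show ?thesis using card_nrm_1 by (simp add: bij_betw_same_card)
qed

lemma hilbert_90:
  assumes "nrm x = 1"
  shows "\<exists>b. b \<noteq> 0 \<and> cj b = x * b"
proof -
  obtain b where b: "b \<noteq> 0" "b ^ (q - 1) = x"
    using finite_field_power_image(2)[of "q + 1" "q - 1" x] q_sq_minus_1 card_field assms
    by (auto simp: nrm_eq_power)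
  have "cj b = b ^ Suc (q - 1)" using q_ge_3 by (simp add: cj_def)
  then show ?thesis using b by auto
qed

lemma nrm_1_generator: "\<exists>s. nrm s = 1 \<and> (\<forall>i. s ^ i = 1 \<longleftrightarrow> (q + 1) dvd i)"
proof -
  have "card {x::'a. x ^ (q + 1) = 1} = q + 1" using card_nrm_1 by (simp add: nrm_eq_power)
  then obtain s :: 'a where "\<forall>i. s ^ i = 1 \<longleftrightarrow> (q + 1) dvd i"
    using primitive_root_of_unity_exists[of "q + 1"] by auto
  moreover from this have "nrm s = 1" by (simp only: nrm_eq_power) simp
  ultimately show ?thesis by blast
qed

lemma field_generator: "\<exists>s::'a. s \<noteq> 0 \<and> (\<forall>i. s ^ i = 1 \<longleftrightarrow> (q\<^sup>2 - 1) dvd i)"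
proof -
  have p: "q\<^sup>2 - 1 > 0" using q_ge_3 power_strict_mono[of 1 q 2] by simp
  have "card {x::'a. x ^ (q\<^sup>2 - 1) = 1} = q\<^sup>2 - 1"
    by (rule finite_field_power_image(1)[where m = 1]) (simp add: card_field)
  then obtain s :: 'a where s: "\<forall>i. s ^ i = 1 \<longleftrightarrow> (q\<^sup>2 - 1) dvd i"
    using primitive_root_of_unity_exists[OF p] by auto
  then have "s ^ (q\<^sup>2 - 1) = 1" by simp
  then have "s \<noteq> 0" using p by (auto simp: power_0_left)
  then show ?thesis using s by blast
qed

section \<open>The Hermitian form and the special unitary group\<close>

definition h :: "'a^4 \<Rightarrow> 'a^4 \<Rightarrow> 'a" where
  "h x y = x$1 * cj (y$1) + x$2 * cj (y$2) + x$3 * cj (y$3) + x$4 * cj (y$4)"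

lemma h_simps [simp]:
  "h (x + y) z = h x z + h y z" "h x (y + z) = h x y + h x z"
  "h (x - y) z = h x z - h y z" "h x (y - z) = h x y - h x z"
  "h (c *s x) y = c * h x y" "h x (c *s y) = cj c * h x y" "h 0 x = 0" "h x 0 = 0"
  by (auto simp: h_def algebra_simps)

lemma h_vec4: "h (vec4 a b c d) (vec4 a' b' c' d') = a * cj a' + b * cj b' + c * cj c' + d * cj d'"
  by (simp add: h_def)

lemma h_sym: "h y x = cj (h x y)" by (simp add: h_def algebra_simps)

lemma h_self: "h x x = nrm (x$1) + nrm (x$2) + nrm (x$3) + nrm (x$4)" by (simp add: h_def nrm_def)

lemma conjT_nth [simp]: "conjT q A $ i $ j = cj (A $ j $ i)" by (simp add: conjT_def cj_def)

lemma conjT_mult: "conjT q (A ** B) = conjT q B ** conjT q A" for A B :: "'a^4^4"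
  by (simp add: vec_eq_iff matrix_matrix_mult_def sum_4 mult.commute)

lemma conjT_conjT [simp]: "conjT q (conjT q A) = A" for A :: "'a^4^4" by (simp add: vec_eq_iff)

lemma conjT_mat_1 [simp]: "conjT q (mat 1) = (mat 1 :: 'a^4^4)" by (simp add: vec_eq_iff mat_def)

definition SU :: "('a^4^4) set" where
  "SU = {A. det A = 1 \<and> A ** conjT q A = mat 1}"

lemma SU4_simps [simp]: "carrier (SU4 q) = SU" "monoid.mult (SU4 q :: ('a^4^4) monoid) = (\<lambda>A B. A ** B)" "one (SU4 q :: ('a^4^4) monoid) = mat 1"
  by (simp_all add: SU4_def SU_def)

lemma conjT_mult_self: "A \<in> SU \<Longrightarrow> conjT q A ** A = mat 1" "A \<in> SU \<Longrightarrow> A ** conjT q A = mat 1"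
  by (auto simp: SU_def matrix_left_right_inverse)

lemma SU_mult [simp]: "A \<in> SU \<Longrightarrow> B \<in> SU \<Longrightarrow> A ** B \<in> SU"
proof -
  assume A: "A \<in> SU" and B: "B \<in> SU"
  have "A ** B ** conjT q (A ** B) = A ** (B ** conjT q B) ** conjT q A"
    by (simp add: conjT_mult matrix_mul_assoc)
  then show ?thesis using A B by (simp add: SU_def det_mul)
qed

lemma SU_one [simp]: "mat 1 \<in> SU" by (simp add: SU_def)

lemma SU_conjT [simp]:
  assumes A: "A \<in> SU"
  shows "conjT q A \<in> SU"
proof -
  have "det A * det (conjT q A) = 1" using A det_mul[of A "conjT q A"] by (simp add: SU_def)
  then show ?thesis using A conjT_mult_self(1)[OF A] by (simp add: SU_def)
qed

lemma group_SU4: "group (SU4 q :: ('a^4^4) monoid)"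
proof (rule groupI)
  fix A assume "A \<in> carrier (SU4 q :: ('a^4^4) monoid)"
  then show "\<exists>B\<in>carrier (SU4 q). B \<otimes>\<^bsub>SU4 q\<^esub> A = \<one>\<^bsub>SU4 q\<^esub>"
    using conjT_mult_self[of A] SU_conjT[of A] by auto
qed (auto simp: matrix_mul_assoc)

lemma h_conjT: "h (A *v x) y = h x (conjT q A *v y)"
  by (simp add: h_def matrix_vector_mult_def sum_4 algebra_simps)

lemma SU_h [simp]: "A \<in> SU \<Longrightarrow> h (A *v x) (A *v y) = h x y"
  by (simp add: h_conjT matrix_vector_mul_assoc conjT_mult_self)

lemma gram_cols_eq:
  assumes g: "h w1 w1 = h v1 v1" "h w2 w2 = h v2 v2" "h w3 w3 = h v3 v3" "h w4 w4 = h v4 v4"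
      "h w1 w2 = h v1 v2" "h w1 w3 = h v1 v3" "h w1 w4 = h v1 v4"
      "h w2 w3 = h v2 v3" "h w2 w4 = h v2 v4" "h w3 w4 = h v3 v4"
  shows "conjT q (cols w1 w2 w3 w4) ** cols w1 w2 w3 w4 = conjT q (cols v1 v2 v3 v4) ** cols v1 v2 v3 v4"
proof -
  have g': "h w2 w1 = h v2 v1" "h w3 w1 = h v3 v1" "h w4 w1 = h v4 v1"
      "h w3 w2 = h v3 v2" "h w4 w2 = h v4 v2" "h w4 w3 = h v4 v3"
    using g(5-10) by (metis h_sym)+
  have gram: "conjT q (cols a1 a2 a3 a4) ** cols b1 b2 b3 b4 =
    (\<chi> i. vec4 (h b1 (vec4 a1 a2 a3 a4 $ i)) (h b2 (vec4 a1 a2 a3 a4 $ i))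
               (h b3 (vec4 a1 a2 a3 a4 $ i)) (h b4 (vec4 a1 a2 a3 a4 $ i)))" for a1 a2 a3 a4 b1 b2 b3 b4
    by (simp add: mat4_eq_iff forall_4 matrix_matrix_mult_def sum_4 h_def mult.commute)
  show ?thesis
    unfolding gram by (simp add: mat4_eq_iff forall_4 g g')
qed

text \<open>An explicit form of Witt's theorem: the matrix that carries one basis to the other is
  unitary because the Gram matrices agree, and has determinant one because the determinants do. Most
  group elements below arise in this way from the images of four vectors.\<close>

lemma frame_map:
  assumes det: "det (cols w1 w2 w3 w4) = det (cols v1 v2 v3 v4)" "det (cols v1 v2 v3 v4) \<noteq> 0"
    and g: "h w1 w1 = h v1 v1" "h w2 w2 = h v2 v2" "h w3 w3 = h v3 v3" "h w4 w4 = h v4 v4"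
      "h w1 w2 = h v1 v2" "h w1 w3 = h v1 v3" "h w1 w4 = h v1 v4"
      "h w2 w3 = h v2 v3" "h w2 w4 = h v2 v4" "h w3 w4 = h v3 v4"
  shows "\<exists>A\<in>SU. A *v v1 = w1 \<and> A *v v2 = w2 \<and> A *v v3 = w3 \<and> A *v v4 = w4"
proof -
  define M where "M = cols v1 v2 v3 v4"
  define Y where "Y = cols w1 w2 w3 w4"
  have XY: "conjT q Y ** Y = conjT q M ** M"
    unfolding M_def Y_def by (rule gram_cols_eq[OF g])
  obtain Xi where Xi: "M ** Xi = mat 1" "Xi ** M = mat 1"
    using det invertible_det_nz[of M] unfolding M_def invertible_def by blast
  define A where "A = Y ** Xi"
  have AX: "A ** M = Y" by (simp add: A_def Xi flip: matrix_mul_assoc)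
  have "conjT q A ** A = conjT q Xi ** (conjT q Y ** Y) ** Xi"
    by (simp add: A_def conjT_mult matrix_mul_assoc)
  also have "\<dots> = conjT q (M ** Xi) ** (M ** Xi)" by (simp add: XY conjT_mult matrix_mul_assoc)
  finally have "conjT q A ** A = mat 1" by (simp add: Xi)
  moreover have "det A = 1" using det arg_cong[OF AX, of det] by (simp add: det_mul M_def Y_def)
  ultimately have "A \<in> SU" by (simp add: SU_def matrix_left_right_inverse)
  moreover have "cols (A *v v1) (A *v v2) (A *v v3) (A *v v4) = cols w1 w2 w3 w4"
    using AX by (simp add: M_def Y_def cols_mult)
  ultimately show ?thesis by (intro bexI[of _ A]) (auto simp: mat4_eq_iff vec_eq_iff)
qed

text \<open>The images are given by coordinates in the old basis, so that the determinant to check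
  is that of the coordinate matrix.\<close>

lemma frame_comb:
  assumes M: "det M \<noteq> 0" "M = cols v1 v2 v3 v4" and C: "det (cols c1 c2 c3 c4) = 1"
    and w: "w1 = M *v c1" "w2 = M *v c2" "w3 = M *v c3" "w4 = M *v c4"
    and g: "h w1 w1 = h v1 v1" "h w2 w2 = h v2 v2" "h w3 w3 = h v3 v3" "h w4 w4 = h v4 v4"
      "h w1 w2 = h v1 v2" "h w1 w3 = h v1 v3" "h w1 w4 = h v1 v4"
      "h w2 w3 = h v2 v3" "h w2 w4 = h v2 v4" "h w3 w4 = h v3 v4"
  shows "\<exists>A\<in>SU. A *v v1 = w1 \<and> A *v v2 = w2 \<and> A *v v3 = w3 \<and> A *v v4 = w4"
proof (rule frame_map[OF _ _ g])
  have "cols w1 w2 w3 w4 = M ** cols c1 c2 c3 c4" by (simp add: w cols_mult)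
  then show "det (cols w1 w2 w3 w4) = det (cols v1 v2 v3 v4)" by (simp add: det_mul C M(2))
qed (use M in simp)

subsection \<open>Isotropic points and totally isotropic lines\<close>

text \<open>The whole subspace, zero included, so that incidence with a line is plain inclusion and
  matrices act by images.\<close>

definition pt :: "'a^4 \<Rightarrow> ('a^4) set" where
  "pt v = range (\<lambda>c. c *s v)"

definition span2 :: "'a^4 \<Rightarrow> 'a^4 \<Rightarrow> ('a^4) set" where
  "span2 v w = {a *s v + b *s w | a b. True}"

definition indep :: "'a^4 \<Rightarrow> 'a^4 \<Rightarrow> bool" where
  "indep v w \<longleftrightarrow> (\<forall>a b. a *s v + b *s w = 0 \<longrightarrow> a = 0 \<and> b = 0)"

definition lines :: "('a^4) set set" where
  "lines = {span2 v w | v w. indep v w \<and> h v v = 0 \<and> h w w = 0 \<and> h v w = 0}"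

definition act :: "'a^4^4 \<Rightarrow> ('a^4) set \<Rightarrow> ('a^4) set" where
  "act A S = (\<lambda>x. A *v x) ` S"

lemma act_mult: "act (A ** B) S = act A (act B S)" by (auto simp: act_def image_image matrix_vector_mul_assoc)

lemma act_one [simp]: "act (mat 1) S = S" by (simp add: act_def)

lemma act_conjT [simp]: "A \<in> SU \<Longrightarrow> act (conjT q A) (act A S) = S" "A \<in> SU \<Longrightarrow> act A (act (conjT q A) S) = S"
  by (simp_all add: conjT_mult_self flip: act_mult)

lemma act_inj [simp]: "A \<in> SU \<Longrightarrow> act A S = act A T \<longleftrightarrow> S = T"
  by (metis act_conjT(1))

lemma act_subset_iff [simp]: "A \<in> SU \<Longrightarrow> act A S \<subseteq> act A T \<longleftrightarrow> S \<subseteq> T"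
  by (metis act_conjT(1) act_def image_mono)

lemma mult_vec_eq_0 [simp]: "A \<in> SU \<Longrightarrow> A *v x = 0 \<longleftrightarrow> x = 0"
  by (metis conjT_mult_self(1) matrix_vector_mul_assoc matrix_vector_mul_lid matrix_vector_mult_0_right)

lemma mult_vec_eq_iff [simp]: "A \<in> SU \<Longrightarrow> A *v x = A *v y \<longleftrightarrow> x = y"
  by (metis conjT_mult_self(1) matrix_vector_mul_assoc matrix_vector_mul_lid)

lemma mult_vec_scale: "A *v (c *s x) = c *s (A *v x)" for x :: "'a^4" and A :: "'a^4^4"
  by (simp add: vec_eq_iff matrix_vector_mult_def sum_4 algebra_simps)

lemma act_pt: "act A (pt v) = pt (A *v v)" by (simp add: act_def pt_def image_image mult_vec_scale)

lemma mult_vec_comb: "a *s (A *v v) + b *s (A *v w) = A *v (a *s v + b *s w)" for v w :: "'a^4" and A :: "'a^4^4"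
  by (simp add: mult_vec_scale matrix_vector_right_distrib)

lemma act_span2: "act A (span2 v w) = span2 (A *v v) (A *v w)"
  unfolding act_def span2_def mult_vec_comb by blast

lemma indep_mult_vec: "A \<in> SU \<Longrightarrow> indep (A *v v) (A *v w) \<longleftrightarrow> indep v w"
  by (simp add: indep_def mult_vec_comb)

lemma act_lines [simp]: "A \<in> SU \<Longrightarrow> L \<in> lines \<Longrightarrow> act A L \<in> lines"
  unfolding lines_def mem_Collect_eq by (elim exE, rule_tac x = "A *v v" in exI, rule_tac x = "A *v w" in exI)
    (auto simp: act_span2 indep_mult_vec)

lemma pt_scale: "c \<noteq> 0 \<Longrightarrow> pt (c *s v) = pt v"
proof -
  assume c: "c \<noteq> 0"
  have "a *s v \<in> pt (c *s v)" for a using c by (auto simp: pt_def intro!: image_eqI[of _ _ "a / c"])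
  then show ?thesis by (auto simp: pt_def)
qed

lemma self_in_pt [simp]: "v \<in> pt v"
  unfolding pt_def by (auto simp: image_def intro: exI[of _ 1])

lemma pt_eqD: "pt v = pt w \<Longrightarrow> \<exists>c. w = c *s v"
  using self_in_pt[of w] by (auto simp: pt_def)

lemma pt_eq_iff: "v \<noteq> 0 \<Longrightarrow> w \<noteq> 0 \<Longrightarrow> pt v = pt w \<longleftrightarrow> (\<exists>c. w = c *s v)"
  using pt_eqD pt_scale by (metis vector_smult_lzero)

lemma span2_gens [simp]: "v \<in> span2 v w" "w \<in> span2 v w"
proof -
  have "v = 1 *s v + 0 *s w" "w = 0 *s v + 1 *s w" by simp_all
  then show "v \<in> span2 v w" "w \<in> span2 v w"
    unfolding span2_def by blast+
qed

lemma span2_closed: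
  assumes "x \<in> span2 v w" "y \<in> span2 v w"
  shows "a *s x + b *s y \<in> span2 v w"
proof -
  obtain c d where x: "x = c *s v + d *s w"
    using assms(1) by (auto simp: span2_def)
  obtain c' d' where y: "y = c' *s v + d' *s w"
    using assms(2) by (auto simp: span2_def)
  have "a *s x + b *s y = (a * c + b * c') *s v + (a * d + b * d') *s w"
    by (simp add: x y vec_eq_iff algebra_simps)
  then show ?thesis by (auto simp: span2_def)
qed

lemma line_comb: "L \<in> lines \<Longrightarrow> x \<in> L \<Longrightarrow> y \<in> L \<Longrightarrow> a *s x + b *s y \<in> L"
  by (auto simp: lines_def span2_closed)

lemma line_scale: "L \<in> lines \<Longrightarrow> x \<in> L \<Longrightarrow> a *s x \<in> L"
  using line_comb[of L x x a 0] by simp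

lemma pt_subset_line: "L \<in> lines \<Longrightarrow> pt x \<subseteq> L \<longleftrightarrow> x \<in> L"
  using self_in_pt line_scale by (auto simp: pt_def)

lemma line_h: "L \<in> lines \<Longrightarrow> x \<in> L \<Longrightarrow> y \<in> L \<Longrightarrow> h x y = 0"
proof -
  assume L: "L \<in> lines" and xy: "x \<in> L" "y \<in> L"
  obtain v w where vw: "L = span2 v w" "h v v = 0" "h w w = 0" "h v w = 0"
    using L by (auto simp: lines_def)
  have "h w v = 0" using vw(4) h_sym[of w v] by simp
  then show ?thesis using xy vw by (auto simp: span2_def)
qed

lemma indepD: "indep v w \<Longrightarrow> a *s v + b *s w = 0 \<Longrightarrow> a = 0 \<and> b = 0"
  by (simp add: indep_def)

lemma indep_nonzero: "indep v w \<Longrightarrow> v \<noteq> 0 \<and> w \<noteq> 0"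
  using indepD[of v w 1 0] indepD[of v w 0 1] by auto

lemma line_eq_span2:
  assumes L: "L \<in> lines" and xy: "x \<in> L" "y \<in> L" "indep x y"
  shows "L = span2 x y"
proof -
  obtain v w where vw: "L = span2 v w"
    using L by (auto simp: lines_def)
  obtain a b where x: "x = a *s v + b *s w"
    using xy vw by (auto simp: span2_def)
  obtain c d where y: "y = c *s v + d *s w"
    using xy vw by (auto simp: span2_def)
  \<comment> \<open>Cramer's rule: these identities express \<open>v\<close> and \<open>w\<close> by
    \<open>x\<close> and \<open>y\<close> once the determinant is known to be nonzero.\<close>
  have e1: "d *s x + (- b) *s y = (a * d - b * c) *s v" by (simp add: x y vec_eq_iff algebra_simps)
  have e2: "(- c) *s x + a *s y = (a * d - b * c) *s w" by (simp add: x y vec_eq_iff algebra_simps)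
  have nz: "a * d - b * c \<noteq> 0"
  proof
    assume "a * d - b * c = 0"
    then have "d *s x + (- b) *s y = 0" "(- c) *s x + a *s y = 0" using e1 e2 by simp_all
    then have "a = 0" "b = 0" using indepD[OF xy(3), of d "- b"] indepD[OF xy(3), of "- c" a] by auto
    then show False using indep_nonzero[OF xy(3)] by (simp add: x)
  qed
  let ?D = "a * d - b * c"
  have s: "x \<in> span2 x y" "y \<in> span2 x y" by simp_all
  have "v = (d / ?D) *s x + (- b / ?D) *s y"
  proof -
    have "v = (1 / ?D) *s (?D *s v)" using nz by simp
    then show ?thesis
      unfolding e1[symmetric] by (simp add: vec_eq_iff algebra_simps)
  qed
  moreover have "w = (- c / ?D) *s x + (a / ?D) *s y"
  proof -
    have "w = (1 / ?D) *s (?D *s w)" using nz by simp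
    then show ?thesis
      unfolding e2[symmetric] by (simp add: vec_eq_iff algebra_simps)
  qed
  ultimately have "v \<in> span2 x y" "w \<in> span2 x y" using span2_closed[OF s] by metis+
  then have "span2 v w \<subseteq> span2 x y" using span2_closed by (auto simp: span2_def[of v w])
  moreover have "span2 x y \<subseteq> span2 v w" using xy vw span2_closed by (auto simp: span2_def[of x y])
  ultimately show ?thesis using vw by auto
qed

text \<open>In the hyperbolic plane of the first two coordinates an isotropic vector spans its own
  orthogonal complement, so the first two coordinates of \<open>w\<close> are proportional to
  it.\<close>

lemma perp_vec:
  assumes z: "nrm z1 + nrm z2 = 0" "z1 \<noteq> 0" and w: "h w (vec4 z1 z2 0 0) = 0"
  shows "w = (w$1 / z1) *s vec4 z1 z2 0 0 + vec4 0 0 (w$3) (w$4)"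
proof -
  have z2: "z2 \<noteq> 0" using z by auto
  have e: "w$1 * cj z1 = - (w$2 * cj z2)" using w by (simp add: h_def add_eq_0_iff2)
  have f: "z1 * cj z1 = - (z2 * cj z2)" using z(1) by (simp add: nrm_def add_eq_0_iff2)
  have "(w$2 * z1) * cj z2 = - ((w$1 * cj z1) * z1)" by (simp add: e algebra_simps)
  also have "\<dots> = - (w$1 * (z1 * cj z1))" by (simp add: algebra_simps)
  also have "\<dots> = (w$1 * z2) * cj z2" by (simp add: f algebra_simps)
  finally have "w$2 * z1 = w$1 * z2" using z2 by simp
  then show ?thesis using z(2) by (simp add: vec4_eq_iff field_simps)
qed

section \<open>The Hermitian curve in the plane \<open>x\<^sub>4 = 0\<close>\<close>

definition opts :: "('a^4) set set" where
  "opts = {pt v | v. v \<noteq> 0 \<and> v$4 = 0 \<and> h v v = 0}"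

lemma line_meets_opts:
  assumes L: "L \<in> lines"
  shows "\<exists>P\<in>opts. P \<subseteq> L"
proof -
  obtain v w where vw: "L = span2 v w" "indep v w"
    using L by (auto simp: lines_def)
  have s: "v \<in> L" "w \<in> L" by (simp_all add: vw)
  have "v \<noteq> 0" using indep_nonzero[OF vw(2)] by simp
  have "\<exists>x\<in>L. x \<noteq> 0 \<and> x$4 = 0"
  proof (cases "v$4 = 0")
    case True
    then show ?thesis using s \<open>v \<noteq> 0\<close> by blast
  next
    case False
    define x where "x = (w$4) *s v + (- (v$4)) *s w"
    have "x \<in> L"
      unfolding x_def by (rule line_comb[OF L s])
    moreover have "x \<noteq> 0" using indepD[OF vw(2), of "w$4" "- (v$4)"] False unfolding x_def by auto
    moreover have "x$4 = 0" by (simp add: x_def)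
    ultimately show ?thesis by blast
  qed
  then obtain x where "x \<in> L" "x \<noteq> 0" "x$4 = 0" by blast
  then show ?thesis using line_h[OF L, of x x] pt_subset_line[OF L, of x] by (auto simp: opts_def)
qed

text \<open>The plane is nondegenerate of dimension three and contains no totally isotropic line.
  Concretely, two distinct points would yield a nonzero vector \<open>z\<close> of the line whose
  last two coordinates vanish; any vector of the line that lies in the plane differs from a multiple
  of \<open>z\<close> by an isotropic multiple of the third unit vector, that is, by zero.\<close>

lemma line_meets_opts_unique:
  assumes L: "L \<in> lines" and P: "P \<in> opts" "P \<subseteq> L" and Q: "Q \<in> opts" "Q \<subseteq> L"
  shows "P = Q"
proof -
  obtain x where x: "P = pt x" "x \<noteq> 0" "x$4 = 0" "x \<in> L"
    using P pt_subset_line[OF L] by (auto simp: opts_def)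
  obtain y where y: "Q = pt y" "y \<noteq> 0" "y$4 = 0" "y \<in> L"
    using Q pt_subset_line[OF L] by (auto simp: opts_def)
  have key: "P = Q" if z: "z \<in> L" "z \<noteq> 0" "z$3 = 0" "z$4 = 0" for z
  proof -
    have zz: "nrm (z$1) + nrm (z$2) = 0" using line_h[OF L z(1) z(1)] z by (simp add: h_self)
    have z1: "z$1 \<noteq> 0" using zz z by (auto simp: vec4_eq_iff)
    have zv: "z = vec4 (z$1) (z$2) 0 0" using z by (simp add: vec4_eq_iff)
    have mult: "w = (w$1 / z$1) *s z" if w: "w \<in> L" "w$4 = 0" for w
    proof -
      have "h w (vec4 (z$1) (z$2) 0 0) = 0" using line_h[OF L w(1) z(1)] zv by simp
      from perp_vec[OF zz z1 this] have e: "w = (w$1 / z$1) *s z + vec4 0 0 (w$3) 0"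
        using w zv by metis
      have "1 *s w + (- (w$1 / z$1)) *s z \<in> L" by (rule line_comb[OF L w(1) z(1)])
      moreover have "1 *s w + (- (w$1 / z$1)) *s z = vec4 0 0 (w$3) 0" by (subst e) (simp add: vec_eq_iff)
      ultimately have "vec4 0 0 (w$3) 0 \<in> L" by simp
      from line_h[OF L this this] have "w$3 = 0" by (simp add: h_self)
      then have "vec4 0 0 (w$3) 0 = 0" by (simp add: vec4_eq_iff)
      then show ?thesis using e by simp
    qed
    have "pt w = pt z" if "w \<in> L" "w$4 = 0" "w \<noteq> 0" for w
      using mult[OF that(1,2)] pt_eq_iff[OF z(2) that(3)] by blast
    then show ?thesis using x y by blast
  qed
  show ?thesis
  proof (cases "x$3 = 0")
    case True
    then show ?thesis using key x by blast
  next
    case False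
    define z where "z = (y$3) *s x + (- (x$3)) *s y"
    have z: "z \<in> L" "z$3 = 0" "z$4 = 0"
      unfolding z_def by (rule line_comb[OF L x(4) y(4)]) (simp_all add: x y)
    show ?thesis
    proof (cases "z = 0")
      case True
      then have "(x$3) *s y = (y$3) *s x" by (simp add: z_def vec_eq_iff)
      then have "y = (y$3 / x$3) *s x" using False by (simp add: vec_eq_iff field_simps)
      then show ?thesis using x y pt_eq_iff by blast
    next
      case False
      then show ?thesis using key z by blast
    qed
  qed
qed

text \<open>With both parameters of norm -1 this joins an isotropic point of the line
  \<open>x\<^sub>3 = x\<^sub>4 = 0\<close> to one of its polar line
  \<open>x\<^sub>1 = x\<^sub>2 = 0\<close>; such lines form a grid of q + 1 by q + 1.\<close>

definition ell :: "'a \<Rightarrow> 'a \<Rightarrow> ('a^4) set" where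
  "ell x y = span2 (vec4 1 x 0 0) (vec4 0 0 1 y)"

lemma ell_in_lines: "nrm x = -1 \<Longrightarrow> nrm y = -1 \<Longrightarrow> ell x y \<in> lines"
  unfolding lines_def ell_def mem_Collect_eq by (intro exI[of _ "vec4 1 x 0 0"] exI[of _ "vec4 0 0 1 y"])
    (auto simp: indep_def vec4_eq_iff h_vec4 nrm_def)

lemma ell_eq_iff: "ell x y = ell x' y' \<longleftrightarrow> x = x' \<and> y = y'"
proof
  assume e: "ell x y = ell x' y'"
  have "vec4 1 x 0 0 \<in> ell x y" "vec4 0 0 1 y \<in> ell x y" by (simp_all add: ell_def)
  then have "vec4 1 x 0 0 \<in> ell x' y'" "vec4 0 0 1 y \<in> ell x' y'" using e by simp_all
  then show "x = x' \<and> y = y'" by (auto simp: ell_def span2_def vec4_eq_iff)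
qed simp

text \<open>Everything on such a line is orthogonal to the given point, so a second generator can be
  moved into the last two coordinates, where it is isotropic and can be scaled to
  \<open>vec4 0 0 1 y\<close>.\<close>

lemma lines_through:
  assumes x: "nrm x = -1"
  shows "{L \<in> lines. pt (vec4 1 x 0 0) \<subseteq> L} = ell x ` {y. nrm y = -1}"
proof (intro equalityI subsetI)
  fix L assume "L \<in> ell x ` {y. nrm y = -1}"
  then obtain y where y: "nrm y = -1" "L = ell x y" by auto
  have "vec4 1 x 0 0 \<in> ell x y" by (simp_all add: ell_def)
  then show "L \<in> {L \<in> lines. pt (vec4 1 x 0 0) \<subseteq> L}"
    using y ell_in_lines[OF x] pt_subset_line by auto
next
  fix L assume "L \<in> {L \<in> lines. pt (vec4 1 x 0 0) \<subseteq> L}"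
  then have L: "L \<in> lines" and eL: "vec4 1 x 0 0 \<in> L" using pt_subset_line by auto
  let ?e = "vec4 1 x 0 0"
  obtain v w where vw: "L = span2 v w" "indep v w"
    using L by (auto simp: lines_def)
  have s: "v \<in> L" "w \<in> L" by (simp_all add: vw)
  define u where "u w = vec4 0 0 (w$3) (w$4)" for w :: "'a^4"
  have eu: "w = (w$1) *s ?e + u w" "u w \<in> L" if "w \<in> L" for w
  proof -
    show e: "w = (w$1) *s ?e + u w" using perp_vec[of 1 x w] x line_h[OF L that eL] by (simp add: u_def)
    have "1 *s w + (- (w$1)) *s ?e \<in> L" by (rule line_comb[OF L that eL])
    moreover have "1 *s w + (- (w$1)) *s ?e = u w" by (subst e) (simp add: vec_eq_iff)
    ultimately show "u w \<in> L" by simp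
  qed
  have "u v \<noteq> 0 \<or> u w \<noteq> 0"
  proof (rule ccontr)
    assume "\<not> ?thesis"
    then have e: "v = (v$1) *s ?e" "w = (w$1) *s ?e" using eu[OF s(1)] eu[OF s(2)] by simp_all
    have "(w$1) *s v + (- (v$1)) *s w = 0" by (subst e(1), subst (2) e(2)) (simp add: vec_eq_iff)
    then have "w$1 = 0" using indepD[OF vw(2)] by blast
    then have "w = 0" using e(2) by simp
    then show False using indep_nonzero[OF vw(2)] by simp
  qed
  then obtain w' where w': "w' \<in> L" "u w' \<noteq> 0" using s by blast
  have nn: "nrm (w'$3) + nrm (w'$4) = 0"
    using line_h[OF L eu(2)[OF w'(1)] eu(2)[OF w'(1)]] by (simp add: u_def h_self)
  have w3: "w'$3 \<noteq> 0" using nn w'(2) by (auto simp: u_def vec4_eq_iff)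
  define y where "y = w'$4 / w'$3"
  have y: "nrm y = -1"
  proof -
    have "nrm (w'$4) = - nrm (w'$3)" using nn by (simp add: add_eq_0_iff)
    then show ?thesis using w3 by (simp add: y_def)
  qed
  have "(1 / w'$3) *s u w' \<in> L" by (rule line_scale[OF L eu(2)[OF w'(1)]])
  moreover have "(1 / w'$3) *s u w' = vec4 0 0 1 y" using w3 by (simp add: u_def y_def vec4_eq_iff)
  ultimately have "vec4 0 0 1 y \<in> L" by simp
  moreover have "indep ?e (vec4 0 0 1 y)" by (auto simp: indep_def vec4_eq_iff)
  ultimately have "L = ell x y"
    unfolding ell_def by (rule line_eq_span2[OF L eL])
  then show "L \<in> ell x ` {y. nrm y = -1}" using y by blast
qed

lemma four_neq_0 [simp]: "(4::'a) \<noteq> 0"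
proof -
  have "(4::'a) = 2 * 2" by simp
  then show ?thesis using two_neq_0 by (metis mult_eq_0_iff)
qed

section \<open>From partitions of sets of lines or points to factorizations of sets of
  matrices\<close>

definition preim :: "('a^4^4) set \<Rightarrow> ('a^4) set \<Rightarrow> ('a^4) set set \<Rightarrow> ('a^4^4) set" where
  "preim H \<omega> \<Omega> = {g \<in> H. act g \<omega> \<in> \<Omega>}"

definition su_closed :: "('a^4^4) set \<Rightarrow> bool" where
  "su_closed H \<longleftrightarrow> H \<subseteq> SU \<and> mat 1 \<in> H \<and> (\<forall>A\<in>H. \<forall>B\<in>H. A ** B \<in> H) \<and> (\<forall>A\<in>H. conjT q A \<in> H)"

lemma su_closed_SU: "su_closed SU" by (auto simp: su_closed_def)

lemma su_closed_subgroup: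
  assumes "su_closed H"
  shows "subgroup H (SU4 q)"
proof -
  interpret group "SU4 q :: ('a^4^4) monoid" by (rule group_SU4)
  have inv: "inv\<^bsub>SU4 q\<^esub> A = conjT q A" if "A \<in> SU" for A :: "'a^4^4"
    using that by (intro inv_equality) (auto simp: conjT_mult_self)
  show ?thesis using assms inv by (intro subgroupI) (auto simp: su_closed_def subset_iff)
qed

text \<open>The translate that contains the image of \<open>\<omega>\<close> under \<open>g\<close>
  has a unique index, which tells the \<open>b i\<close> to split off; what remains sends
  \<open>\<omega>\<close> into \<open>\<Omega>'\<close>. If \<open>\<Omega>'\<close> consists of
  \<open>\<omega>\<close> alone, this is the usual decomposition into cosets of a
  stabilizer.\<close>

lemma preim_bij:
  assumes H: "su_closed H" and b: "\<And>i. i \<in> I \<Longrightarrow> b i \<in> H"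
    and bij: "bij_betw (\<lambda>(i, L). act (b i) L) (I \<times> \<Omega>') \<Omega>"
  shows "bij_betw (\<lambda>(i, g). b i ** g) (I \<times> preim H \<omega> \<Omega>') (preim H \<omega> \<Omega>)"
  unfolding bij_betw_def
proof
  have HSU: "H \<subseteq> SU" using H by (simp add: su_closed_def)
  have inj: "i = j \<and> L = L'" if "i \<in> I" "j \<in> I" "L \<in> \<Omega>'" "L' \<in> \<Omega>'" "act (b i) L = act (b j) L'" for i j L L'
    using bij that unfolding bij_betw_def inj_on_def by auto
  show "inj_on (\<lambda>(i, g). b i ** g) (I \<times> preim H \<omega> \<Omega>')"
  proof (rule inj_onI, clarify)
    fix i g j g' assume x: "i \<in> I" "j \<in> I" "g \<in> preim H \<omega> \<Omega>'" "g' \<in> preim H \<omega> \<Omega>'" "b i ** g = b j ** g'"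
    have "act (b i) (act g \<omega>) = act (b j) (act g' \<omega>)" using x(5) by (simp flip: act_mult)
    then have "i = j" using inj x by (auto simp: preim_def)
    moreover have "g = g'"
    proof -
      have "conjT q (b i) ** (b i ** g) = conjT q (b i) ** (b i ** g')"
        using x(5) \<open>i = j\<close> by simp
      then show ?thesis using b[OF x(1)] HSU by (auto simp: matrix_mul_assoc conjT_mult_self)
    qed
    ultimately show "i = j \<and> g = g'" by simp
  qed
  show "(\<lambda>(i, g). b i ** g) ` (I \<times> preim H \<omega> \<Omega>') = preim H \<omega> \<Omega>"
  proof (intro equalityI subsetI)
    fix y assume "y \<in> (\<lambda>(i, g). b i ** g) ` (I \<times> preim H \<omega> \<Omega>')"
    then obtain i g where y: "i \<in> I" "g \<in> H" "act g \<omega> \<in> \<Omega>'" "y = b i ** g"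
      by (auto simp: preim_def)
    have "act (b i) (act g \<omega>) \<in> \<Omega>" using bij y unfolding bij_betw_def by auto
    then show "y \<in> preim H \<omega> \<Omega>" using y b H by (auto simp: preim_def act_mult su_closed_def)
  next
    fix y assume y: "y \<in> preim H \<omega> \<Omega>"
    then have "act y \<omega> \<in> (\<lambda>(i, L). act (b i) L) ` (I \<times> \<Omega>')"
      using bij unfolding bij_betw_def by (auto simp: preim_def)
    then obtain i L where i: "i \<in> I" "L \<in> \<Omega>'" "act y \<omega> = act (b i) L" by auto
    have bi: "b i \<in> SU" "b i \<in> H" using b[OF i(1)] HSU by auto
    define g where "g = conjT q (b i) ** y"
    have "g \<in> preim H \<omega> \<Omega>'"
      using y i bi H by (auto simp: preim_def g_def act_mult su_closed_def)
    moreover have "y = b i ** g" using bi by (simp add: g_def matrix_mul_assoc conjT_mult_self)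
    ultimately show "y \<in> (\<lambda>(i, g). b i ** g) ` (I \<times> preim H \<omega> \<Omega>')"
      using i(1) by (auto intro!: image_eqI[of _ _ "(i, g)"])
  qed
qed

lemma mls_preim_single:
  assumes "su_closed H" "finite I" "prime (card I) \<or> card I = 4" "\<And>i. i \<in> I \<Longrightarrow> b i \<in> H"
    and "bij_betw (\<lambda>(i, L). act (b i) L) (I \<times> \<Omega>') \<Omega>" "preim H \<omega> \<Omega>' \<noteq> {}"
  shows "mls_rel (SU4 q) (preim H \<omega> \<Omega>) (preim H \<omega> \<Omega>')"
  using mls_rel_single[OF assms(2,3), where b = b and G = "SU4 q" and K = "preim H \<omega> \<Omega>'"]
    preim_bij[OF assms(1,4,5)] assms(1,4,6) by (auto simp: su_closed_def)

lemma SU_pow: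
  assumes "g \<in> SU"
  shows "g [^]\<^bsub>SU4 q\<^esub> (i::nat) \<in> SU" "act (g [^]\<^bsub>SU4 q\<^esub> (i::nat)) L = (act g ^^ i) L"
    "(g [^]\<^bsub>SU4 q\<^esub> i) *v x = ((\<lambda>x. g *v x) ^^ i) x"
proof -
  interpret group "SU4 q :: ('a^4^4) monoid" by (rule group_SU4)
  show "g [^]\<^bsub>SU4 q\<^esub> i \<in> SU" using assms nat_pow_closed[of g i] by simp
  have e: "g [^]\<^bsub>SU4 q\<^esub> Suc i = g ** (g [^]\<^bsub>SU4 q\<^esub> i)" for i :: nat
    using nat_pow_Suc2[of g i] assms by simp
  show "act (g [^]\<^bsub>SU4 q\<^esub> i) L = (act g ^^ i) L"
  proof (induction i)
    case (Suc i)
    then show ?case by (simp only: e act_mult funpow.simps comp_apply)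
  qed simp
  show "(g [^]\<^bsub>SU4 q\<^esub> i) *v x = ((\<lambda>x. g *v x) ^^ i) x"
  proof (induction i)
    case (Suc i)
    then show ?case by (simp only: e funpow.simps comp_apply flip: matrix_vector_mul_assoc)
  qed simp
qed

lemma mls_preim_powers:
  assumes H: "su_closed H" and g: "g \<in> H" and n: "n > 0"
    and bij: "bij_betw (\<lambda>(i, L). (act g ^^ i) L) ({..<n} \<times> \<Omega>') \<Omega>" and ne: "preim H \<omega> \<Omega>' \<noteq> {}"
  shows "mls_rel (SU4 q) (preim H \<omega> \<Omega>) (preim H \<omega> \<Omega>')"
proof -
  interpret group "SU4 q :: ('a^4^4) monoid" by (rule group_SU4)
  interpret H: subgroup H "SU4 q" by (rule su_closed_subgroup[OF H])
  have gS: "g \<in> SU" using H g by (auto simp: su_closed_def)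
  have pw: "g [^]\<^bsub>SU4 q\<^esub> (i::nat) \<in> H" for i
    using g by (induction i) (use H.m_closed H.one_closed in auto)
  have "bij_betw (\<lambda>(i, L). act (g [^]\<^bsub>SU4 q\<^esub> i) L) ({..<n} \<times> \<Omega>') \<Omega>"
    using bij by (simp add: SU_pow[OF gS])
  from preim_bij[OF H _ this] pw
  have "bij_betw (\<lambda>(i, k). g [^]\<^bsub>SU4 q\<^esub> i \<otimes>\<^bsub>SU4 q\<^esub> k) ({..<n} \<times> preim H \<omega> \<Omega>') (preim H \<omega> \<Omega>)"
    by simp
  then show ?thesis using H gS n ne by (intro mls_rel_powers[of g _ n]) (auto simp: preim_def su_closed_def)
qed

section \<open>Pencils of lines through points of the curve\<close>

definition lam :: "('a^4) set set \<Rightarrow> ('a^4) set set" where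
  "lam I = {L \<in> lines. \<exists>P\<in>I. P \<subseteq> L}"

lemma lam_opts: "lam opts = lines"
  using line_meets_opts by (auto simp: lam_def)

text \<open>A line has only one point on the curve, so translates of pencils are disjoint as soon as
  the translates of their base points are. Only the images of the points in \<open>I\<close> have to
  lie on the curve again, not that of the whole curve.\<close>

lemma lam_bij:
  assumes b: "\<And>j. j \<in> J \<Longrightarrow> b j \<in> SU" and I: "I \<subseteq> opts" "I' \<subseteq> opts"
    and bij: "bij_betw (\<lambda>(j, P). act (b j) P) (J \<times> I) I'"
  shows "bij_betw (\<lambda>(j, L). act (b j) L) (J \<times> lam I) (lam I')"
  unfolding bij_betw_def
proof
  have inj: "i = j \<and> L = L'" if "i \<in> J" "j \<in> J" "L \<in> I" "L' \<in> I" "act (b i) L = act (b j) L'" for i j L L'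
    using bij that unfolding bij_betw_def inj_on_def by auto
  have mem: "act (b j) P \<in> I'" if "j \<in> J" "P \<in> I" for j P
    using bij that unfolding bij_betw_def by auto
  show "inj_on (\<lambda>(j, L). act (b j) L) (J \<times> lam I)"
  proof (rule inj_onI, clarify)
    fix i L j L' assume x: "i \<in> J" "j \<in> J" "L \<in> lam I" "L' \<in> lam I" "act (b i) L = act (b j) L'"
    obtain P where P: "P \<in> I" "P \<subseteq> L" "L \<in> lines"
      using x by (auto simp: lam_def)
    obtain Q where Q: "Q \<in> I" "Q \<subseteq> L'"
      using x by (auto simp: lam_def)
    have "act (b i) P \<subseteq> act (b i) L" "act (b j) Q \<subseteq> act (b i) L"
      subgoal using P(2) by (auto simp: act_def)
      subgoal unfolding x(5) using Q(2) by (auto simp: act_def)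
      done
    moreover have "act (b i) P \<in> opts" "act (b j) Q \<in> opts"
      using mem[OF x(1) P(1)] mem[OF x(2) Q(1)] I by auto
    ultimately have "act (b i) P = act (b j) Q"
      using line_meets_opts_unique[OF act_lines[OF b[OF x(1)] P(3)]] by blast
    then have "i = j" using inj x P Q by blast
    then show "i = j \<and> L = L'" using x b by auto
  qed
  show "(\<lambda>(j, L). act (b j) L) ` (J \<times> lam I) = lam I'"
  proof (intro equalityI subsetI)
    fix y assume "y \<in> (\<lambda>(j, L). act (b j) L) ` (J \<times> lam I)"
    then obtain j L P where y: "j \<in> J" "L \<in> lines" "P \<in> I" "P \<subseteq> L" "y = act (b j) L"
      by (auto simp: lam_def)
    moreover from this have "act (b j) P \<subseteq> y" by (auto simp: act_def)
    moreover from calculation have "y \<in> lines" using b by simp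
    ultimately show "y \<in> lam I'"
      unfolding lam_def using mem[of j P] by blast
  next
    fix y assume "y \<in> lam I'"
    then obtain Q where y: "y \<in> lines" "Q \<in> I'" "Q \<subseteq> y" by (auto simp: lam_def)
    then have "Q \<in> (\<lambda>(j, P). act (b j) P) ` (J \<times> I)" using bij by (simp add: bij_betw_def)
    then obtain j P where j: "j \<in> J" "P \<in> I" "Q = act (b j) P" by auto
    define L where "L = act (conjT q (b j)) y"
    have e: "y = act (b j) L" using b j by (simp add: L_def)
    have "P \<subseteq> L" using y(3) j b unfolding e by simp
    moreover have "L \<in> lines" using y b j by (simp add: L_def)
    ultimately have "L \<in> lam I" using j by (auto simp: lam_def)
    then show "y \<in> (\<lambda>(j, L). act (b j) L) ` (J \<times> lam I)"
      using j e by (auto intro!: image_eqI[of _ _ "(j, L)"])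
  qed
qed

text \<open>The parameters \<open>x\<close> for which \<open>(1, x)\<close> is isotropic in a
  hyperbolic plane.\<close>

definition nset :: "'a set" where
  "nset = {x. nrm x = -1}"

definition ept :: "'a \<Rightarrow> ('a^4) set" where
  "ept x = pt (vec4 1 x 0 0)"

definition ells :: "'a set \<Rightarrow> 'a set \<Rightarrow> ('a^4) set set" where
  "ells A B = {ell x y | x y. x \<in> A \<and> y \<in> B}"

lemma lam_ept: "A \<subseteq> nset \<Longrightarrow> lam (ept ` A) = ells A nset"
proof -
  assume A: "A \<subseteq> nset"
  have "lam (ept ` A) = (\<Union>x\<in>A. {L \<in> lines. pt (vec4 1 x 0 0) \<subseteq> L})"
    by (auto simp: lam_def ept_def)
  also have "\<dots> = (\<Union>x\<in>A. ell x ` nset)"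
    using A lines_through by (intro SUP_cong refl) (auto simp: nset_def subset_iff)
  also have "\<dots> = ells A nset" by (auto simp: ells_def)
  finally show ?thesis .
qed

lemma vec4_eq_0: "vec4 a b c d = 0 \<longleftrightarrow> a = 0 \<and> b = 0 \<and> c = 0 \<and> d = (0::'a)"
  by (simp add: vec4_eq_iff)

lemma ept_opts: "x \<in> nset \<Longrightarrow> ept x \<in> opts"
  unfolding opts_def ept_def nset_def by (auto simp: vec4_eq_0 h_self intro!: exI[of _ "vec4 1 x 0 0"])

lemma ept_eq_iff [simp]: "ept x = ept y \<longleftrightarrow> x = y"
  unfolding ept_def by (auto simp: pt_eq_iff vec4_eq_0 vec4_eq_iff)

lemma card_nset: "card nset = q + 1"
  unfolding nset_def by (rule card_nrm_eq) auto

lemma finite_nset: "finite nset" by simp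

text \<open>The square comes from the matrix diag(1/s, s), which has determinant one and multiplies
  the ratio of two coordinates by \<open>s\<^sup>2\<close>. As \<open>q + 1\<close> is even,
  squaring halves the order of \<open>s\<close>, and two orbits remain.\<close>

lemma nset_orbit:
  assumes s: "nrm s = 1" "\<And>i. s ^ i = 1 \<longleftrightarrow> (q + 1) dvd i"
  shows "\<exists>R\<subseteq>nset. card R = 2 \<and> bij_betw (\<lambda>(i, x). s ^ (2 * i) * x) ({..<(q + 1) div 2} \<times> R) nset"
proof -
  let ?g = "\<lambda>x. s\<^sup>2 * x"
  have pw: "(?g ^^ i) x = s ^ (2 * i) * x" for i x
    by (induction i) (auto simp: power2_eq_square algebra_simps)
  have ev: "even (q + 1)" using odd_q by simp
  let ?n = "(q + 1) div 2"
  have n: "?n > 0" using q_ge_3 by simp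
  have "\<exists>R\<subseteq>nset. bij_betw (\<lambda>(i, w). (?g ^^ i) w) ({..<?n} \<times> R) nset"
  proof (rule free_orbit_representatives[OF finite_nset n])
    show "(?g ^^ ?n) w = w" for w
      unfolding pw using s(2)[of "2 * ?n"] ev by simp
    show "s\<^sup>2 * w \<in> nset" if "w \<in> nset" for w using that s by (simp add: nset_def)
    show "(?g ^^ i) w \<noteq> w" if "w \<in> nset" "0 < i" "i < ?n" for i w
    proof
      assume "(?g ^^ i) w = w"
      moreover have "w \<noteq> 0" using that by (auto simp: nset_def)
      ultimately have "(q + 1) dvd 2 * i" using s(2)[of "2 * i"] by (simp add: pw)
      then show False using that by (auto dest: dvd_imp_le)
    qed
  qed
  then obtain R where R: "R \<subseteq> nset" "bij_betw (\<lambda>(i, w). (?g ^^ i) w) ({..<?n} \<times> R) nset"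
    by blast
  have "card ({..<?n} \<times> R) = card nset" using bij_betw_same_card[OF R(2)] .
  then have "?n * card R = q + 1" by (simp add: card_cartesian_product card_nset)
  moreover have "q + 1 = ?n * 2" using dvd_div_mult_self[OF ev] by simp
  ultimately have "card R = 2" using n by (metis mult_left_cancel not_gr_zero)
  then show ?thesis using R by (auto simp: pw)
qed

section \<open>Diagonal tori and the grid of lines \<open>ell x y\<close>\<close>

lemma diag_in_SU:
  assumes "nrm a = 1" "nrm b = 1" "nrm c = 1" "nrm d = 1" "a * b * c * d = 1"
  shows "cols (vec4 a 0 0 0) (vec4 0 b 0 0) (vec4 0 0 c 0) (vec4 0 0 0 d) \<in> SU"
  using assms unfolding SU_def
  by (auto simp: det_4 mat4_eq_iff forall_4 matrix_matrix_mult_def sum_4 mat_def nrm_def algebra_simps)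

lemma span2_scale: "c \<noteq> 0 \<Longrightarrow> d \<noteq> 0 \<Longrightarrow> span2 (c *s v) (d *s w) = span2 v w"
proof -
  assume cd: "c \<noteq> 0" "d \<noteq> 0"
  have "a *s (c *s v) + b *s (d *s w) = (a * c) *s v + (b * d) *s w"
    "a *s v + b *s w = (a / c) *s (c *s v) + (b / d) *s (d *s w)" for a b
    using cd by simp_all
  then show ?thesis
    unfolding span2_def by blast
qed

lemma torus_ells_1:
  assumes s: "nrm s = 1" and g: "g = cols (vec4 (inverse s) 0 0 0) (vec4 0 s 0 0) (vec4 0 0 1 0) (vec4 0 0 0 1)"
  shows "g \<in> SU" "act g (ell x y) = ell (s\<^sup>2 * x) y"
proof -
  have s0: "s \<noteq> 0" using s by auto
  show "g \<in> SU"
    unfolding g using s s0 by (intro diag_in_SU) auto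
  have "g *v vec4 1 x 0 0 = inverse s *s vec4 1 (s\<^sup>2 * x) 0 0"
    "g *v vec4 0 0 1 y = 1 *s vec4 0 0 1 y"
    using s0 by (simp_all add: g cols_vector_mult vec4_eq_iff power2_eq_square field_simps)
  then show "act g (ell x y) = ell (s\<^sup>2 * x) y"
    unfolding ell_def act_span2 using span2_scale[of "inverse s" 1] s0 by simp
qed

lemma torus_ells_2:
  assumes s: "nrm s = 1" and g: "g = cols (vec4 1 0 0 0) (vec4 0 1 0 0) (vec4 0 0 (inverse s) 0) (vec4 0 0 0 s)"
  shows "g \<in> SU" "act g (ell x y) = ell x (s\<^sup>2 * y)"
proof -
  have s0: "s \<noteq> 0" using s by auto
  show "g \<in> SU"
    unfolding g using s s0 by (intro diag_in_SU) auto
  have "g *v vec4 1 x 0 0 = 1 *s vec4 1 x 0 0"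
    "g *v vec4 0 0 1 y = inverse s *s vec4 0 0 1 (s\<^sup>2 * y)"
    using s0 by (simp_all add: g cols_vector_mult vec4_eq_iff power2_eq_square field_simps)
  then show "act g (ell x y) = ell x (s\<^sup>2 * y)"
    unfolding ell_def act_span2 using span2_scale[of 1 "inverse s"] s0 by simp
qed

lemma transitive_on_ells:
  assumes n: "nrm x = -1" "nrm y = -1" "nrm x' = -1" "nrm y' = -1"
  shows "\<exists>g\<in>SU. act g (ell x y) = ell x' y'"
proof -
  have nz: "x \<noteq> 0" "y \<noteq> 0" "x' \<noteq> 0" "y' \<noteq> 0" using n by auto
  \<comment> \<open>The frames below have determinants with ratio
    \<open>x' * y' / (x * y) * a / cj a\<close>; Hilbert's theorem 90 supplies an \<open>a\<close>
    that makes it one.\<close>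
  have "nrm (x' * y' / (x * y)) = 1" using n by simp
  then obtain a where a: "a \<noteq> 0" "cj a = x' * y' / (x * y) * a" using hilbert_90 by blast
  have c: "x * cj x = -1" "y * cj y = -1" "x' * cj x' = -1" "y' * cj y' = -1"
    using n by (simp_all add: nrm_def)
  have "\<exists>A\<in>SU. A *v vec4 1 x 0 0 = a *s vec4 1 x' 0 0 \<and> A *v vec4 1 (- x) 0 0 = (1 / cj a) *s vec4 1 (- x') 0 0 \<and>
     A *v vec4 0 0 1 y = vec4 0 0 1 y' \<and> A *v vec4 0 0 1 (- y) = vec4 0 0 1 (- y')"
  proof (rule frame_map)
    show "det (cols (a *s vec4 1 x' 0 0) ((1 / cj a) *s vec4 1 (- x') 0 0) (vec4 0 0 1 y') (vec4 0 0 1 (- y'))) =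
      det (cols (vec4 1 x 0 0) (vec4 1 (- x) 0 0) (vec4 0 0 1 y) (vec4 0 0 1 (- y)))"
      using a nz by (simp add: det_4 field_simps)
    show "det (cols (vec4 1 x 0 0) (vec4 1 (- x) 0 0) (vec4 0 0 1 y) (vec4 0 0 1 (- y))) \<noteq> 0"
      using nz by (simp add: det_4 flip: mult_2)
  qed (use c a(1) in \<open>simp_all add: h_vec4\<close>)
  then obtain A where A: "A \<in> SU" "A *v vec4 1 x 0 0 = a *s vec4 1 x' 0 0" "A *v vec4 0 0 1 y = 1 *s vec4 0 0 1 y'"
    by auto
  then have "act A (ell x y) = ell x' y'"
    unfolding ell_def act_span2 A using span2_scale[OF a(1), of 1] by simp
  then show ?thesis using A(1) by blast
qed

lemma torus_powers_1:
  assumes "nrm s = 1" "g = cols (vec4 (inverse s) 0 0 0) (vec4 0 s 0 0) (vec4 0 0 1 0) (vec4 0 0 0 1)"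
  shows "(act g ^^ i) (ell x y) = ell (s ^ (2 * i) * x) y"
  by (induction i) (auto simp: torus_ells_1[OF assms] power2_eq_square algebra_simps)

lemma torus_powers_2:
  assumes "nrm s = 1" "g = cols (vec4 1 0 0 0) (vec4 0 1 0 0) (vec4 0 0 (inverse s) 0) (vec4 0 0 0 s)"
  shows "(act g ^^ i) (ell x y) = ell x (s ^ (2 * i) * y)"
  by (induction i) (auto simp: torus_ells_2[OF assms] power2_eq_square algebra_simps)

lemma preim_ells_nonempty:
  assumes "\<xi> \<in> nset" "A \<subseteq> nset" "B \<subseteq> nset" "A \<noteq> {}" "B \<noteq> {}"
  shows "preim SU (ell \<xi> \<xi>) (ells A B) \<noteq> {}"
proof -
  obtain x y where xy: "x \<in> A" "y \<in> B"
    using assms by blast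
  then obtain g where "g \<in> SU" "act g (ell \<xi> \<xi>) = ell x y"
    using transitive_on_ells[of \<xi> \<xi> x y] assms by (auto simp: nset_def subset_iff)
  then show ?thesis using xy by (auto simp: preim_def ells_def)
qed

lemma ells_bij:
  assumes A: "bij_betw (\<lambda>(i, x). f i * x) (I \<times> R) N"
  shows "bij_betw (\<lambda>(i, (x, y)). ell (f i * x) y) (I \<times> (R \<times> B)) (ells N B)"
    "bij_betw (\<lambda>(i, (x, y)). ell x (f i * y)) (I \<times> (B \<times> R)) (ells B N)"
proof -
  have inj: "i = j \<and> x = x'" if "i \<in> I" "j \<in> I" "x \<in> R" "x' \<in> R" "f i * x = f j * x'" for i j x x'
    using A that unfolding bij_betw_def inj_on_def by auto
  have N: "N = (\<lambda>(i, x). f i * x) ` (I \<times> R)" using A by (simp add: bij_betw_def)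
  show "bij_betw (\<lambda>(i, (x, y)). ell (f i * x) y) (I \<times> (R \<times> B)) (ells N B)"
    unfolding bij_betw_def
  proof (intro conjI inj_onI)
    fix u v assume uv: "u \<in> I \<times> (R \<times> B)" "v \<in> I \<times> (R \<times> B)"
      "(\<lambda>(i, (x, y)). ell (f i * x) y) u = (\<lambda>(i, (x, y)). ell (f i * x) y) v"
    obtain i x y where u: "u = (i, (x, y))" by (metis prod.exhaust)
    obtain j x' y' where v: "v = (j, (x', y'))" by (metis prod.exhaust)
    show "u = v" using uv inj[of i j x x'] by (simp add: u v ell_eq_iff)
  next
    show "(\<lambda>(i, (x, y)). ell (f i * x) y) ` (I \<times> (R \<times> B)) = ells N B"
      unfolding ells_def N by (auto simp: image_iff; blast)
  qed
  show "bij_betw (\<lambda>(i, (x, y)). ell x (f i * y)) (I \<times> (B \<times> R)) (ells B N)"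
    unfolding bij_betw_def
  proof (intro conjI inj_onI)
    fix u v assume uv: "u \<in> I \<times> (B \<times> R)" "v \<in> I \<times> (B \<times> R)"
      "(\<lambda>(i, (x, y)). ell x (f i * y)) u = (\<lambda>(i, (x, y)). ell x (f i * y)) v"
    obtain i x y where u: "u = (i, (x, y))" by (metis prod.exhaust)
    obtain j x' y' where v: "v = (j, (x', y'))" by (metis prod.exhaust)
    show "u = v" using uv inj[of i j y y'] by (simp add: u v ell_eq_iff)
  next
    show "(\<lambda>(i, (x, y)). ell x (f i * y)) ` (I \<times> (B \<times> R)) = ells B N"
      unfolding ells_def N by (auto simp: image_iff; blast)
  qed
qed

lemma bij_ell: "bij_betw (\<lambda>(x, y). ell x y) (A \<times> B) (ells A B)"
  unfolding bij_betw_def ells_def by (auto simp: inj_on_def ell_eq_iff)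

lemma bij_betw_reparam:
  assumes "bij_betw (\<lambda>(i, p). F i p) (I \<times> P) Y" "bij_betw e P Q"
    and "\<And>i p. i \<in> I \<Longrightarrow> p \<in> P \<Longrightarrow> F i p = G i (e p)"
  shows "bij_betw (\<lambda>(i, p). G i p) (I \<times> Q) Y"
proof -
  have m: "bij_betw (map_prod id e) (I \<times> P) (I \<times> Q)"
    using assms(2) by (intro bij_betw_map_prod) auto
  have "bij_betw ((\<lambda>(i, p). G i p) \<circ> map_prod id e) (I \<times> P) Y"
    using assms(1) by (rule bij_betw_cong[THEN iffD1, rotated]) (auto simp: assms(3))
  then show ?thesis using m by (simp add: bij_betw_comp_iff)
qed

text \<open>One torus for each coordinate reduces \<open>nset\<close> to the two representatives in
  \<open>R\<close>. The four lines left are gathered by a single set of size four, which costs no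
  more than two factors of size two. The second claim is separate because the case
  \<open>q + 1 = 2 * p\<close> enters the chain there.\<close>

lemma mls_ells:
  assumes \<xi>: "\<xi> \<in> nset" and s: "nrm s = 1" and R: "R \<subseteq> nset" "card R = 2"
    and bij: "bij_betw (\<lambda>(i, x). s ^ (2 * i) * x) ({..<(q + 1) div 2} \<times> R) nset"
  shows "mls_rel (SU4 q) (preim SU (ell \<xi> \<xi>) (ells nset nset)) (preim SU (ell \<xi> \<xi>) (ells R nset))"
    and "mls_rel (SU4 q) (preim SU (ell \<xi> \<xi>) (ells R nset)) (preim SU (ell \<xi> \<xi>) {ell \<xi> \<xi>})"
proof -
  let ?n = "(q + 1) div 2"
  have n: "?n > 0" using q_ge_3 by simp
  have ne: "R \<noteq> {}" "nset \<noteq> {}" using R \<xi> by auto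
  define g1 where "g1 = cols (vec4 (inverse s) 0 0 0) (vec4 0 s 0 0) (vec4 0 0 1 0) (vec4 0 0 0 1)"
  define g2 where "g2 = cols (vec4 1 0 0 0) (vec4 0 1 0 0) (vec4 0 0 (inverse s) 0) (vec4 0 0 0 s)"
  have "bij_betw (\<lambda>(i, L). (act g1 ^^ i) L) ({..<?n} \<times> ells R nset) (ells nset nset)"
    by (rule bij_betw_reparam[OF ells_bij(1)[OF bij] bij_ell])
      (auto simp: torus_powers_1[OF s g1_def])
  then show "mls_rel (SU4 q) (preim SU (ell \<xi> \<xi>) (ells nset nset)) (preim SU (ell \<xi> \<xi>) (ells R nset))"
    using torus_ells_1(1)[OF s g1_def] n \<xi> R ne
    by (intro mls_preim_powers[OF su_closed_SU] preim_ells_nonempty) auto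
  have "bij_betw (\<lambda>(i, L). (act g2 ^^ i) L) ({..<?n} \<times> ells R R) (ells R nset)"
    by (rule bij_betw_reparam[OF ells_bij(2)[OF bij] bij_ell])
      (auto simp: torus_powers_2[OF s g2_def])
  then have "mls_rel (SU4 q) (preim SU (ell \<xi> \<xi>) (ells R nset)) (preim SU (ell \<xi> \<xi>) (ells R R))"
    using torus_ells_2(1)[OF s g2_def] n \<xi> R ne
    by (intro mls_preim_powers[OF su_closed_SU] preim_ells_nonempty) auto
  also have "mls_rel (SU4 q) (preim SU (ell \<xi> \<xi>) (ells R R)) (preim SU (ell \<xi> \<xi>) {ell \<xi> \<xi>})"
  proof -
    have "\<forall>p\<in>R \<times> R. \<exists>g\<in>SU. act g (ell \<xi> \<xi>) = ell (fst p) (snd p)"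
      using transitive_on_ells[of \<xi> \<xi>] \<xi> R(1) by (auto simp: nset_def subset_iff)
    then obtain b where b: "\<And>p. p \<in> R \<times> R \<Longrightarrow> b p \<in> SU" "\<And>p. p \<in> R \<times> R \<Longrightarrow> act (b p) (ell \<xi> \<xi>) = ell (fst p) (snd p)"
      by metis
    have "bij_betw (\<lambda>(p, L). act (b p) L) ((R \<times> R) \<times> {ell \<xi> \<xi>}) (ells R R)"
      unfolding bij_betw_def
    proof (intro conjI inj_onI)
      fix u v assume "u \<in> (R \<times> R) \<times> {ell \<xi> \<xi>}" "v \<in> (R \<times> R) \<times> {ell \<xi> \<xi>}"
        "(\<lambda>(p, L). act (b p) L) u = (\<lambda>(p, L). act (b p) L) v"
      then show "u = v" using b(2) by (auto simp: ell_eq_iff)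
    next
      show "(\<lambda>(p, L). act (b p) L) ` ((R \<times> R) \<times> {ell \<xi> \<xi>}) = ells R R"
      proof -
        have "(\<lambda>(p, L). act (b p) L) ` ((R \<times> R) \<times> {ell \<xi> \<xi>}) = (\<lambda>p. ell (fst p) (snd p)) ` (R \<times> R)"
          using b(2) by (force simp: image_iff)
        also have "\<dots> = ells R R"
          unfolding ells_def by (force simp: ell_eq_iff)
        finally show ?thesis .
      qed
    qed
    moreover have "card (R \<times> R) = 4" using R by (simp add: card_cartesian_product)
    moreover have "preim SU (ell \<xi> \<xi>) {ell \<xi> \<xi>} \<noteq> {}"
      using act_one SU_one by (auto simp: preim_def intro!: exI[of _ "mat 1"])
    ultimately show ?thesis using b by (intro mls_preim_single[OF su_closed_SU, of "R \<times> R" b]) auto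
  qed
  finally show "mls_rel (SU4 q) (preim SU (ell \<xi> \<xi>) (ells R nset)) (preim SU (ell \<xi> \<xi>) {ell \<xi> \<xi>})" .
qed

section \<open>Coordinates on the curve, its size and its blocks\<close>

definition dset :: "('a \<times> 'a) set" where
  "dset = {(a, b). nrm a + nrm b = -1}"

definition pt3 :: "'a \<times> 'a \<Rightarrow> ('a^4) set" where
  "pt3 p = pt (vec4 (fst p) (snd p) 1 0)"

lemma pt3_eq_iff [simp]: "pt3 p = pt3 r \<longleftrightarrow> p = r"
  unfolding pt3_def by (auto simp: pt_eq_iff vec4_eq_0 vec4_eq_iff prod_eq_iff)

lemma ept_neq_pt3 [simp]: "ept x \<noteq> pt3 p"
  unfolding pt3_def ept_def by (auto simp: pt_eq_iff vec4_eq_0 vec4_eq_iff)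

lemma opts_eq: "opts = ept ` nset \<union> pt3 ` dset"
proof (intro equalityI subsetI)
  fix P assume "P \<in> opts"
  then obtain v where v: "P = pt v" "v \<noteq> 0" "v$4 = 0" "h v v = 0" by (auto simp: opts_def)
  have n: "nrm (v$1) + nrm (v$2) + nrm (v$3) = 0" using v by (simp add: h_self)
  show "P \<in> ept ` nset \<union> pt3 ` dset"
  proof (cases "v$3 = 0")
    case True
    have v1: "v$1 \<noteq> 0" using n True v by (auto simp: vec4_eq_iff)
    have "P = pt ((1 / v$1) *s v)" using v v1 pt_scale by simp
    also have "(1 / v$1) *s v = vec4 1 (v$2 / v$1) 0 0" using v v1 True by (simp add: vec4_eq_iff)
    finally have "P = ept (v$2 / v$1)" by (simp add: ept_def)
    moreover have "nrm (v$2) = - nrm (v$1)" using n True by (simp add: add_eq_0_iff)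
    then have "v$2 / v$1 \<in> nset" using v1 by (simp add: nset_def)
    ultimately show ?thesis by blast
  next
    case False
    have "P = pt ((1 / v$3) *s v)" using v False pt_scale by simp
    also have "(1 / v$3) *s v = vec4 (v$1 / v$3) (v$2 / v$3) 1 0" using v False by (simp add: vec4_eq_iff)
    finally have "P = pt3 (v$1 / v$3, v$2 / v$3)" by (simp add: pt3_def)
    moreover have "nrm (v$1) + nrm (v$2) = - nrm (v$3)" using n by (simp add: eq_neg_iff_add_eq_0)
    then have "(v$1 / v$3, v$2 / v$3) \<in> dset" using False by (simp add: dset_def flip: add_divide_distrib)
    ultimately show ?thesis by blast
  qed
next
  fix P assume "P \<in> ept ` nset \<union> pt3 ` dset"
  moreover have "pt3 p \<in> opts" if "p \<in> dset" for p
  proof -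
    have "vec4 (fst p) (snd p) 1 0 \<noteq> 0" "vec4 (fst p) (snd p) 1 0 $ 4 = 0"
      "h (vec4 (fst p) (snd p) 1 0) (vec4 (fst p) (snd p) 1 0) = 0"
      using that by (auto simp: dset_def h_self vec4_eq_0)
    then show ?thesis
      unfolding opts_def pt3_def by blast
  qed
  ultimately show "P \<in> opts" using ept_opts by auto
qed

text \<open>The count runs over \<open>a\<close>: if \<open>a\<close> has norm -1, only
  \<open>b = 0\<close> remains; otherwise \<open>b\<close> has a prescribed nonzero norm in
  GF(q).\<close>

lemma card_dset: "card dset = (q + 1) * (q\<^sup>2 - q)"
proof -
  have fib: "card {b. nrm a + nrm b = -1} = (if a \<in> nset then 1 else q + 1)" for a
  proof (cases "a \<in> nset")
    case True
    then have "{b. nrm a + nrm b = -1} = {0}" by (auto simp: nset_def)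
    then show ?thesis using True by simp
  next
    case False
    have "{b. nrm a + nrm b = -1} = {b. nrm b = -1 - nrm a}" by (auto simp: algebra_simps)
    moreover have "card {b. nrm b = -1 - nrm a} = q + 1"
      using False by (intro card_nrm_eq) (auto simp: nset_def)
    ultimately show ?thesis using False by simp
  qed
  have le: "q + 1 \<le> q\<^sup>2" using card_mono[of UNIV nset] card_nset card_field by simp
  have "dset = Sigma UNIV (\<lambda>a. {b. nrm a + nrm b = -1})" by (auto simp: dset_def)
  then have "card dset = (\<Sum>a\<in>UNIV. if a \<in> nset then 1 else q + 1)" by (simp add: fib)
  also have "\<dots> = (\<Sum>a\<in>nset. 1) + (\<Sum>a\<in>- nset. q + 1)"
    by (subst sum.If_cases) (auto simp: Compl_eq)
  also have "\<dots> = (q + 1) + (q\<^sup>2 - (q + 1)) * (q + 1)"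
    using card_nset card_Diff_subset[of nset UNIV] by (simp add: Compl_eq_Diff_UNIV card_field)
  also have "\<dots> = (q + 1) * (q\<^sup>2 - q)"
  proof -
    obtain k where k: "q\<^sup>2 = q + 1 + k"
      using le le_Suc_ex by blast
    show ?thesis by (simp add: k)
  qed
  finally show ?thesis .
qed

lemma card_opts: "card opts = (q + 1) * (q\<^sup>2 - q + 1)"
proof -
  have "card opts = card (ept ` nset) + card (pt3 ` dset)"
    unfolding opts_eq by (rule card_Un_disjoint) auto
  also have "\<dots> = (q + 1) + (q + 1) * (q\<^sup>2 - q)"
    by (simp add: card_image inj_on_def card_nset card_dset)
  finally show ?thesis by simp
qed

lemma block_matrix_SU:
  assumes "nrm m1 + nrm m2 = 1"
  shows "cols (vec4 0 0 1 0) (vec4 m1 m2 0 0) (vec4 (- cj m2) (cj m1) 0 0) (vec4 0 0 0 1) \<in> SU"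
  using assms unfolding SU_def
  by (auto simp: det_4 mat4_eq_iff forall_4 matrix_matrix_mult_def sum_4 mat_def nrm_def algebra_simps)

lemma nset_powers:
  assumes s: "nrm s = 1" "\<And>i. s ^ i = 1 \<longleftrightarrow> (q + 1) dvd i" and \<xi>: "\<xi> \<in> nset"
  shows "bij_betw (\<lambda>i. s ^ i * \<xi>) {..<q + 1} nset"
proof -
  have x0: "\<xi> \<noteq> 0" and s0: "s \<noteq> 0" using \<xi> s(1) by (auto simp: nset_def)
  have le: "i = j" if "i \<le> j" "j < q + 1" "s ^ i = s ^ j" for i j
  proof -
    have "s ^ i * s ^ (j - i) = s ^ j" using that(1) by (simp flip: power_add)
    then have "s ^ i * s ^ (j - i) = s ^ i" using that(3) by simp
    then have "(q + 1) dvd (j - i)" using s0 s(2) by simp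
    then show ?thesis using that by (auto dest!: dvd_imp_le)
  qed
  have inj: "inj_on (\<lambda>i. s ^ i * \<xi>) {..<q + 1}"
  proof (rule inj_onI)
    fix i j assume "i \<in> {..<q + 1}" "j \<in> {..<q + 1}" "s ^ i * \<xi> = s ^ j * \<xi>"
    then show "i = j" using x0 le[of i j] le[of j i] by (cases "i \<le> j") auto
  qed
  moreover have "(\<lambda>i. s ^ i * \<xi>) ` {..<q + 1} = nset"
  proof (rule card_subset_eq[OF finite_nset])
    show "card ((\<lambda>i. s ^ i * \<xi>) ` {..<q + 1}) = card nset"
      using card_image[OF inj] by (simp add: card_nset)
  qed (use \<xi> s in \<open>auto simp: nset_def\<close>)
  ultimately show ?thesis by (simp add: bij_betw_def)
qed

lemma block_partition:
  "\<exists>(J :: ('a \<times> 'a) option set) b. finite J \<and> card J = q\<^sup>2 - q + 1 \<and> (\<forall>j\<in>J. b j \<in> SU) \<and>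
     bij_betw (\<lambda>(j, P). act (b j) P) (J \<times> ept ` nset) opts"
proof -
  obtain s where s: "nrm s = 1" "\<And>i. s ^ i = 1 \<longleftrightarrow> (q + 1) dvd i"
    using nrm_1_generator by blast
  obtain \<xi> where \<xi>: "\<xi> \<in> nset"
    using nrm_surj[of "-1"] by (auto simp: nset_def)
  have x0: "\<xi> \<noteq> 0" and s0: "s \<noteq> 0" using \<xi> s(1) by (auto simp: nset_def)
  \<comment> \<open>Apart from \<open>ept ` nset\<close>, the blocks are the orbits of the scaling of \<open>(x\<^sub>1, x\<^sub>2)\<close> by elements of norm one.\<close>
  let ?g = "\<lambda>(a, b). (s * a, s * b)"
  have pw: "(?g ^^ i) p = (s ^ i * fst p, s ^ i * snd p)" for i p by (induction i) (auto simp: algebra_simps)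
  have "\<exists>R\<subseteq>dset. bij_betw (\<lambda>(i, w). (?g ^^ i) w) ({..<q + 1} \<times> R) dset"
  proof (rule free_orbit_representatives)
    show "finite dset" by simp
    show "(?g ^^ (q + 1)) w = w" for w
      unfolding pw using s(2)[of "q + 1"] by simp
    show "?g w \<in> dset" if "w \<in> dset" for w using that s by (auto simp: dset_def)
    show "(?g ^^ i) w \<noteq> w" if w: "w \<in> dset" "0 < i" "i < q + 1" for i w
    proof
      assume "(?g ^^ i) w = w"
      then have e: "s ^ i * fst w = fst w" "s ^ i * snd w = snd w"
        unfolding pw by (metis fst_conv snd_conv)+
      have "fst w \<noteq> 0 \<or> snd w \<noteq> 0" using w by (auto simp: dset_def)
      then have "s ^ i = 1" using e by auto
      then show False using w s(2)[of i] by (auto dest: dvd_imp_le)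
    qed
  qed simp
  then obtain R where R: "R \<subseteq> dset" "bij_betw (\<lambda>(i, w). (?g ^^ i) w) ({..<q + 1} \<times> R) dset"
    by blast
  have "card ({..<q + 1} \<times> R) = card dset" using bij_betw_same_card[OF R(2)] .
  then have "(q + 1) * card R = (q + 1) * (q\<^sup>2 - q)"
    by (simp only: card_cartesian_product card_dset card_lessThan)
  then have cR: "card R = q\<^sup>2 - q" by (metis mult_left_cancel add_is_0 zero_neq_one)
  \<comment> \<open>The second column of \<open>B p\<close> is multiplied by the coordinate
    \<open>s ^ i * \<xi>\<close>, so dividing by \<open>\<xi>\<close> yields \<open>s ^ i\<close>
    times \<open>p\<close>, while the first column supplies the third coordinate 1. The division
    also turns the norm sum -1 of \<open>p\<close> into the 1 of a unit vector.\<close>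
  define m where "m p = (fst p / \<xi>, snd p / \<xi>)" for p
  define B where "B p = cols (vec4 0 0 1 0) (vec4 (fst (m p)) (snd (m p)) 0 0)
     (vec4 (- cj (snd (m p))) (cj (fst (m p))) 0 0) (vec4 0 0 0 1)" for p
  \<comment> \<open>\<open>None\<close> stands for the block from which all others are reached,
    hence the identity.\<close>
  define b where "b j = (case j of None \<Rightarrow> mat 1 | Some p \<Rightarrow> B p)" for j
  have BSU: "B p \<in> SU" if "p \<in> R" for p
  proof -
    have "nrm (fst p) + nrm (snd p) = -1" using that R(1) by (auto simp: dset_def)
    then have "nrm (fst (m p)) + nrm (snd (m p)) = 1"
      using \<xi> by (simp add: m_def nset_def) (metis add.commute minus_add_distrib minus_equation_iff uminus_add_conv_diff)
    then show ?thesis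
      unfolding B_def by (rule block_matrix_SU)
  qed
  have Bact: "act (B p) (ept (s ^ i * \<xi>)) = pt3 ((?g ^^ i) p)" for p i
  proof -
    have "B p *v vec4 1 (s ^ i * \<xi>) 0 0 = vec4 (s ^ i * fst p) (s ^ i * snd p) 1 0"
      using x0 by (simp add: B_def cols_vector_mult vec4_eq_iff m_def)
    then show ?thesis by (simp add: ept_def pt3_def act_pt pw)
  qed
  let ?J = "insert None (Some ` R)"
  have finR: "finite R" by simp
  have nb: "bij_betw (\<lambda>i. ept (s ^ i * \<xi>)) {..<q + 1} (ept ` nset)"
  proof -
    have "bij_betw ept nset (ept ` nset)" by (auto simp: bij_betw_def inj_on_def)
    from bij_betw_trans[OF nset_powers[OF s \<xi>] this] show ?thesis by (simp add: comp_def)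
  qed
  have b1: "bij_betw (\<lambda>(j, P). act (b j) P) ({None} \<times> ept ` nset) (ept ` nset)"
    by (rule bij_betw_byWitness[where f' = "\<lambda>P. (None, P)"]) (auto simp: b_def)
  have p3: "bij_betw pt3 dset (pt3 ` dset)" by (auto simp: bij_betw_def inj_on_def)
  have sw: "bij_betw (\<lambda>(i, w). pt3 ((?g ^^ i) w)) ({..<q + 1} \<times> R) (pt3 ` dset)"
    using bij_betw_trans[OF R(2) p3] by (simp add: comp_def case_prod_beta')
  have b2: "bij_betw (\<lambda>(j, P). act (b j) P) (Some ` R \<times> ept ` nset) (pt3 ` dset)"
  proof -
    have k: "bij_betw (\<lambda>(i, w). (Some w, ept (s ^ i * \<xi>))) ({..<q + 1} \<times> R) (Some ` R \<times> ept ` nset)"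
    proof -
      have "bij_betw (map_prod Some (\<lambda>i. ept (s ^ i * \<xi>))) (R \<times> {..<q + 1}) (Some ` R \<times> ept ` nset)"
        by (rule bij_betw_map_prod[OF _ nb]) (auto simp: bij_betw_def)
      moreover have "bij_betw prod.swap ({..<q + 1} \<times> R) (R \<times> {..<q + 1})"
        by (rule bij_betw_byWitness[where f' = prod.swap]) auto
      ultimately have "bij_betw (map_prod Some (\<lambda>i. ept (s ^ i * \<xi>)) \<circ> prod.swap) ({..<q + 1} \<times> R) (Some ` R \<times> ept ` nset)"
        using bij_betw_trans by blast
      then show ?thesis by (simp add: comp_def case_prod_beta' map_prod_def)
    qed
    have "bij_betw ((\<lambda>(j, P). act (b j) P) \<circ> (\<lambda>(i, w). (Some w, ept (s ^ i * \<xi>)))) ({..<q + 1} \<times> R) (pt3 ` dset)"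
      using sw by (rule bij_betw_cong[THEN iffD1, rotated]) (auto simp: b_def Bact)
    then show ?thesis using bij_betw_comp_iff[OF k] by blast
  qed
  have "bij_betw (\<lambda>(j, P). act (b j) P) ({None} \<times> ept ` nset \<union> Some ` R \<times> ept ` nset) (ept ` nset \<union> pt3 ` dset)"
    by (rule bij_betw_combine[OF b1 b2]) auto
  moreover have "{None} \<times> ept ` nset \<union> Some ` R \<times> ept ` nset = ?J \<times> ept ` nset"
    by auto
  ultimately have "bij_betw (\<lambda>(j, P). act (b j) P) (?J \<times> ept ` nset) opts"
    by (simp add: opts_eq)
  moreover have "card ?J = q\<^sup>2 - q + 1" using finR by (simp add: card_image cR)
  moreover have "\<forall>j\<in>?J. b j \<in> SU" using BSU by (auto simp: b_def)
  ultimately show ?thesis using finR by (intro exI[of _ ?J] exI[of _ b]) auto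
qed

lemma preim_lines: "\<xi> \<in> nset \<Longrightarrow> preim SU (ell \<xi> \<xi>) lines = SU"
  using ell_in_lines by (auto simp: preim_def nset_def)

lemma mls_lines_case1:
  assumes "prime (q\<^sup>2 - q + 1)" and \<xi>: "\<xi> \<in> nset"
  shows "mls_rel (SU4 q) SU (preim SU (ell \<xi> \<xi>) {ell \<xi> \<xi>})"
proof -
  obtain s where s: "nrm s = 1" "\<And>i. s ^ i = 1 \<longleftrightarrow> (q + 1) dvd i"
    using nrm_1_generator by blast
  obtain R where R: "R \<subseteq> nset" "card R = 2"
    "bij_betw (\<lambda>(i, x). s ^ (2 * i) * x) ({..<(q + 1) div 2} \<times> R) nset"
    using nset_orbit[OF s] by blast
  obtain J :: "('a \<times> 'a) option set" and b where J: "finite J" "card J = q\<^sup>2 - q + 1" "\<forall>j\<in>J. b j \<in> SU"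
     "bij_betw (\<lambda>(j, P). act (b j) P) (J \<times> ept ` nset) opts"
    using block_partition by blast
  have "bij_betw (\<lambda>(j, L). act (b j) L) (J \<times> lam (ept ` nset)) (lam opts)"
    using J ept_opts by (intro lam_bij) auto
  then have "bij_betw (\<lambda>(j, L). act (b j) L) (J \<times> ells nset nset) lines"
    by (simp add: lam_ept lam_opts)
  then have "mls_rel (SU4 q) (preim SU (ell \<xi> \<xi>) lines) (preim SU (ell \<xi> \<xi>) (ells nset nset))"
    using J assms \<xi> by (intro mls_preim_single[OF su_closed_SU, of J b] preim_ells_nonempty) auto
  also have "mls_rel (SU4 q) (preim SU (ell \<xi> \<xi>) (ells nset nset)) (preim SU (ell \<xi> \<xi>) (ells R nset))"
    by (rule mls_ells(1)[OF \<xi> s(1) R])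
  also have "mls_rel (SU4 q) (preim SU (ell \<xi> \<xi>) (ells R nset)) (preim SU (ell \<xi> \<xi>) {ell \<xi> \<xi>})"
    by (rule mls_ells(2)[OF \<xi> s(1) R])
  finally show ?thesis by (simp add: preim_lines[OF \<xi>])
qed

section \<open>Transitivity on pairs of points of the curve\<close>

lemma det_conjT: "det (conjT q A) = cj (det A)" for A :: "'a^4^4" by (simp add: det_4 algebra_simps)

lemma vec4_4_mult:
  assumes "A \<in> SU" "A *v vec4 0 0 0 1 = vec4 0 0 0 1"
  shows "(A *v x) $ 4 = x $ 4"
proof -
  have "y $ 4 = h y (vec4 0 0 0 1)" for y by (simp add: h_def)
  then show ?thesis using SU_h[OF assms(1), of x "vec4 0 0 0 1"] assms(2) by simp
qed

text \<open>Two orthogonal points would span a totally isotropic line with two points on the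
  curve.\<close>

lemma opts_not_orthogonal:
  assumes "pt x \<noteq> pt y" "x \<noteq> 0" "y \<noteq> 0" "x$4 = 0" "y$4 = 0" "h x x = 0" "h y y = 0"
  shows "h x y \<noteq> 0"
proof
  assume h0: "h x y = 0"
  have "indep x y"
    unfolding indep_def
  proof (intro allI impI)
    fix a b assume e: "a *s x + b *s y = 0"
    have "b = 0"
    proof (rule ccontr)
      assume b: "b \<noteq> 0"
      have "b *s y = (- a) *s x" using e by (simp add: vec_eq_iff eq_neg_iff_add_eq_0 add.commute)
      then have "(1 / b) *s (b *s y) = (1 / b) *s ((- a) *s x)" by simp
      then have "y = (- a / b) *s x" using b by simp
      then show False using assms pt_eq_iff by blast
    qed
    then show "a = 0 \<and> b = 0" using e assms(2) by simp
  qed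
  then have L: "span2 x y \<in> lines" using assms h0 by (auto simp: lines_def)
  have "pt x \<in> opts" "pt y \<in> opts" using assms by (auto simp: opts_def)
  then show False using line_meets_opts_unique[OF L] pt_subset_line[OF L] assms(1) by (metis span2_gens)
qed

text \<open>Lagrange's identity for cross products; capitals stand for the conjugates, which makes
  it a polynomial identity.\<close>

lemma cross_norm:
  fixes x1 x2 x3 y1 y2 y3 X1 X2 X3 Y1 Y2 Y3 :: 'a
  shows "(x2*y3 - x3*y2) * (X2*Y3 - X3*Y2) + (x3*y1 - x1*y3) * (X3*Y1 - X1*Y3) + (x1*y2 - x2*y1) * (X1*Y2 - X2*Y1)
    = (x1*X1 + x2*X2 + x3*X3) * (y1*Y1 + y2*Y2 + y3*Y3) - (x1*Y1 + x2*Y2 + x3*Y3) * (X1*y1 + X2*y2 + X3*y3)"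
  by (simp add: algebra_simps)

lemma transitive_on_pairs:
  assumes n: "x0 \<in> nset" "x1 \<in> nset" "x0 \<noteq> x1" and PQ: "P \<in> opts" "Q \<in> opts" "P \<noteq> Q"
  shows "\<exists>b\<in>SU. act b (ept x0) = P \<and> act b (ept x1) = Q"
proof -
  obtain x where x: "P = pt x" "x \<noteq> 0" "x$4 = 0" "h x x = 0"
    using PQ by (auto simp: opts_def)
  obtain y where y: "Q = pt y" "y \<noteq> 0" "y$4 = 0" "h y y = 0"
    using PQ by (auto simp: opts_def)
  have hxy: "h x y \<noteq> 0" using opts_not_orthogonal x y PQ by auto
  have x0: "x0 \<noteq> 0" "x1 \<noteq> 0" "x0 * cj x0 = -1" "x1 * cj x1 = -1"
    using n by (auto simp: nset_def nrm_def)
  define k where "k = h (vec4 1 x0 0 0) (vec4 1 x1 0 0)"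
  have k0: "k \<noteq> 0"
  proof
    assume "k = 0"
    then have "x1 * (1 + x0 * cj x1) = 0" by (simp add: k_def h_vec4)
    then have "x1 + x0 * (x1 * cj x1) = 0" by (simp add: algebra_simps)
    then show False using n(3) x0(4) by simp
  qed
  \<comment> \<open>A representative of \<open>Q\<close> may be rescaled; with the factor
    \<open>m\<close> its pairing with \<open>x\<close> equals that of the two source
    vectors.\<close>
  define m where "m = cj (k / h x y)"
  have m0: "m \<noteq> 0" using k0 hxy by (simp add: m_def)
  \<comment> \<open>The conjugated cross product spans the orthogonal complement of \<open>x\<close>
    and \<open>y\<close> in the plane. By Lagrange's identity it is not isotropic, so it can be
    scaled to a unit vector.\<close>
  define z where "z = vec4 (cj (x$2 * y$3 - x$3 * y$2)) (cj (x$3 * y$1 - x$1 * y$3)) (cj (x$1 * y$2 - x$2 * y$1)) 0"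
  have hxz: "h x z = 0" "h y z = 0" using x y by (simp_all add: h_def z_def algebra_simps)
  have "h z z = (x$1 * cj (x$1) + x$2 * cj (x$2) + x$3 * cj (x$3)) * (y$1 * cj (y$1) + y$2 * cj (y$2) + y$3 * cj (y$3))
     - (x$1 * cj (y$1) + x$2 * cj (y$2) + x$3 * cj (y$3)) * (cj (x$1) * y$1 + cj (x$2) * y$2 + cj (x$3) * y$3)"
    unfolding cross_norm[symmetric] by (simp add: h_def z_def mult.commute)
  also have "\<dots> = h x x * h y y - h x y * cj (h x y)" using x y by (simp add: h_def)
  finally have hzz: "h z z = - nrm (h x y)" by (simp add: x nrm_def)
  then have "cj (1 / h z z) = 1 / h z z" by simp
  then obtain \<zeta> where \<zeta>: "nrm \<zeta> = 1 / h z z" using nrm_surj by blast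
  define w1 where "w1 = x"
  define w2 where "w2 = m *s y"
  define w3 where "w3 = \<zeta> *s z"
  define d4 where "d4 = vec4 0 0 0 (1::'a)"
  define v1 where "v1 = vec4 1 x0 0 0"
  define v2 where "v2 = vec4 1 x1 0 0"
  define v3 where "v3 = vec4 0 0 (1::'a) 0"
  have g: "h w1 w1 = h v1 v1" "h w2 w2 = h v2 v2" "h w3 w3 = h v3 v3"
      "h w1 w2 = h v1 v2" "h w1 w3 = h v1 v3" "h w2 w3 = h v2 v3"
  proof -
    show "h w1 w1 = h v1 v1" "h w2 w2 = h v2 v2"
      using x y x0 by (simp_all add: w1_def w2_def v1_def v2_def h_vec4)
    show "h w3 w3 = h v3 v3"
    proof -
      have "h w3 w3 = nrm \<zeta> * h z z" by (simp add: w3_def nrm_def)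
      then show ?thesis using hzz hxy by (simp add: \<zeta> v3_def h_vec4)
    qed
    show "h w1 w2 = h v1 v2" using hxy by (simp add: w1_def w2_def m_def k_def v1_def v2_def)
    show "h w1 w3 = h v1 v3" "h w2 w3 = h v2 v3"
      by (simp_all add: w1_def w2_def w3_def v1_def v2_def v3_def hxz h_vec4)
  qed
  have g4: "h w1 d4 = h v1 d4" "h w2 d4 = h v2 d4" "h w3 d4 = h v3 d4" "h v1 d4 = 0" "h v2 d4 = 0" "h v3 d4 = 0" "h d4 d4 = 1"
    using x y by (simp_all add: w1_def w2_def w3_def v1_def v2_def v3_def d4_def z_def h_def)
  let ?V = "cols v1 v2 v3 d4" and ?W = "cols w1 w2 w3 d4"
  have detV: "det ?V \<noteq> 0" using n(3) by (simp add: det_4 v1_def v2_def v3_def d4_def)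
  have "det (conjT q ?W ** ?W) = det (conjT q ?V ** ?V)"
    using gram_cols_eq[OF g(1-3) refl[of "h d4 d4"] g(4,5) g4(1) g(6) g4(2,3)] by simp
  then have nn: "nrm (det ?W) = nrm (det ?V)" by (simp add: det_mul det_conjT nrm_def mult.commute)
  then have detW: "det ?W \<noteq> 0" using detV by (metis nrm_simps(8))
  \<comment> \<open>Equal Gram matrices force the two determinants to have the same norm; the
    remaining factor of norm one is put on the fourth basis vector, which is orthogonal to the
    plane.\<close>
  define \<delta> where "\<delta> = det ?V / det ?W"
  have nd: "nrm \<delta> = 1" using nn detV by (simp add: \<delta>_def)
  have "det (cols w1 w2 w3 (\<delta> *s d4)) = \<delta> * det ?W" by (simp add: det_4 algebra_simps)
  then have dd: "det (cols w1 w2 w3 (\<delta> *s d4)) = det ?V" using detW by (simp add: \<delta>_def)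
  have "\<exists>A\<in>SU. A *v v1 = w1 \<and> A *v v2 = w2 \<and> A *v v3 = w3 \<and> A *v d4 = \<delta> *s d4"
  proof (rule frame_map[OF dd detV g(1-3) _ g(4,5) _ g(6)])
    show "h (\<delta> *s d4) (\<delta> *s d4) = h d4 d4" using nd by (simp add: nrm_def mult.commute g4)
  qed (use g4 in simp_all)
  then obtain A where A: "A \<in> SU" "A *v v1 = w1" "A *v v2 = w2" by blast
  then have "act A (ept x0) = P" "act A (ept x1) = Q"
    using x y pt_scale[OF m0] by (simp_all add: ept_def act_pt flip: v1_def v2_def) (simp_all add: w1_def w2_def)
  then show ?thesis using A(1) by blast
qed

section \<open>The field inside its algebraic closure\<close>

lemma frob_ac: "(x + y :: 'a alg_closure) ^ q = x ^ q + y ^ q" by (rule frob_add_gen) simp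

lemma frob_sq_ac: "(x + y :: 'a alg_closure) ^ (q\<^sup>2) = x ^ (q\<^sup>2) + y ^ (q\<^sup>2)"
  by (simp add: power2_eq_square power_mult frob_ac)

lemma to_ac_frob_sq: "to_ac (x :: 'a) ^ (q\<^sup>2) = to_ac x"
proof -
  have "x ^ (q\<^sup>2) = x" using cj_cj[of x] by (simp add: cj_def power2_eq_square flip: power_mult)
  then show ?thesis by (metis to_ac_power)
qed

text \<open>The equation has at most q^2 roots, and the image of the field already provides q^2 of
  them.\<close>

lemma in_range_to_ac:
  assumes "x ^ (q\<^sup>2) = (x :: 'a alg_closure)"
  shows "\<exists>y. x = to_ac y"
proof -
  define p :: "'a alg_closure poly" where "p = monom 1 (q\<^sup>2) - monom 1 1"
  have q2: "q\<^sup>2 > 1" using q_ge_3 power_strict_mono[of 1 q 2] by simp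
  have "coeff p (q\<^sup>2) = 1" using q2 by (simp add: p_def)
  then have p0: "p \<noteq> 0" by auto
  have pe: "poly p y = y ^ (q\<^sup>2) - y" for y by (simp add: p_def poly_monom)
  have "card {y. poly p y = 0} \<le> degree p" by (rule card_poly_roots_bound[OF p0])
  also have "\<dots> \<le> q\<^sup>2"
    unfolding p_def using q2 by (intro order_trans[OF degree_diff_le_max]) (simp add: degree_monom_eq)
  finally have le: "card {y. poly p y = 0} \<le> q\<^sup>2" .
  have sub: "range to_ac \<subseteq> {y. poly p y = 0}" by (auto simp: pe to_ac_frob_sq)
  have "card (range (to_ac :: 'a \<Rightarrow> _)) = q\<^sup>2" by (simp add: card_image inj_to_ac card_field)
  then have "range to_ac = {y. poly p y = 0}"
    using le sub by (intro card_seteq) (auto simp: poly_roots_finite[OF p0])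
  moreover have "x \<in> {y. poly p y = 0}" using assms by (simp add: pe)
  ultimately show ?thesis by auto
qed

lemma primitive_root_ac:
  assumes "coprime n q" "n > 0"
  shows "\<exists>u :: 'a alg_closure. \<forall>i. u ^ i = 1 \<longleftrightarrow> n dvd i"
proof -
  have "of_nat n \<noteq> (0 :: 'a alg_closure)"
    using of_nat_eq_0_iff_dvd_q[OF assms(1)] by (metis to_ac_eq_0_iff to_ac_of_nat)
  then show ?thesis by (intro primitive_root_of_unity_exists assms card_roots_of_unity_alg_closed)
qed

end

section \<open>The stabilizer of a totally isotropic line\<close>

locale hermitian_frame = hermitian_field q ty
  for q :: nat and ty :: "'a::{field,finite} itself" +
  fixes \<xi> :: 'a
  assumes xi: "nrm \<xi> = -1"
begin

text \<open>Two orthogonal hyperbolic pairs \<open>e1\<close>, \<open>f1\<close> and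
  \<open>e2\<close>, \<open>f2\<close>: reversing the sign of \<open>\<xi>\<close> gives isotropic
  vectors again, and the factor 1/2 makes the pairings equal to one.\<close>

definition e1 :: "'a^4" where "e1 = vec4 1 \<xi> 0 0"
definition e2 :: "'a^4" where "e2 = vec4 0 0 1 \<xi>"
definition f1 :: "'a^4" where "f1 = vec4 (1/2) (- \<xi>/2) 0 0"
definition f2 :: "'a^4" where "f2 = vec4 0 0 (1/2) (- \<xi>/2)"
definition \<omega> :: "('a^4) set" where "\<omega> = ell \<xi> \<xi>"

lemma xi_cj: "\<xi> * cj \<xi> = -1"
  using xi by (simp add: nrm_def)

lemma frame_h [simp]:
  "h e1 e1 = 0" "h e1 e2 = 0" "h e1 f1 = 1" "h e1 f2 = 0"
  "h e2 e1 = 0" "h e2 e2 = 0" "h e2 f1 = 0" "h e2 f2 = 1"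
  "h f1 e1 = 1" "h f1 e2 = 0" "h f1 f1 = 0" "h f1 f2 = 0"
  "h f2 e1 = 0" "h f2 e2 = 1" "h f2 f1 = 0" "h f2 f2 = 0"
  using xi_cj by (simp_all add: e1_def e2_def f1_def f2_def h_vec4)

lemma \<omega>_eq: "\<omega> = span2 e1 e2" by (simp add: \<omega>_def ell_def e1_def e2_def)

lemma \<omega>_line: "\<omega> \<in> lines"
  using ell_in_lines[OF xi xi] by (simp add: \<omega>_def)

lemma indep_e: "indep e1 e2" by (auto simp: indep_def e1_def e2_def vec4_eq_iff)

lemma frame_expand: "v = h v f1 *s e1 + h v f2 *s e2 + h v e1 *s f1 + h v e2 *s f2"
proof -
  have a: "\<xi> * (cj \<xi> * c) = - c" for c using xi_cj by (metis mult.assoc mult_minus1)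
  have "(8::'a) = 2 * 4" by simp
  then have eight: "(8::'a) \<noteq> 0" using two_neq_0 four_neq_0 by (metis mult_eq_0_iff)
  show ?thesis using eight by (simp add: vec4_eq_iff h_def e1_def e2_def f1_def f2_def field_simps a)
qed

lemma frame_comb_eq_iff:
  "a *s e1 + b *s e2 + c *s f1 + d *s f2 = a' *s e1 + b' *s e2 + c' *s f1 + d' *s f2 \<longleftrightarrow>
     a = a' \<and> b = b' \<and> c = c' \<and> d = d'" (is "?l = ?r \<longleftrightarrow> _")
proof
  assume e: "?l = ?r"
  have "h ?l f1 = h ?r f1" "h ?l f2 = h ?r f2" "h ?l e1 = h ?r e1" "h ?l e2 = h ?r e2" by (simp_all only: e)
  then show "a = a' \<and> b = b' \<and> c = c' \<and> d = d'" by simp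
qed simp

definition M :: "'a^4^4" where "M = cols e1 e2 f1 f2"

lemma det_M: "det M \<noteq> 0"
proof -
  have "\<xi> \<noteq> 0" using xi by auto
  then show ?thesis by (simp add: M_def det_4 e1_def e2_def f1_def f2_def field_simps)
qed

lemma M_vec: "M *v vec4 a b c d = a *s e1 + b *s e2 + c *s f1 + d *s f2" by (simp add: M_def cols_vector_mult)

lemma frame_matrix_eqI:
  assumes "A *v e1 = B *v e1" "A *v e2 = B *v e2" "A *v f1 = B *v f1" "A *v f2 = B *v f2"
  shows "A = (B :: 'a^4^4)"
proof -
  obtain Mi where Mi: "M ** Mi = mat 1"
    using det_M invertible_det_nz[of M] unfolding invertible_def by blast
  have "A ** M = B ** M" by (simp add: M_def cols_mult assms)
  then have "A ** (M ** Mi) = B ** (M ** Mi)" by (simp add: matrix_mul_assoc)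
  then show ?thesis by (simp add: Mi)
qed

text \<open>This is SL_2(q^2) acting on \<open>\<omega>\<close>. On \<open>f1\<close> and
  \<open>f2\<close> it acts by the inverse conjugate transpose, as the dual pairing with
  \<open>e1\<close> and \<open>e2\<close> dictates.\<close>

lemma levi_exists:
  assumes "a * d - b * c = 1"
  shows "\<exists>A\<in>SU. A *v e1 = a *s e1 + c *s e2 \<and> A *v e2 = b *s e1 + d *s e2 \<and>
    A *v f1 = cj d *s f1 + (- cj b) *s f2 \<and> A *v f2 = (- cj c) *s f1 + cj a *s f2"
proof -
  have cja: "cj a * cj d - cj b * cj c = 1" using arg_cong[OF assms, of cj] by simp
  show ?thesis
  proof (rule frame_comb[OF det_M M_def])
    have "det (cols (vec4 a c 0 0) (vec4 b d 0 0) (vec4 0 0 (cj d) (- cj b)) (vec4 0 0 (- cj c) (cj a))) =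
      (a * d - b * c) * (cj a * cj d - cj b * cj c)" by (simp add: det_4 algebra_simps)
    then show "det (cols (vec4 a c 0 0) (vec4 b d 0 0) (vec4 0 0 (cj d) (- cj b)) (vec4 0 0 (- cj c) (cj a))) = 1"
      using assms cja by simp
  qed (use assms in \<open>auto simp: M_vec algebra_simps\<close>)
qed

text \<open>The first hypothesis says that the determinant \<open>a * b / (cj a * cj b)\<close> is
  one.\<close>

lemma torus_exists:
  assumes "a * b = cj a * cj b" "a \<noteq> 0" "b \<noteq> 0"
  shows "\<exists>A\<in>SU. A *v e1 = a *s e1 \<and> A *v e2 = b *s e2 \<and>
    A *v f1 = (1 / cj a) *s f1 \<and> A *v f2 = (1 / cj b) *s f2"
proof (rule frame_comb[OF det_M M_def])
  show "det (cols (vec4 a 0 0 0) (vec4 0 b 0 0) (vec4 0 0 (1 / cj a) 0) (vec4 0 0 0 (1 / cj b))) = 1"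
    using assms by (simp add: det_4 field_simps)
qed (use assms in \<open>auto simp: M_vec\<close>)

lemma inv_vec [simp]: "A \<in> SU \<Longrightarrow> conjT q A *v (A *v x) = x"
  by (simp add: matrix_vector_mul_assoc conjT_mult_self)

lemma inv_vec_eq: "A \<in> SU \<Longrightarrow> A *v x = y \<Longrightarrow> conjT q A *v y = x" by auto

definition stab :: "('a^4^4) set" where "stab = preim SU \<omega> {\<omega>}"

lemma stab_iff: "g \<in> stab \<longleftrightarrow> g \<in> SU \<and> g *v e1 \<in> \<omega> \<and> g *v e2 \<in> \<omega>"
proof
  assume "g \<in> stab"
  then have g: "g \<in> SU" "act g \<omega> = \<omega>" by (auto simp: stab_def preim_def)
  have "g *v e1 \<in> act g \<omega>" "g *v e2 \<in> act g \<omega>" by (auto simp: act_def \<omega>_eq)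
  then show "g \<in> SU \<and> g *v e1 \<in> \<omega> \<and> g *v e2 \<in> \<omega>" using g by simp
next
  assume g: "g \<in> SU \<and> g *v e1 \<in> \<omega> \<and> g *v e2 \<in> \<omega>"
  then have "indep (g *v e1) (g *v e2)" using indep_e by (simp add: indep_mult_vec)
  then have "\<omega> = span2 (g *v e1) (g *v e2)" using line_eq_span2[OF \<omega>_line] g by blast
  moreover have "act g \<omega> = span2 (g *v e1) (g *v e2)" by (simp add: \<omega>_eq act_span2)
  ultimately show "g \<in> stab" using g by (simp add: stab_def preim_def)
qed

lemma su_closed_stab: "su_closed stab"
proof -
  have "act (conjT q A) \<omega> = \<omega>" if "A \<in> SU" "act A \<omega> = \<omega>" for A
    using act_conjT(1)[OF that(1), of \<omega>] that(2) by simp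
  then show ?thesis by (auto simp: su_closed_def stab_def preim_def act_mult)
qed

lemma e_comb_in_\<omega> [simp]: "a *s e1 + b *s e2 \<in> \<omega>"
  unfolding \<omega>_eq span2_def by blast

lemma e_in_\<omega> [simp]: "e1 \<in> \<omega>" "e2 \<in> \<omega>" "a *s e1 \<in> \<omega>" "a *s e2 \<in> \<omega>"
  using e_comb_in_\<omega>[of a 0] e_comb_in_\<omega>[of 0 a] by (simp_all add: \<omega>_eq)

lemma in_\<omega>_iff: "v \<in> \<omega> \<longleftrightarrow> (\<exists>a b. v = a *s e1 + b *s e2)"
  unfolding \<omega>_eq span2_def by blast

section \<open>The points of the fixed line and a non-split torus\<close>

definition wpts :: "('a^4) set set" where
  "wpts = {pt v | v. v \<in> \<omega> \<and> v \<noteq> 0}"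

lemma e_comb_eq_iff: "a *s e1 + b *s e2 = a' *s e1 + b' *s e2 \<longleftrightarrow> a = a' \<and> b = b'"
  using frame_comb_eq_iff[of a b 0 0 a' b' 0 0] by simp

lemma e_comb_eq_0: "a *s e1 + b *s e2 = 0 \<longleftrightarrow> a = 0 \<and> b = 0"
  using e_comb_eq_iff[of a b 0 0] by simp

lemma e1_neq_0: "e1 \<noteq> 0"
  using e_comb_eq_0[of 1 0] by auto

lemma card_wpts: "card wpts = q\<^sup>2 + 1"
proof -
  let ?f = "\<lambda>x. pt (x *s e1 + 1 *s e2)"
  have nz: "x *s e1 + 1 *s e2 \<noteq> 0" for x by (simp only: e_comb_eq_0) simp
  have sc: "c *s (a *s e1 + b *s e2) = (c * a) *s e1 + (c * b) *s e2" for a b c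
    by (simp add: vec_eq_iff algebra_simps)
  have w: "wpts = insert (pt e1) (range ?f)"
  proof (intro equalityI subsetI)
    fix P assume "P \<in> wpts"
    then obtain a b where P: "P = pt (a *s e1 + b *s e2)" "a *s e1 + b *s e2 \<noteq> 0"
      by (auto simp: wpts_def in_\<omega>_iff)
    show "P \<in> insert (pt e1) (range ?f)"
    proof (cases "b = 0")
      case True
      then show ?thesis using P pt_scale[of a e1] by auto
    next
      case False
      then have "P = pt ((1 / b) *s (a *s e1 + b *s e2))" using P pt_scale by simp
      also have "\<dots> = ?f (a / b)" using False by (simp only: sc) simp
      finally show ?thesis by blast
    qed
  next
    fix P assume "P \<in> insert (pt e1) (range ?f)"
    then show "P \<in> wpts"
      unfolding wpts_def using e1_neq_0 nz e_in_\<omega>(1) e_comb_in_\<omega> by blast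
  qed
  have inj: "inj ?f"
  proof (rule injI)
    fix x y assume "?f x = ?f y"
    then obtain c where "y *s e1 + 1 *s e2 = c *s (x *s e1 + 1 *s e2)" using pt_eqD by blast
    then show "x = y" by (simp only: sc e_comb_eq_iff) simp
  qed
  have "pt e1 \<notin> range ?f"
  proof
    assume "pt e1 \<in> range ?f"
    then obtain x where "pt e1 = ?f x" by blast
    then obtain c where "x *s e1 + 1 *s e2 = c *s e1" using pt_eqD by blast
    then have "x *s e1 + 1 *s e2 = c *s e1 + 0 *s e2" by simp
    then show False by (simp only: e_comb_eq_iff) simp
  qed
  then show ?thesis using inj by (simp add: w card_image card_field)
qed

lemma act_wpts: "g \<in> stab \<Longrightarrow> P \<in> wpts \<Longrightarrow> act g P \<in> wpts"
proof -
  assume g: "g \<in> stab" and P: "P \<in> wpts"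
  obtain v where v: "P = pt v" "v \<in> \<omega>" "v \<noteq> 0"
    using P by (auto simp: wpts_def)
  have "g *v v \<in> act g \<omega>" "g \<in> SU" "act g \<omega> = \<omega>"
    using g v by (auto simp: act_def stab_def preim_def)
  then show ?thesis using v by (auto simp: wpts_def act_pt)
qed

lemma transitive_wpts:
  assumes "P \<in> wpts"
  shows "\<exists>g\<in>stab. act g (pt e1) = P"
proof -
  obtain a c where P: "P = pt (a *s e1 + c *s e2)" "a *s e1 + c *s e2 \<noteq> 0"
    using assms by (auto simp: wpts_def in_\<omega>_iff)
  obtain b d where bd: "a * d - b * c = 1"
  proof (cases "a = 0")
    case True
    then show ?thesis using that[of 0 "- 1 / c"] P(2) by simp
  next
    case False
    then show ?thesis using that[of "1 / a" 0] by simp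
  qed
  obtain g where g: "g \<in> SU" "g *v e1 = a *s e1 + c *s e2" "g *v e2 = b *s e1 + d *s e2"
    using levi_exists[OF bd] by blast
  then have "g \<in> stab" by (simp add: stab_iff)
  moreover have "act g (pt e1) = P" by (simp add: act_pt g P)
  ultimately show ?thesis by blast
qed

lemma funpow_mult_vec_\<omega>:
  assumes "g \<in> stab" "v \<in> \<omega>"
  shows "((\<lambda>x. g *v x) ^^ i) v \<in> \<omega>"
proof (induction i)
  case (Suc i)
  have "act g \<omega> = \<omega>" using assms by (auto simp: stab_def preim_def)
  then show ?case using Suc by (auto simp: act_def)
qed (use assms in simp)

lemma funpow_act_pt: "(act g ^^ i) (pt v) = pt (((\<lambda>x. g *v x) ^^ i) v)"
  by (induction i) (auto simp: act_pt)

text \<open>The line \<open>\<omega>\<close> is identified with GF(q^4) by means of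
  \<open>\<phi>\<close>, and its points with the nonzero elements modulo GF(q^2). Multiplication by
  a root of unity \<open>u\<close> of order q^2 + 1 has determinant
  \<open>u ^ (q\<^sup>2 + 1) = 1\<close> and so comes from SL_2(q^2). Since -1 is a power of
  \<open>u\<close>, its order on points is halved; two orbits remain, and two is prime.\<close>

lemma mls_stab_borel: "mls_rel (SU4 q) stab (preim stab (pt e1) {pt e1})"
proof -
  let ?n = "(q\<^sup>2 + 1) div 2"
  have ev: "q\<^sup>2 + 1 = 2 * ?n" using odd_q by simp
  have q2: "q\<^sup>2 \<ge> 9" using power_mono[of 3 q 2] q_ge_3 by simp
  have "coprime (q\<^sup>2 + 1) q"
  proof (rule coprimeI)
    fix c assume c: "c dvd q\<^sup>2 + 1" "c dvd q"
    then have "c dvd q\<^sup>2" by (simp add: power2_eq_square)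
    then show "is_unit c" using c(1) dvd_add_right_iff by blast
  qed
  then obtain u :: "'a alg_closure" where u: "\<And>i. u ^ i = 1 \<longleftrightarrow> (q\<^sup>2 + 1) dvd i"
    using primitive_root_ac[of "q\<^sup>2 + 1"] by auto
  have u0: "u \<noteq> 0" using u[of "q\<^sup>2 + 1"] by (auto simp: power_0_left)
  have uq: "u ^ (q\<^sup>2) = inverse u"
  proof -
    have "u * u ^ (q\<^sup>2) = 1" using u[of "q\<^sup>2 + 1"] by simp
    then show ?thesis by (rule inverse_unique[symmetric])
  qed
  \<comment> \<open>The conjugate of \<open>u\<close> is \<open>inverse u\<close>, so the trace lies
    in the field and \<open>u\<close> is a root of T^2 - t T + 1.\<close>
  have "(u + inverse u) ^ (q\<^sup>2) = u + inverse u" by (simp add: frob_sq_ac power_inverse uq)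
  then obtain t where t: "u + inverse u = to_ac t" using in_range_to_ac by blast
  have u2: "u * u = to_ac t * u - 1"
    unfolding t[symmetric] using u0 by (simp add: algebra_simps)
  \<comment> \<open>Elements of the field are fixed by the power \<open>q\<^sup>2\<close>, which
    inverts \<open>u\<close>; hence \<open>u ^ i\<close> equals its own inverse.\<close>
  have not_range: "2 * i mod (q\<^sup>2 + 1) = 0" if "u ^ i = to_ac l" for i l
  proof -
    have "u ^ i * (u ^ (q\<^sup>2)) ^ i = 1" using u0 by (simp add: uq flip: power_mult_distrib)
    moreover have "(u ^ (q\<^sup>2)) ^ i = u ^ i"
    proof -
      have "(u ^ (q\<^sup>2)) ^ i = (u ^ i) ^ (q\<^sup>2)" by (simp only: power_mult[symmetric] mult.commute)
      also have "\<dots> = u ^ i"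
        unfolding that by (rule to_ac_frob_sq)
      finally show ?thesis .
    qed
    ultimately have "u ^ (2 * i) = 1" by (simp add: mult_2 power_add)
    then show ?thesis using u by simp
  qed
  \<comment> \<open>On \<open>\<omega>\<close> this is the companion matrix of T^2 - t T + 1, of
    determinant one.\<close>
  obtain g where g: "g \<in> SU" "g *v e1 = 0 *s e1 + 1 *s e2" "g *v e2 = (-1) *s e1 + t *s e2"
    using levi_exists[of 0 t "-1" 1] by auto
  have gs: "g \<in> stab" using g by (simp only: stab_iff e_comb_in_\<omega>)
  define \<phi> where "\<phi> v = to_ac (h v f1) + to_ac (h v f2) * u" for v
  have \<phi>g: "\<phi> (g *v v) = u * \<phi> v" if "v \<in> \<omega>" for v
  proof -
    obtain a b where v: "v = a *s e1 + b *s e2"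
      using \<open>v \<in> \<omega>\<close> by (auto simp: in_\<omega>_iff)
    have "g *v v = a *s (g *v e1) + b *s (g *v e2)"
      unfolding v by (simp only: mult_vec_comb)
    also have "\<dots> = (- b) *s e1 + (a + b * t) *s e2"
      unfolding g(2,3) by (simp add: vec_eq_iff algebra_simps)
    finally have gv: "g *v v = (- b) *s e1 + (a + b * t) *s e2" .
    have "\<phi> (g *v v) = - to_ac b + (to_ac a + to_ac b * to_ac t) * u"
      unfolding gv by (simp add: \<phi>_def)
    also have "\<dots> = to_ac a * u + to_ac b * (to_ac t * u - 1)"
      by (simp only: ring_distribs mult.assoc) simp
    also have "\<dots> = u * (to_ac a + to_ac b * u)"
      unfolding u2[symmetric] by (simp only: ring_distribs ac_simps)
    also have "to_ac a + to_ac b * u = \<phi> v"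
      unfolding v by (simp add: \<phi>_def)
    finally show ?thesis .
  qed
  have \<phi>pow: "\<phi> (((\<lambda>x. g *v x) ^^ i) v) = u ^ i * \<phi> v" if "v \<in> \<omega>" for v i
    by (induction i) (auto simp: \<phi>g funpow_mult_vec_\<omega>[OF gs that])
  have \<phi>scale: "\<phi> (c *s v) = to_ac c * \<phi> v" for c v by (simp add: \<phi>_def algebra_simps)
  have \<phi>0: "v = 0" if v: "v \<in> \<omega>" "\<phi> v = 0" for v
  proof -
    obtain a b where ab: "v = a *s e1 + b *s e2"
      using v by (auto simp: in_\<omega>_iff)
    have e: "to_ac a + to_ac b * u = 0" using v(2) by (simp add: \<phi>_def ab)
    have "b = 0"
    proof (rule ccontr)
      assume b: "b \<noteq> 0"
      have "to_ac b * u = - to_ac a" using e by (simp add: eq_neg_iff_add_eq_0 add.commute)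
      then have "u = (- to_ac a) / to_ac b" using b by (metis nonzero_mult_div_cancel_left to_ac_eq_0_iff)
      then have "u = to_ac (- a / b)" by simp
      then have "u ^ 1 = to_ac (- a / b)" by simp
      from not_range[OF this] show False
        using q2 by simp
    qed
    then show ?thesis using e ab by simp
  qed
  have \<phi>diff: "\<phi> (v - w) = \<phi> v - \<phi> w" for v w by (simp add: \<phi>_def algebra_simps)
  \<comment> \<open>The scalar -1 fixes every point, which is why the cycle length is half of q^2 +
    1.\<close>
  have un: "u ^ ?n = -1"
  proof -
    have "(u ^ ?n) ^ 2 = 1" using u[of "q\<^sup>2 + 1"] ev by (simp flip: power_mult add: mult.commute)
    moreover have "u ^ ?n \<noteq> 1" using u[of ?n] q2 by (auto dest!: dvd_imp_le)
    ultimately show ?thesis by (simp add: power2_eq_1_iff)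
  qed
  have \<omega>diff: "v - w \<in> \<omega>" if "v \<in> \<omega>" "w \<in> \<omega>" for v w
    using line_comb[OF \<omega>_line that, of 1 "-1"] by simp
  have fix_iff: "\<exists>l. u ^ i = to_ac l" if v: "v \<in> \<omega>" "v \<noteq> 0" and e: "(act g ^^ i) (pt v) = pt v" for v i
  proof -
    obtain l where "((\<lambda>x. g *v x) ^^ i) v = l *s v"
      using pt_eqD[OF e[unfolded funpow_act_pt, symmetric]] by blast
    then have "u ^ i * \<phi> v = to_ac l * \<phi> v" using \<phi>pow[OF v(1), of i] \<phi>scale by metis
    moreover have "\<phi> v \<noteq> 0" using \<phi>0 v by blast
    ultimately show ?thesis by auto
  qed
  have "\<exists>R\<subseteq>wpts. bij_betw (\<lambda>(i, w). (act g ^^ i) w) ({..<?n} \<times> R) wpts"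
  proof (rule free_orbit_representatives)
    show "finite wpts" using card_wpts card_ge_0_finite[of wpts] by simp
    show "?n > 0" using q2 by simp
    show "act g w \<in> wpts" if "w \<in> wpts" for w using act_wpts[OF gs that] .
    show "(act g ^^ ?n) w = w" if "w \<in> wpts" for w
    proof -
      obtain v where v: "w = pt v" "v \<in> \<omega>" "v \<noteq> 0"
        using \<open>w \<in> wpts\<close> by (auto simp: wpts_def)
      let ?v = "((\<lambda>x. g *v x) ^^ ?n) v"
      have "\<phi> (?v - (-1) *s v) = 0"
        unfolding \<phi>diff \<phi>scale \<phi>pow[OF v(2)] un by simp
      moreover have "?v - (-1) *s v \<in> \<omega>"
        by (rule \<omega>diff[OF funpow_mult_vec_\<omega>[OF gs v(2)] line_scale[OF \<omega>_line v(2)]])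
      ultimately have "?v - (-1) *s v = 0" using \<phi>0 by blast
      then have "?v = (-1) *s v" by (simp only: right_minus_eq)
      then show ?thesis
        unfolding v(1) funpow_act_pt using pt_scale[of "-1" v] by simp
    qed
    show "(act g ^^ i) w \<noteq> w" if w: "w \<in> wpts" "0 < i" "i < ?n" for w i
    proof
      assume e: "(act g ^^ i) w = w"
      obtain v where v: "w = pt v" "v \<in> \<omega>" "v \<noteq> 0"
        using w(1) by (auto simp: wpts_def)
      then obtain l where "u ^ i = to_ac l" using fix_iff e by blast
      then have "(q\<^sup>2 + 1) dvd 2 * i" using not_range by (simp add: mod_eq_0_iff_dvd)
      then have "q\<^sup>2 + 1 \<le> 2 * i" using w by (intro dvd_imp_le) auto
      then show False using w ev by linarith
    qed
  qed
  then obtain R where R: "R \<subseteq> wpts" "bij_betw (\<lambda>(i, w). (act g ^^ i) w) ({..<?n} \<times> R) wpts"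
    by blast
  have "?n * card R = ?n * 2"
    using bij_betw_same_card[OF R(2)] ev by (simp add: card_cartesian_product card_wpts)
  moreover have n0: "?n > 0" using q2 by simp
  ultimately have cR: "card R = 2" by (metis mult_left_cancel not_gr_zero)
  have "\<forall>P\<in>R. \<exists>g\<in>stab. act g (pt e1) = P" using transitive_wpts R(1) by blast
  then obtain b where b: "\<And>P. P \<in> R \<Longrightarrow> b P \<in> stab" "\<And>P. P \<in> R \<Longrightarrow> act (b P) (pt e1) = P"
    by metis
  have ne: "preim stab (pt e1) R \<noteq> {}" "preim stab (pt e1) {pt e1} \<noteq> {}"
  proof -
    obtain P where "P \<in> R"
      using cR by fastforce
    then have "b P \<in> preim stab (pt e1) R" using b by (simp add: preim_def)
    then show "preim stab (pt e1) R \<noteq> {}" by blast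
    have "mat 1 \<in> stab" using su_closed_stab by (simp add: su_closed_def)
    then show "preim stab (pt e1) {pt e1} \<noteq> {}"
      unfolding preim_def using act_one by blast
  qed
  have "pt e1 \<in> wpts" using e1_neq_0 by (auto simp: wpts_def)
  then have "preim stab (pt e1) wpts = stab" using act_wpts by (auto simp: preim_def)
  then have "mls_rel (SU4 q) stab (preim stab (pt e1) R)"
    using mls_preim_powers[OF su_closed_stab gs n0 R(2) ne(1)] by simp
  also have "mls_rel (SU4 q) (preim stab (pt e1) R) (preim stab (pt e1) {pt e1})"
  proof (rule mls_preim_single[OF su_closed_stab _ _ _ _ ne(2)])
    show "finite R" using cR card_ge_0_finite[of R] by simp
    show "prime (card R) \<or> card R = 4" by (simp add: cR)
    show "bij_betw (\<lambda>(i, L). act (b i) L) (R \<times> {pt e1}) R"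
      by (rule bij_betw_byWitness[where f' = "\<lambda>P. (P, pt e1)"]) (auto simp: b)
  qed (fact b(1))
  finally show ?thesis .
qed

section \<open>Root subgroup, unipotent radical and diagonal torus\<close>

definition root_grp :: "('a^4^4) set" where
  "root_grp = {A \<in> SU. A *v e1 = e1 \<and> A *v f2 = f2 \<and> (\<exists>x. A *v e2 = e2 + x *s e1 \<and> A *v f1 = f1 + (- cj x) *s f2)}"

text \<open>What is left of the stabilizer of a point on \<open>\<omega>\<close> once the root
  subgroup has been split off: a second point is fixed as well.\<close>

definition borel2 :: "('a^4^4) set" where
  "borel2 = {A \<in> SU. \<exists>a b. A *v e1 = a *s e1 \<and> A *v e2 = b *s e2}"

text \<open>The kernel of the action on the vectors of \<open>\<omega>\<close>, which is the
  unipotent radical of the line stabilizer.\<close>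

definition unip :: "('a^4^4) set" where
  "unip = {A \<in> SU. A *v e1 = e1 \<and> A *v e2 = e2}"

definition tor :: "('a^4^4) set" where
  "tor = {A \<in> SU. \<exists>a b c d. A *v e1 = a *s e1 \<and> A *v e2 = b *s e2 \<and> A *v f1 = c *s f1 \<and> A *v f2 = d *s f2}"

lemma frame_neq_0 [simp]: "e1 \<noteq> 0" "e2 \<noteq> 0" "f1 \<noteq> 0" "f2 \<noteq> 0"
  using frame_h(3,8) by (auto simp del: frame_h)

lemma eigen_nonzero: "A \<in> SU \<Longrightarrow> A *v v = a *s v \<Longrightarrow> v \<noteq> 0 \<Longrightarrow> a \<noteq> 0"
  by (metis mult_vec_eq_0 vector_smult_lzero)

lemma root_grp_exists:
  "\<exists>A\<in>root_grp. A *v e2 = e2 + x *s e1 \<and> A *v f1 = f1 + (- cj x) *s f2"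
proof -
  obtain A where "A \<in> SU" "A *v e1 = 1 *s e1 + 0 *s e2" "A *v e2 = x *s e1 + 1 *s e2"
    "A *v f1 = cj 1 *s f1 + (- cj x) *s f2" "A *v f2 = (- cj 0) *s f1 + cj 1 *s f2"
    using levi_exists[of 1 1 x 0] by auto
  then have "A \<in> SU" "A *v e1 = e1" "A *v f2 = f2" "A *v e2 = e2 + x *s e1" "A *v f1 = f1 + (- cj x) *s f2"
    by (simp_all add: add.commute)
  then show ?thesis
    unfolding root_grp_def by blast
qed

lemma su_closed_root_grp: "su_closed root_grp"
  unfolding su_closed_def
proof (intro conjI ballI)
  show "root_grp \<subseteq> SU" by (auto simp: root_grp_def)
  show "mat 1 \<in> root_grp" by (auto simp: root_grp_def intro!: exI[of _ 0])
  fix A assume A: "A \<in> root_grp"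
  then obtain x where x: "A \<in> SU" "A *v e1 = e1" "A *v f2 = f2" "A *v e2 = e2 + x *s e1" "A *v f1 = f1 + (- cj x) *s f2"
    by (auto simp: root_grp_def)
  have i: "A *v (e2 + (- x) *s e1) = e2" "A *v (f1 + (- cj (- x)) *s f2) = f1"
    by (simp_all add: matrix_vector_right_distrib mult_vec_scale x matrix_vector_mult_diff_distrib)
  have "conjT q A *v e2 = e2 + (- x) *s e1" "conjT q A *v f1 = f1 + (- cj (- x)) *s f2"
    "conjT q A *v e1 = e1" "conjT q A *v f2 = f2"
    using inv_vec_eq[OF x(1) i(1)] inv_vec_eq[OF x(1) i(2)] inv_vec_eq[OF x(1,2)] inv_vec_eq[OF x(1,3)] by blast+
  then show "conjT q A \<in> root_grp" using SU_conjT[OF x(1)] unfolding root_grp_def by blast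
  fix B assume B: "B \<in> root_grp"
  then obtain y where y: "B \<in> SU" "B *v e1 = e1" "B *v f2 = f2" "B *v e2 = e2 + y *s e1" "B *v f1 = f1 + (- cj y) *s f2"
    by (auto simp: root_grp_def)
  have "A ** B *v e1 = e1" "A ** B *v f2 = f2" "A ** B *v e2 = e2 + (x + y) *s e1"
    "A ** B *v f1 = f1 + (- cj (x + y)) *s f2"
    by (simp_all add: matrix_vector_right_distrib mult_vec_scale x y matrix_vector_mult_diff_distrib
        vec_eq_iff algebra_simps flip: matrix_vector_mul_assoc)
  then show "A ** B \<in> root_grp" using SU_mult[OF x(1) y(1)] unfolding root_grp_def by blast
qed

lemma root_grp_comm:
  assumes "A \<in> root_grp" "B \<in> root_grp"
  shows "A ** B = B ** A"
proof -
  obtain x where x: "A *v e1 = e1" "A *v f2 = f2" "A *v e2 = e2 + x *s e1" "A *v f1 = f1 + (- cj x) *s f2"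
    using assms(1) by (auto simp: root_grp_def)
  obtain y where y: "B *v e1 = e1" "B *v f2 = f2" "B *v e2 = e2 + y *s e1" "B *v f1 = f1 + (- cj y) *s f2"
    using assms(2) by (auto simp: root_grp_def)
  show ?thesis by (rule frame_matrix_eqI)
      (simp_all add: matrix_vector_right_distrib mult_vec_scale x y matrix_vector_mult_diff_distrib
        vec_eq_iff algebra_simps flip: matrix_vector_mul_assoc)
qed

lemma borel_iff: "A \<in> preim stab (pt e1) {pt e1} \<longleftrightarrow>
  A \<in> SU \<and> (\<exists>a b c. A *v e1 = a *s e1 \<and> A *v e2 = b *s e2 + c *s e1)"
proof
  assume "A \<in> preim stab (pt e1) {pt e1}"
  then have A: "A \<in> SU" "A *v e2 \<in> \<omega>" "pt (A *v e1) = pt e1"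
    by (auto simp: preim_def stab_iff act_pt)
  obtain a where "A *v e1 = a *s e1"
    using pt_eqD[OF A(3)[symmetric]] by blast
  moreover obtain c b where "A *v e2 = c *s e1 + b *s e2" using A(2) by (auto simp: in_\<omega>_iff)
  ultimately show "A \<in> SU \<and> (\<exists>a b c. A *v e1 = a *s e1 \<and> A *v e2 = b *s e2 + c *s e1)"
    using A(1) by (metis add.commute)
next
  assume "A \<in> SU \<and> (\<exists>a b c. A *v e1 = a *s e1 \<and> A *v e2 = b *s e2 + c *s e1)"
  then obtain a b c where A: "A \<in> SU" "A *v e1 = a *s e1" "A *v e2 = c *s e1 + b *s e2"
    by (metis add.commute)
  then have "A \<in> stab" by (simp add: stab_iff)
  moreover have "a \<noteq> 0" using eigen_nonzero A by simp
  ultimately show "A \<in> preim stab (pt e1) {pt e1}" using A pt_scale by (simp add: preim_def act_pt)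
qed

text \<open>The root subgroup permutes the points of \<open>\<omega>\<close> other than
  \<open>pt e1\<close> simply transitively, so the left factor is determined by the image of
  \<open>pt e2\<close>.\<close>

lemma borel_bij:
  "bij_betw (\<lambda>(a, k). a ** k) (root_grp \<times> borel2) (preim stab (pt e1) {pt e1})"
  unfolding bij_betw_def
proof (intro conjI inj_onI)
  fix u v assume uv: "u \<in> root_grp \<times> borel2" "v \<in> root_grp \<times> borel2"
    "(\<lambda>(a, k). a ** k) u = (\<lambda>(a, k). a ** k) v"
  obtain r k where u: "u = (r, k)" "r \<in> root_grp" "k \<in> borel2"
    using uv by auto
  obtain r' k' where v: "v = (r', k')" "r' \<in> root_grp" "k' \<in> borel2"
    using uv by auto
  obtain x where x: "r \<in> SU" "r *v e1 = e1" "r *v f2 = f2" "r *v e2 = e2 + x *s e1" "r *v f1 = f1 + (- cj x) *s f2"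
    using u(2) by (auto simp: root_grp_def)
  obtain y where y: "r' \<in> SU" "r' *v e1 = e1" "r' *v f2 = f2" "r' *v e2 = e2 + y *s e1" "r' *v f1 = f1 + (- cj y) *s f2"
    using v(2) by (auto simp: root_grp_def)
  obtain b where b: "k \<in> SU" "k *v e2 = b *s e2"
    using u(3) by (auto simp: borel2_def)
  obtain b' where b': "k' \<in> SU" "k' *v e2 = b' *s e2"
    using v(3) by (auto simp: borel2_def)
  have e: "r ** k = r' ** k'" using uv(3) u v by simp
  have "r *v (k *v e2) = r' *v (k' *v e2)" using e by (simp add: matrix_vector_mul_assoc)
  moreover have "r *v (k *v e2) = (b * x) *s e1 + b *s e2"
    unfolding b(2) mult_vec_scale x(4) by (simp add: vec_eq_iff algebra_simps)
  moreover have "r' *v (k' *v e2) = (b' * y) *s e1 + b' *s e2"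
    unfolding b'(2) mult_vec_scale y(4) by (simp add: vec_eq_iff algebra_simps)
  ultimately have "b * x = b' * y" "b = b'" using e_comb_eq_iff by auto
  moreover have "b \<noteq> 0" using eigen_nonzero b by simp
  ultimately have "x = y" by simp
  then have "r = r'" using x y by (intro frame_matrix_eqI) auto
  moreover from this have "conjT q r ** (r ** k) = conjT q r ** (r ** k')" using e by simp
  then have "k = k'" using x(1) by (simp add: matrix_mul_assoc conjT_mult_self)
  ultimately show "u = v" by (simp add: u v)
next
  show "(\<lambda>(a, k). a ** k) ` (root_grp \<times> borel2) = preim stab (pt e1) {pt e1}"
  proof (intro equalityI subsetI)
    fix g assume "g \<in> (\<lambda>(a, k). a ** k) ` (root_grp \<times> borel2)"
    then obtain r k where g: "g = r ** k" "r \<in> root_grp" "k \<in> borel2" by auto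
    obtain x where x: "r \<in> SU" "r *v e1 = e1" "r *v e2 = e2 + x *s e1"
      using g(2) by (auto simp: root_grp_def)
    obtain a b where b: "k \<in> SU" "k *v e1 = a *s e1" "k *v e2 = b *s e2"
      using g(3) by (auto simp: borel2_def)
    have "g *v e1 = a *s e1" by (simp add: g(1) b mult_vec_scale x flip: matrix_vector_mul_assoc)
    moreover have "g *v e2 = b *s e2 + (b * x) *s e1"
      unfolding g(1) matrix_vector_mul_assoc[symmetric] b mult_vec_scale x by (simp add: vec_eq_iff algebra_simps)
    moreover have "g \<in> SU" using g(1) x b by simp
    ultimately show "g \<in> preim stab (pt e1) {pt e1}"
      unfolding borel_iff by blast
  next
    fix g assume "g \<in> preim stab (pt e1) {pt e1}"
    then obtain a b c where g: "g \<in> SU" "g *v e1 = a *s e1" "g *v e2 = b *s e2 + c *s e1"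
      unfolding borel_iff by blast
    have a0: "a \<noteq> 0" using eigen_nonzero g by simp
    have b0: "b \<noteq> 0"
    proof
      assume "b = 0"
      have "g *v (e2 + (- c / a) *s e1) = g *v e2 + (- c / a) *s (g *v e1)"
        by (simp only: matrix_vector_right_distrib mult_vec_scale)
      also have "\<dots> = 0"
        unfolding g(2,3) using a0 \<open>b = 0\<close> by (simp add: vec_eq_iff)
      finally have "(- c / a) *s e1 + 1 *s e2 = 0" using g(1) by (simp add: add.commute)
      then show False by (simp only: e_comb_eq_0) simp
    qed
    \<comment> \<open>The parameter \<open>c / b\<close> is chosen so that \<open>r\<close> sends
      \<open>b *s e2\<close> to the image of \<open>e2\<close> under \<open>g\<close>.\<close>
    obtain r where r: "r \<in> root_grp" "r *v e2 = e2 + (c / b) *s e1"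
      using root_grp_exists by blast
    then have rS: "r \<in> SU" "r *v e1 = e1" by (auto simp: root_grp_def)
    have "r *v (b *s e2) = g *v e2" using b0 by (simp add: mult_vec_scale r g vector_add_ldistrib)
    then have k2: "conjT q r *v (g *v e2) = b *s e2" by (rule inv_vec_eq[OF rS(1)])
    have "r *v (a *s e1) = g *v e1" by (simp add: mult_vec_scale rS g)
    then have k1: "conjT q r *v (g *v e1) = a *s e1" by (rule inv_vec_eq[OF rS(1)])
    have "conjT q r ** g \<in> borel2"
      using k1 k2 rS g(1) unfolding borel2_def by (auto simp flip: matrix_vector_mul_assoc)
    moreover have "g = r ** (conjT q r ** g)" using rS by (simp add: matrix_mul_assoc conjT_mult_self)
    ultimately show "g \<in> (\<lambda>(a, k). a ** k) ` (root_grp \<times> borel2)"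
      using r(1) by (intro image_eqI[of _ _ "(r, conjT q r ** g)"]) auto
  qed
qed

lemma su_closed_unip: "su_closed unip"
  unfolding su_closed_def
proof (intro conjI ballI)
  fix A assume A: "A \<in> unip"
  then show "conjT q A \<in> unip"
    using inv_vec_eq[of A e1 e1] inv_vec_eq[of A e2 e2] by (auto simp: unip_def)
  fix B assume "B \<in> unip"
  then show "A ** B \<in> unip" using A by (auto simp: unip_def simp flip: matrix_vector_mul_assoc)
qed (auto simp: unip_def)

lemma unip_f:
  assumes "A \<in> unip"
  shows "A *v f1 = h (A *v f1) f1 *s e1 + h (A *v f1) f2 *s e2 + f1"
    "A *v f2 = h (A *v f2) f1 *s e1 + h (A *v f2) f2 *s e2 + f2"
proof -
  have A: "A \<in> SU" "A *v e1 = e1" "A *v e2 = e2" using assms by (auto simp: unip_def)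
  have i: "h (A *v f1) e1 = 1" "h (A *v f1) e2 = 0" "h (A *v f2) e1 = 0" "h (A *v f2) e2 = 1"
    using SU_h[OF A(1), of f1 e1] SU_h[OF A(1), of f1 e2] SU_h[OF A(1), of f2 e1] SU_h[OF A(1), of f2 e2]
    by (simp_all add: A)
  show "A *v f1 = h (A *v f1) f1 *s e1 + h (A *v f1) f2 *s e2 + f1"
    using frame_expand[of "A *v f1"] by (simp add: i)
  show "A *v f2 = h (A *v f2) f1 *s e1 + h (A *v f2) f2 *s e2 + f2"
    using frame_expand[of "A *v f2"] by (simp add: i)
qed

text \<open>Each element adds vectors of \<open>\<omega>\<close> to \<open>f1\<close> and
  \<open>f2\<close>, and the other one fixes these vectors, so a composition just adds the two
  shifts.\<close>

lemma unip_comm: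
  assumes A: "A \<in> unip" and B: "B \<in> unip"
  shows "A ** B = B ** A"
proof -
  have e: "A *v e1 = e1" "A *v e2 = e2" "B *v e1 = e1" "B *v e2 = e2" using A B by (auto simp: unip_def)
  obtain a b c d where Af: "A *v f1 = a *s e1 + b *s e2 + f1" "A *v f2 = c *s e1 + d *s e2 + f2"
    using unip_f[OF A] by blast
  obtain a' b' c' d' where Bf: "B *v f1 = a' *s e1 + b' *s e2 + f1" "B *v f2 = c' *s e1 + d' *s e2 + f2"
    using unip_f[OF B] by blast
  show ?thesis by (rule frame_matrix_eqI)
      (simp_all add: matrix_vector_right_distrib mult_vec_scale e Af Bf
        vec_eq_iff algebra_simps flip: matrix_vector_mul_assoc)
qed

lemma borel2_f:
  assumes A: "A \<in> SU" "A *v e1 = a *s e1" "A *v e2 = b *s e2"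
  shows "A *v f1 = h (A *v f1) f1 *s e1 + h (A *v f1) f2 *s e2 + (1 / cj a) *s f1"
    "A *v f2 = h (A *v f2) f1 *s e1 + h (A *v f2) f2 *s e2 + (1 / cj b) *s f2"
proof -
  have ab: "a \<noteq> 0" "b \<noteq> 0" using eigen_nonzero A by auto
  have "h (A *v f1) (A *v e1) = 1" "h (A *v f1) (A *v e2) = 0" "h (A *v f2) (A *v e1) = 0" "h (A *v f2) (A *v e2) = 1"
    using A(1) by simp_all
  then have i: "h (A *v f1) e1 = 1 / cj a" "h (A *v f1) e2 = 0" "h (A *v f2) e1 = 0" "h (A *v f2) e2 = 1 / cj b"
    using ab by (simp_all add: A(2,3) field_simps)
  show "A *v f1 = h (A *v f1) f1 *s e1 + h (A *v f1) f2 *s e2 + (1 / cj a) *s f1"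
    using frame_expand[of "A *v f1"] by (simp add: i)
  show "A *v f2 = h (A *v f2) f1 *s e1 + h (A *v f2) f2 *s e2 + (1 / cj b) *s f2"
    using frame_expand[of "A *v f2"] by (simp add: i)
qed

text \<open>In the frame, \<open>A\<close> is triangular with diagonal entries \<open>a\<close>,
  \<open>b\<close>, \<open>1 / cj a\<close> and \<open>1 / cj b\<close>, and its determinant is one.
  This is the condition under which a diagonal matrix with the same eigenvalues exists.\<close>

lemma borel2_det:
  assumes A: "A \<in> SU" "A *v e1 = a *s e1" "A *v e2 = b *s e2"
  shows "a * b = cj a * cj b"
proof -
  have ab: "a \<noteq> 0" "b \<noteq> 0" using eigen_nonzero A by auto
  obtain c d where f1: "A *v f1 = c *s e1 + d *s e2 + (1 / cj a) *s f1"
    using borel2_f[OF A] by blast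
  obtain c' d' where f2: "A *v f2 = c' *s e1 + d' *s e2 + (1 / cj b) *s f2"
    using borel2_f[OF A] by blast
  let ?C = "cols (vec4 a 0 0 0) (vec4 0 b 0 0) (vec4 c d (1 / cj a) 0) (vec4 c' d' 0 (1 / cj b))"
  have "A ** M = M ** ?C"
    unfolding cols_mult M_vec by (simp add: M_def cols_mult A f1 f2)
  then have "det A * det M = det M * det ?C" by (metis det_mul)
  then have "det ?C = 1" using A(1) det_M by (simp add: SU_def)
  then show ?thesis using ab by (simp add: det_4 field_simps)
qed

lemma su_closed_tor: "su_closed tor"
  unfolding su_closed_def
proof (intro conjI ballI)
  have "mat 1 *v e1 = 1 *s e1 \<and> mat 1 *v e2 = 1 *s e2 \<and> mat 1 *v f1 = 1 *s f1 \<and> mat 1 *v f2 = 1 *s f2"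
    by simp
  then show "mat 1 \<in> tor"
    unfolding tor_def using SU_one by blast
  fix A assume "A \<in> tor"
  then obtain a b c d where A: "A \<in> SU" "A *v e1 = a *s e1" "A *v e2 = b *s e2" "A *v f1 = c *s f1" "A *v f2 = d *s f2"
    by (auto simp: tor_def)
  have nz: "a \<noteq> 0" "b \<noteq> 0" "c \<noteq> 0" "d \<noteq> 0" using eigen_nonzero A by auto
  have i: "conjT q A *v v = (1 / x) *s v" if "A *v v = x *s v" "x \<noteq> 0" for x v
    using that by (intro inv_vec_eq[OF A(1)]) (simp add: mult_vec_scale)
  show "conjT q A \<in> tor"
    using i[OF A(2) nz(1)] i[OF A(3) nz(2)] i[OF A(4) nz(3)] i[OF A(5) nz(4)] A(1) SU_conjT unfolding tor_def by blast
  fix B assume "B \<in> tor"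
  then obtain a' b' c' d' where B: "B \<in> SU" "B *v e1 = a' *s e1" "B *v e2 = b' *s e2" "B *v f1 = c' *s f1" "B *v f2 = d' *s f2"
    by (auto simp: tor_def)
  have "A ** B *v e1 = (a' * a) *s e1" "A ** B *v e2 = (b' * b) *s e2" "A ** B *v f1 = (c' * c) *s f1" "A ** B *v f2 = (d' * d) *s f2"
    by (simp_all add: A B mult_vec_scale flip: matrix_vector_mul_assoc)
  then show "A ** B \<in> tor" using A(1) B(1) SU_mult unfolding tor_def by blast
qed (auto simp: tor_def)

lemma tor_comm:
  assumes "A \<in> tor" "B \<in> tor"
  shows "A ** B = B ** A"
proof -
  obtain a b c d where A: "A *v e1 = a *s e1" "A *v e2 = b *s e2" "A *v f1 = c *s f1" "A *v f2 = d *s f2"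
    using assms by (auto simp: tor_def)
  obtain a' b' c' d' where B: "B *v e1 = a' *s e1" "B *v e2 = b' *s e2" "B *v f1 = c' *s f1" "B *v f2 = d' *s f2"
    using assms by (auto simp: tor_def)
  show ?thesis
    by (rule frame_matrix_eqI) (simp_all add: A B mult_vec_scale mult.commute flip: matrix_vector_mul_assoc)
qed

lemma tor_f:
  assumes "A \<in> tor" "A *v e1 = a *s e1" "A *v e2 = b *s e2"
  shows "A *v f1 = (1 / cj a) *s f1" "A *v f2 = (1 / cj b) *s f2"
proof -
  obtain c d where A: "A \<in> SU" "A *v f1 = c *s f1" "A *v f2 = d *s f2"
    using assms(1) by (auto simp: tor_def)
  have ab: "a \<noteq> 0" "b \<noteq> 0" using eigen_nonzero A assms by auto
  have "h (A *v f1) (A *v e1) = 1" "h (A *v f2) (A *v e2) = 1" using A(1) by simp_all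
  then have "c = 1 / cj a" "d = 1 / cj b" using ab by (simp_all add: A assms field_simps)
  then show "A *v f1 = (1 / cj a) *s f1" "A *v f2 = (1 / cj b) *s f2" using A by simp_all
qed

text \<open>The eigenvalues on \<open>e1\<close> and \<open>e2\<close> determine the diagonal
  factor; dividing it out leaves an element that fixes both vectors.\<close>

lemma borel2_bij: "bij_betw (\<lambda>(a, k). a ** k) (unip \<times> tor) borel2"
  unfolding bij_betw_def
proof (intro conjI inj_onI)
  fix u v assume uv: "u \<in> unip \<times> tor" "v \<in> unip \<times> tor"
    "(\<lambda>(a, k). a ** k) u = (\<lambda>(a, k). a ** k) v"
  obtain n k where u: "u = (n, k)" "n \<in> unip" "k \<in> tor"
    using uv by auto
  obtain n' k' where v: "v = (n', k')" "n' \<in> unip" "k' \<in> tor"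
    using uv by auto
  have e: "n ** k = n' ** k'" using uv(3) u v by simp
  obtain a b where k: "k \<in> SU" "k *v e1 = a *s e1" "k *v e2 = b *s e2"
    using u(3) by (auto simp: tor_def)
  obtain a' b' where k': "k' *v e1 = a' *s e1" "k' *v e2 = b' *s e2"
    using v(3) by (auto simp: tor_def)
  have n: "n *v e1 = e1" "n *v e2 = e2" "n' *v e1 = e1" "n' *v e2 = e2" using u v by (auto simp: unip_def)
  have "n *v (k *v e1) = n' *v (k' *v e1)" "n *v (k *v e2) = n' *v (k' *v e2)"
    using e by (simp_all add: matrix_vector_mul_assoc)
  then have "a = a'" "b = b'" by (simp_all add: k k' mult_vec_scale n)
  then have "k = k'" using k k' tor_f[OF u(3) k(2,3)] tor_f[OF v(3) k'] by (intro frame_matrix_eqI) auto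
  moreover from this have "n ** k ** conjT q k = n' ** k ** conjT q k" using e by simp
  then have "n = n'" using k(1) by (simp add: conjT_mult_self flip: matrix_mul_assoc)
  ultimately show "u = v" by (simp add: u v)
next
  show "(\<lambda>(a, k). a ** k) ` (unip \<times> tor) = borel2"
  proof (intro equalityI subsetI)
    fix g assume "g \<in> (\<lambda>(a, k). a ** k) ` (unip \<times> tor)"
    then obtain n k where g: "g = n ** k" "n \<in> unip" "k \<in> tor" by auto
    obtain a b where k: "k \<in> SU" "k *v e1 = a *s e1" "k *v e2 = b *s e2"
      using g(3) by (auto simp: tor_def)
    have n: "n \<in> SU" "n *v e1 = e1" "n *v e2 = e2" using g by (auto simp: unip_def)
    have "g *v e1 = a *s e1" "g *v e2 = b *s e2"
      by (simp_all add: g(1) k n mult_vec_scale flip: matrix_vector_mul_assoc)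
    then show "g \<in> borel2" using g(1) k(1) n(1) unfolding borel2_def by auto
  next
    fix g assume "g \<in> borel2"
    then obtain a b where g: "g \<in> SU" "g *v e1 = a *s e1" "g *v e2 = b *s e2" by (auto simp: borel2_def)
    have ab: "a \<noteq> 0" "b \<noteq> 0" using eigen_nonzero g by auto
    obtain t where t: "t \<in> SU" "t *v e1 = a *s e1" "t *v e2 = b *s e2" "t *v f1 = (1 / cj a) *s f1" "t *v f2 = (1 / cj b) *s f2"
      using torus_exists[OF borel2_det[OF g] ab] by blast
    have tt: "t \<in> tor" using t unfolding tor_def by blast
    have "conjT q t *v e1 = (1 / a) *s e1" "conjT q t *v e2 = (1 / b) *s e2"
      using ab by (auto intro!: inv_vec_eq[OF t(1)] simp: mult_vec_scale t)
    then have "g ** conjT q t \<in> unip"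
      using g t(1) ab by (auto simp: unip_def mult_vec_scale simp flip: matrix_vector_mul_assoc)
    moreover have "g = (g ** conjT q t) ** t" using t(1) by (simp add: conjT_mult_self flip: matrix_mul_assoc)
    ultimately show "g \<in> (\<lambda>(a, k). a ** k) ` (unip \<times> tor)"
      using tt by (intro image_eqI[of _ _ "(g ** conjT q t, t)"]) auto
  qed
qed

section \<open>The centre is diagonal\<close>

lemma tor_eigen:
  assumes "t *v e1 = a *s e1" "t *v e2 = b *s e2" "t *v f1 = c *s f1" "t *v f2 = d *s f2"
    and "t *v v = l *s v"
  shows "l \<noteq> b \<Longrightarrow> l \<noteq> c \<Longrightarrow> l \<noteq> d \<Longrightarrow> \<exists>x. v = x *s e1"
    "l \<noteq> a \<Longrightarrow> l \<noteq> c \<Longrightarrow> l \<noteq> d \<Longrightarrow> \<exists>x. v = x *s e2"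
    "l \<noteq> a \<Longrightarrow> l \<noteq> b \<Longrightarrow> l \<noteq> d \<Longrightarrow> \<exists>x. v = x *s f1"
    "l \<noteq> a \<Longrightarrow> l \<noteq> b \<Longrightarrow> l \<noteq> c \<Longrightarrow> \<exists>x. v = x *s f2"
proof -
  obtain x y z w where v: "v = x *s e1 + y *s e2 + z *s f1 + w *s f2"
    using frame_expand by blast
  have "t *v v = (a * x) *s e1 + (b * y) *s e2 + (c * z) *s f1 + (d * w) *s f2"
    unfolding v by (simp add: matrix_vector_right_distrib mult_vec_scale assms(1-4) mult.commute)
  moreover have "l *s v = (l * x) *s e1 + (l * y) *s e2 + (l * z) *s f1 + (l * w) *s f2"
    unfolding v by (simp add: vec_eq_iff algebra_simps)
  ultimately have e: "a * x = l * x" "b * y = l * y" "c * z = l * z" "d * w = l * w"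
    using assms(5) frame_comb_eq_iff by auto
  show "l \<noteq> b \<Longrightarrow> l \<noteq> c \<Longrightarrow> l \<noteq> d \<Longrightarrow> \<exists>x. v = x *s e1"
    "l \<noteq> a \<Longrightarrow> l \<noteq> c \<Longrightarrow> l \<noteq> d \<Longrightarrow> \<exists>x. v = x *s e2"
    "l \<noteq> a \<Longrightarrow> l \<noteq> b \<Longrightarrow> l \<noteq> d \<Longrightarrow> \<exists>x. v = x *s f1"
    "l \<noteq> a \<Longrightarrow> l \<noteq> b \<Longrightarrow> l \<noteq> c \<Longrightarrow> \<exists>x. v = x *s f2"
    using e unfolding v by auto
qed

text \<open>A central element preserves the eigenspaces of every group element, so one diagonal
  element with four distinct eigenvalues is enough.\<close>

lemma center_subset_tor: "group_center (SU4 q :: ('a^4^4) monoid) \<subseteq> tor"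
proof
  fix z assume z: "z \<in> group_center (SU4 q :: ('a^4^4) monoid)"
  then have zS: "z \<in> SU" and comm: "\<And>g. g \<in> SU \<Longrightarrow> z ** g = g ** z"
    by (auto simp: group_center_def)
  obtain s :: 'a where s: "s \<noteq> 0" "\<And>i. s ^ i = 1 \<longleftrightarrow> (q\<^sup>2 - 1) dvd i"
    using field_generator by blast
  \<comment> \<open>A coincidence among \<open>s\<close>, \<open>1 / s\<close>,
    \<open>1 / cj s\<close> and \<open>cj s\<close> would make a power of \<open>s\<close> with
    exponent 2, q - 1, q + 1 or 2 q equal to one. The order of a generator exceeds 2 q, which
    excludes this.\<close>
  have big: "q\<^sup>2 - 1 > 2 * q"
  proof -
    have "3 * q \<le> q * q" using q_ge_3 by simp
    then show ?thesis
      unfolding power2_eq_square using q_ge_3 by linarith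
  qed
  have ne: "s ^ i \<noteq> 1" if "0 < i" "i \<le> 2 * q" for i
    using s(2)[of i] that big by (auto dest: dvd_imp_le)
  have n1: "s * s \<noteq> 1" using ne[of 2] q_ge_3 by (simp add: power2_eq_square)
  have n2: "s * cj s \<noteq> 1" using ne[of "q + 1"] q_ge_3 by (simp add: cj_def)
  have n3: "cj s \<noteq> s"
  proof
    assume "cj s = s"
    then have "s ^ (q - 1) * s = 1 * s" using q_ge_3 by (simp add: cj_def flip: power_Suc2)
    then have "s ^ (q - 1) = 1" using s(1) by simp
    moreover have "0 < q - 1" "q - 1 \<le> 2 * q" using q_ge_3 by simp_all
    ultimately show False using ne by blast
  qed
  have n4: "cj s * cj s \<noteq> 1" using ne[of "2 * q"] q_ge_3 by (simp add: cj_def mult_2 power_add)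
  have cs: "cj s \<noteq> 0" using s(1) by simp
  obtain t where t: "t \<in> SU" "t *v e1 = s *s e1" "t *v e2 = (1 / s) *s e2"
    "t *v f1 = (1 / cj s) *s f1" "t *v f2 = cj s *s f2"
    using torus_exists[of s "1 / s"] s(1) by auto
  have ev: "t *v (z *v v) = l *s (z *v v)" if "t *v v = l *s v" for v l
  proof -
    have "t *v (z *v v) = z *v (t *v v)" using comm[OF t(1)] by (simp add: matrix_vector_mul_assoc)
    then show ?thesis by (simp add: that mult_vec_scale)
  qed
  have d: "s \<noteq> 1 / s" "s \<noteq> 1 / cj s" "s \<noteq> cj s" "1 / s \<noteq> 1 / cj s" "1 / s \<noteq> cj s" "1 / cj s \<noteq> cj s"
    using n1 n2 n3 n4 s(1) cs by (auto simp: field_simps)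
  have "\<exists>x. z *v e1 = x *s e1" by (rule tor_eigen(1)[OF t(2-5) ev[OF t(2)]]) (use d in auto)
  moreover have "\<exists>x. z *v e2 = x *s e2"
    by (rule tor_eigen(2)[OF t(2-5) ev[OF t(3)]]) (use d in metis)+
  moreover have "\<exists>x. z *v f1 = x *s f1"
    by (rule tor_eigen(3)[OF t(2-5) ev[OF t(4)]]) (use d in metis)+
  moreover have "\<exists>x. z *v f2 = x *s f2"
    by (rule tor_eigen(4)[OF t(2-5) ev[OF t(5)]]) (use d in metis)+
  ultimately show "z \<in> tor" using zS unfolding tor_def by blast
qed

lemma mls_stab_center: "mls_rel (SU4 q) stab (group_center (SU4 q :: ('a^4^4) monoid))"
proof -
  interpret group "SU4 q :: ('a^4^4) monoid" by (rule group_SU4)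
  have fin: "finite (carrier (SU4 q :: ('a^4^4) monoid))" by simp
  note mls_stab_borel
  also have "mls_rel (SU4 q) (preim stab (pt e1) {pt e1}) borel2"
    using borel_bij root_grp_comm su_closed_subgroup[OF su_closed_root_grp] fin
    by (intro mls_rel_abelian_factor[of root_grp]) (auto simp: borel2_def)
  also have "mls_rel (SU4 q) borel2 tor" using borel2_bij unip_comm su_closed_subgroup[OF su_closed_unip] fin
    by (intro mls_rel_abelian_factor[of unip]) (auto simp: tor_def)
  also have "mls_rel (SU4 q) tor (group_center (SU4 q))"
    using tor_comm su_closed_subgroup[OF su_closed_tor] fin center_subset_tor
      normal_imp_subgroup[OF group_center_normal] by (intro mls_rel_abelian) auto
  finally show ?thesis .
qed

subsection \<open>Singer cycles\<close>

text \<open>The plane is modelled on GF(q^6). The order q^2 - q + 1 of the root of unity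
  \<open>u\<close> divides q^3 + 1, so the power q^3 inverts \<open>u\<close>; this is what makes
  multiplication by \<open>u\<close> compatible with a Hermitian form. Coprimality keeps the
  nontrivial powers of \<open>u\<close> out of GF(q^2), where they would fix every point.\<close>

lemma singer_exists:
  assumes cop: "coprime (q\<^sup>2 - q + 1) (q + 1)"
  shows "\<exists>g\<in>SU. \<forall>P\<in>opts. act g P \<in> opts \<and> (act g ^^ (q\<^sup>2 - q + 1)) P = P \<and>
    (\<forall>i. 0 < i \<longrightarrow> i < q\<^sup>2 - q + 1 \<longrightarrow> (act g ^^ i) P \<noteq> P)"
proof -
  define r where "r = q\<^sup>2 - q + 1"
  have qq: "q\<^sup>2 - q = q * (q - 1)" by (simp add: power2_eq_square right_diff_distrib')
  have le: "q \<le> q\<^sup>2" by (simp add: power2_eq_square)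
  have r1: "r > 1" using q_ge_3 by (simp add: r_def qq)
  have rq: "r + q = q\<^sup>2 + 1" using le by (simp add: r_def)
  have cq: "coprime r q" "coprime r (q - 1)"
  proof -
    have "is_unit c" if "c dvd r" "c dvd q \<or> c dvd q - 1" for c
    proof -
      have "c dvd q\<^sup>2 - q"
        unfolding qq using that(2) by auto
      then show ?thesis using that(1) unfolding r_def using dvd_add_right_iff by blast
    qed
    then show "coprime r q" "coprime r (q - 1)" by (auto intro!: coprimeI)
  qed
  have codd: "odd r" using odd_q by (simp add: r_def qq)
  obtain u :: "'a alg_closure" where u: "\<And>i. u ^ i = 1 \<longleftrightarrow> r dvd i"
    using primitive_root_ac[OF cq(1)] r1 by auto
  have ur: "u ^ r = 1" using u by simp
  have u0: "u \<noteq> 0" using ur r1 by (auto simp: power_0_left)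
  \<comment> \<open>\<open>v\<close> and \<open>w\<close> are the conjugates of \<open>u\<close>
    over GF(q^2): the power q^4 of \<open>u\<close> is \<open>inverse (u ^ q)\<close> because the
    power q^3 inverts \<open>u\<close>.\<close>
  define v where "v = u ^ (q\<^sup>2)"
  define w where "w = inverse (u ^ q)"
  have v0: "v \<noteq> 0" and w0: "w \<noteq> 0" using u0 by (simp_all add: v_def w_def)
  have uvw: "u * v * w = 1"
  proof -
    have "u * v = u ^ (r + q)" by (simp add: v_def rq)
    then have "u * v = u ^ q" by (simp add: power_add ur)
    then show ?thesis using u0 by (simp add: w_def)
  qed
  have vq: "v ^ q = inverse u"
  proof -
    have "q\<^sup>2 * q + 1 = (q + 1) * r"
    proof -
      have "(q + 1) * r + (q + 1) * q = (q + 1) * (q\<^sup>2 + 1)"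
        unfolding rq[symmetric] by (simp add: algebra_simps)
      then show ?thesis by (simp add: algebra_simps power2_eq_square)
    qed
    then have "u ^ (q\<^sup>2 * q + 1) = 1" using u by simp
    then have "u * v ^ q = 1" by (simp add: v_def power_mult)
    then show ?thesis by (rule inverse_unique[symmetric])
  qed
  have uq: "u ^ q = inverse w" by (simp add: w_def)
  have wq: "w ^ q = inverse v" by (simp add: w_def v_def power_inverse power2_eq_square power_mult)
  have sq: "x ^ (q\<^sup>2) = (x ^ q) ^ q" for x :: "'a alg_closure"
    by (simp add: power2_eq_square power_mult)
  have vs: "v ^ (q\<^sup>2) = w" and ws: "w ^ (q\<^sup>2) = u" and us: "u ^ (q\<^sup>2) = v"
    by (simp_all only: sq vq wq uq power_inverse inverse_inverse_eq)
  define a where "a = u + v + w"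
  have aq: "a ^ q = inverse u + inverse v + inverse w"
    unfolding a_def frob_ac uq vq wq by (simp add: ac_simps)
  have "a ^ (q\<^sup>2) = a"
    unfolding a_def frob_sq_ac us vs ws by (simp add: ac_simps)
  then obtain \<alpha> where \<alpha>: "a = to_ac \<alpha>" using in_range_to_ac by blast
  have caq: "to_ac (cj \<alpha>) = a ^ q" by (simp add: cj_def \<alpha>)
  have iu: "inverse u = v * w" "inverse v = u * w" "inverse w = u * v"
    using uvw by (auto intro!: inverse_unique simp: ac_simps)
  have aq2: "to_ac (cj \<alpha>) = v * w + u * w + u * v"
    unfolding caq aq iu ..
  have cubic: "u * u * u = to_ac \<alpha> * (u * u) - to_ac (cj \<alpha>) * u + 1"
    unfolding aq2 \<alpha>[symmetric] uvw[symmetric] a_def by (simp add: algebra_simps)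
  have neg1: "x \<noteq> -1" if "x ^ r = 1" for x :: "'a alg_closure"
  proof
    assume "x = -1"
    then have "(-1 :: 'a alg_closure) = 1" using that codd by simp
    then have "to_ac (2 :: 'a) = 0" by (metis add.right_inverse one_add_one to_ac_numeral)
    then show False
      unfolding to_ac_eq_0_iff by simp
  qed
  have vr: "v ^ r = 1" and wr: "w ^ r = 1"
  proof -
    have "(u ^ k) ^ r = 1" for k by (metis mult.commute power_mult power_one ur)
    then show "v ^ r = 1" "w ^ r = 1" by (simp_all add: v_def w_def power_inverse)
  qed
  \<comment> \<open>Up to sign this is the cubic with roots \<open>u\<close>, \<open>v\<close>,
    \<open>w\<close> evaluated at -1. None of the roots is -1, as they are roots of unity of odd
    exponent \<open>r\<close>; so the value is nonzero.\<close>
  have "to_ac (\<alpha> + cj \<alpha> + 2) = (1 + u) * (1 + v) * (1 + w)"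
  proof -
    have "(1 + u) * (1 + v) * (1 + w) = 1 + (u + v + w) + (v * w + u * w + u * v) + u * v * w"
      by (simp add: algebra_simps)
    then show ?thesis
      unfolding uvw by (simp add: aq2 a_def flip: \<alpha>)
  qed
  moreover have "1 + u \<noteq> 0" "1 + v \<noteq> 0" "1 + w \<noteq> 0"
    using neg1[OF ur] neg1[OF vr] neg1[OF wr] by (auto simp: add_eq_0_iff)
  ultimately have tr0: "\<alpha> + cj \<alpha> + 2 \<noteq> 0" by (metis mult_eq_0_iff to_ac_0)
  \<comment> \<open>\<open>g\<close> is the companion matrix of the minimal polynomial \<open>T\<^sup>3 - \<alpha> T\<^sup>2 + \<alpha>\<^sup>q T - 1\<close> of \<open>u\<close> in a basis
    \<open>e1, f1, v2\<close>; it preserves the form because the Gram matrix is Toeplitz with entries \<open>0, 1, \<beta>\<close>.\<close>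
  define \<beta> where "\<beta> = \<alpha> + 1"
  \<comment> \<open>The norm of \<open>\<gamma>\<close> is dictated by isotropy of
    \<open>v2\<close>, and \<open>\<gamma> \<noteq> 0\<close> makes \<open>v2\<close> independent of
    \<open>e1\<close> and \<open>f1\<close>.\<close>
  obtain \<gamma> where \<gamma>: "nrm \<gamma> = - (\<alpha> + cj \<alpha> + 2)"
    using nrm_surj[of "- (\<alpha> + cj \<alpha> + 2)"] by (auto simp: add.commute)
  have \<gamma>0: "\<gamma> \<noteq> 0" using tr0 \<gamma> by (metis neg_equal_0_iff_equal nrm_simps(1))
  define c3 where "c3 = vec4 0 0 (1::'a) 0"
  define d4 where "d4 = vec4 0 0 0 (1::'a)"
  define v2 where "v2 = e1 + \<beta> *s f1 + \<gamma> *s c3"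
  have hc: "h e1 c3 = 0" "h f1 c3 = 0" "h c3 e1 = 0" "h c3 f1 = 0" "h c3 c3 = 1"
    "h e1 d4 = 0" "h f1 d4 = 0" "h c3 d4 = 0" "h d4 d4 = 1"
    by (simp_all add: e1_def f1_def c3_def d4_def h_vec4)
  have hv: "h e1 v2 = cj \<beta>" "h v2 e1 = \<beta>" "h f1 v2 = 1" "h v2 f1 = 1" "h v2 d4 = 0"
    by (simp_all add: v2_def hc)
  have hv2: "h v2 v2 = 0"
  proof -
    have "h v2 v2 = cj \<beta> + \<beta> + nrm \<gamma>" by (simp add: v2_def hc nrm_def)
    then show ?thesis by (simp add: \<gamma> \<beta>_def)
  qed
  define E where "E = cols e1 f1 v2 d4"
  have detE: "det E \<noteq> 0"
  proof -
    have "\<xi> \<noteq> 0" using xi by auto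
    moreover have "det E = - \<xi> * \<gamma>"
      by (simp add: E_def det_4 e1_def f1_def v2_def c3_def d4_def field_simps)
    ultimately show ?thesis using \<gamma>0 by simp
  qed
  have Ev: "E *v vec4 x y z t = x *s e1 + y *s f1 + z *s v2 + t *s d4" for x y z t
    by (simp add: E_def cols_vector_mult)
  define C where "C = cols (vec4 0 1 0 0) (vec4 0 0 1 0) (vec4 1 (- cj \<alpha>) \<alpha> 0) (vec4 0 0 0 (1::'a))"
  define v3 where "v3 = e1 + (- cj \<alpha>) *s f1 + \<alpha> *s v2"
  \<comment> \<open>The value of \<open>\<beta>\<close> originates here: \<open>h v2 v3\<close> is
    \<open>\<beta> - \<alpha>\<close> and has to equal \<open>h f1 v2\<close>, which is 1.\<close>
  have h3: "h v2 v3 = 1" "h f1 v3 = cj \<beta>" "h v3 v3 = 0" "h v3 d4 = 0"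
  proof -
    show "h v2 v3 = 1" "h f1 v3 = cj \<beta>" "h v3 d4 = 0" by (simp_all add: v3_def hv hv2 hc \<beta>_def)
    show "h v3 v3 = 0" by (simp add: v3_def hv hv2 hc \<beta>_def algebra_simps)
  qed
  have "\<exists>g\<in>SU. g *v e1 = f1 \<and> g *v f1 = v2 \<and> g *v v2 = v3 \<and> g *v d4 = d4"
  proof (rule frame_comb[OF detE E_def])
    show "det (cols (vec4 0 1 0 0) (vec4 0 0 1 0) (vec4 1 (- cj \<alpha>) \<alpha> 0) (vec4 0 0 0 (1::'a))) = 1"
      by (simp add: det_4)
    show "f1 = E *v vec4 0 1 0 0" "v2 = E *v vec4 0 0 1 0" "d4 = E *v vec4 0 0 0 1"
      "v3 = E *v vec4 1 (- cj \<alpha>) \<alpha> 0" by (simp_all add: Ev v3_def)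
  qed (simp_all add: hv hv2 h3 hc)
  then obtain g where g: "g \<in> SU" "g *v e1 = f1" "g *v f1 = v2" "g *v v2 = v3" "g *v d4 = d4" by blast
  obtain Ei where Ei: "E ** Ei = mat 1" "Ei ** E = mat 1"
    using detE invertible_det_nz[of E] unfolding invertible_def by blast
  have gE: "g ** E = E ** C"
    unfolding C_def cols_mult Ev by (simp add: E_def cols_mult g v3_def)
  have Eig: "Ei *v (g *v x) = C *v (Ei *v x)" for x
  proof -
    have "Ei ** g = Ei ** g ** (E ** Ei)" by (simp add: Ei)
    also have "\<dots> = Ei ** (g ** E) ** Ei" by (simp add: matrix_mul_assoc)
    also have "\<dots> = (Ei ** E) ** C ** Ei"
      unfolding gE by (simp add: matrix_mul_assoc)
    finally have "Ei ** g = C ** Ei" by (simp add: Ei)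
    then show ?thesis by (simp add: matrix_vector_mul_assoc)
  qed
  have EEi: "E *v (Ei *v x) = x" for x by (simp add: matrix_vector_mul_assoc Ei)
  \<comment> \<open>\<open>\<phi>\<close> embeds the plane \<open>x\<^sub>4 = 0\<close> into the algebraic closure and turns \<open>g\<close> into multiplication by \<open>u\<close>.\<close>
  define \<psi> where "\<psi> y = to_ac (y$1) + to_ac (y$2) * u + to_ac (y$3) * (u * u)" for y :: "'a^4"
  define \<phi> where "\<phi> x = \<psi> (Ei *v x)" for x
  have \<psi>C: "\<psi> (C *v y) = u * \<psi> y" for y
  proof -
    have "\<psi> (C *v y) = to_ac (y$3) + (to_ac (y$1) - to_ac (cj \<alpha>) * to_ac (y$3)) * u + (to_ac (y$2) + to_ac \<alpha> * to_ac (y$3)) * (u * u)"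
      by (simp add: \<psi>_def C_def cols_vector_mult algebra_simps)
    also have "\<dots> = to_ac (y$1) * u + to_ac (y$2) * (u * u) + to_ac (y$3) * (to_ac \<alpha> * (u * u) - to_ac (cj \<alpha>) * u + 1)"
      by (simp add: algebra_simps)
    also have "\<dots> = u * \<psi> y"
      unfolding cubic[symmetric] by (simp add: \<psi>_def algebra_simps)
    finally show ?thesis .
  qed
  have \<phi>g: "\<phi> (g *v x) = u * \<phi> x" for x by (simp add: \<phi>_def Eig \<psi>C)
  have \<phi>pow: "\<phi> (((\<lambda>x. g *v x) ^^ i) x) = u ^ i * \<phi> x" for x i
    by (induction i) (auto simp: \<phi>g)
  have \<phi>scale: "\<phi> (c *s x) = to_ac c * \<phi> x" for c x
    by (simp add: \<phi>_def \<psi>_def mult_vec_scale algebra_simps)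
  have \<phi>diff: "\<phi> (x - y) = \<phi> x - \<phi> y" for x y
    by (simp add: \<phi>_def \<psi>_def matrix_vector_mult_diff_distrib algebra_simps)
  have cr: "coprime r (q\<^sup>2 - 1)" using cq(2) cop unfolding q_sq_minus_1(1)[symmetric] r_def[symmetric]
    by (simp only: coprime_mult_right_iff)
  have notK: "r dvd i" if l: "u ^ i = to_ac l" for i l
  proof -
    have "(u ^ i) ^ (q\<^sup>2) = u ^ i"
      unfolding l by (rule to_ac_frob_sq)
    then have "u ^ (i * (q\<^sup>2 - 1)) * u ^ i = u ^ i"
      using le q_ge_3 by (simp add: right_diff_distrib' flip: power_add power_mult)
    then have "u ^ (i * (q\<^sup>2 - 1)) = 1" using u0 by simp
    then have "r dvd i * (q\<^sup>2 - 1)" using u by simp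
    then show ?thesis using cr by (simp add: coprime_dvd_mult_left_iff)
  qed
  have uv: "u \<noteq> v"
  proof
    assume "u = v"
    then have "u ^ (q\<^sup>2) = u" by (simp add: v_def)
    then obtain l where "u ^ 1 = to_ac l" using in_range_to_ac[of u] by auto
    from notK[OF this] show False
      using r1 by simp
  qed
  have vw: "v \<noteq> w" using uv vs ws us by metis
  have uw: "u \<noteq> w" using vw uv vs ws us by metis
  \<comment> \<open>A polynomial of degree at most two over the field that vanishes at
    \<open>u\<close> also vanishes at \<open>v\<close> and \<open>w\<close>; having three distinct
    roots, it is zero. The argument takes divided differences.\<close>
  have \<phi>0: "x = 0" if x: "x$4 = 0" "\<phi> x = 0" for x
  proof -
    define y where "y = Ei *v x"
    have xy: "x = E *v y" by (simp add: y_def EEi)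
    have "x$4 = y$4" by (simp add: xy E_def cols_vector_mult e1_def f1_def v2_def c3_def d4_def)
    then have y4: "y$4 = 0" using x by simp
    let ?y1 = "to_ac (y$1)" and ?y2 = "to_ac (y$2)" and ?y3 = "to_ac (y$3)"
    have eu: "?y1 + ?y2 * u + ?y3 * (u * u) = 0" using x(2) by (simp add: \<phi>_def \<psi>_def y_def)
    have fr: "?y1 + ?y2 * z ^ (q\<^sup>2) + ?y3 * (z ^ (q\<^sup>2) * z ^ (q\<^sup>2)) = 0"
      if "?y1 + ?y2 * z + ?y3 * (z * z) = 0" for z
    proof -
      have "(?y1 + ?y2 * z + ?y3 * (z * z)) ^ (q\<^sup>2) = 0"
        unfolding that using q_ge_3 by (simp add: power_0_left)
      then show ?thesis
        unfolding frob_sq_ac by (simp only: power_mult_distrib to_ac_frob_sq)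
    qed
    have ev: "?y1 + ?y2 * v + ?y3 * (v * v) = 0" using fr[OF eu] by (simp only: us)
    have ew: "?y1 + ?y2 * w + ?y3 * (w * w) = 0" using fr[OF ev] by (simp only: vs)
    have "(u - v) * (?y2 + ?y3 * (u + v)) = (?y1 + ?y2 * u + ?y3 * (u * u)) - (?y1 + ?y2 * v + ?y3 * (v * v))"
      by (simp add: algebra_simps)
    then have e1': "?y2 + ?y3 * (u + v) = 0" using uv by (simp add: eu ev)
    have "(u - w) * (?y2 + ?y3 * (u + w)) = (?y1 + ?y2 * u + ?y3 * (u * u)) - (?y1 + ?y2 * w + ?y3 * (w * w))"
      by (simp add: algebra_simps)
    then have e2': "?y2 + ?y3 * (u + w) = 0" using uw by (simp add: eu ew)
    have "?y3 * (v - w) = (?y2 + ?y3 * (u + v)) - (?y2 + ?y3 * (u + w))" by (simp add: algebra_simps)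
    then have "?y3 = 0" using vw by (simp add: e1' e2')
    then have "y$3 = 0" "y$2 = 0" "y$1 = 0" using e1' eu by simp_all
    then have "y = 0" using y4 by (simp add: vec4_eq_iff)
    then show ?thesis by (simp add: xy)
  qed
  have g4: "(g *v x) $ 4 = x $ 4" for x using vec4_4_mult g(1,5) unfolding d4_def by blast
  have g4pow: "((((\<lambda>x. g *v x) ^^ i) x) $ 4) = x $ 4" for i x by (induction i) (auto simp: g4)
  have main: "act g P \<in> opts \<and> (act g ^^ r) P = P \<and> (\<forall>i. 0 < i \<longrightarrow> i < r \<longrightarrow> (act g ^^ i) P \<noteq> P)"
    if "P \<in> opts" for P
  proof -
    obtain x where x: "P = pt x" "x \<noteq> 0" "x$4 = 0" "h x x = 0"
      using \<open>P \<in> opts\<close> by (auto simp: opts_def)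
    have "act g P = pt (g *v x)" "g *v x \<noteq> 0" "(g *v x) $ 4 = 0" "h (g *v x) (g *v x) = 0"
      using x g(1) g4 by (simp_all add: act_pt)
    then have "act g P \<in> opts"
      unfolding opts_def by blast
    moreover have "(act g ^^ r) P = P"
    proof -
      have "\<phi> (((\<lambda>x. g *v x) ^^ r) x - x) = 0"
        unfolding \<phi>diff \<phi>pow ur by simp
      then have "((\<lambda>x. g *v x) ^^ r) x - x = 0" by (rule \<phi>0[rotated]) (simp add: g4pow)
      then show ?thesis by (simp add: x(1) funpow_act_pt)
    qed
    moreover have "(act g ^^ i) P \<noteq> P" if i: "0 < i" "i < r" for i
    proof
      assume "(act g ^^ i) P = P"
      then have "pt x = pt (((\<lambda>x. g *v x) ^^ i) x)" by (simp add: x(1) funpow_act_pt)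
      then obtain l where "((\<lambda>x. g *v x) ^^ i) x = l *s x" using pt_eqD by blast
      then have "u ^ i * \<phi> x = to_ac l * \<phi> x" using \<phi>pow[of i x] \<phi>scale[of l x] by metis
      moreover have "\<phi> x \<noteq> 0" using \<phi>0 x by blast
      ultimately have "u ^ i = to_ac l" by (metis mult_right_cancel)
      from notK[OF this] show False
        using i by (auto dest: dvd_imp_le)
    qed
    ultimately show ?thesis by blast
  qed
  show ?thesis using g(1) main unfolding r_def by blast
qed

text \<open>The base pair \<open>S\<close> on the curve consists of the torus representatives from
  \<open>nset_orbit\<close>. The pencils over it are therefore \<open>ells S nset\<close>, the set
  at which the second half of \<open>mls_ells\<close> takes over.\<close>

lemma mls_lines_case2:
  assumes p: "prime p" "q + 1 = 2 * p" and q5: "q > 5"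
  shows "mls_rel (SU4 q) SU stab"
proof -
  define r where "r = q\<^sup>2 - q + 1"
  have "coprime r (q + 1)"
  proof (rule coprimeI)
    fix c assume c: "c dvd r" "c dvd q + 1"
    \<comment> \<open>Modulo \<open>q + 1\<close> the number \<open>r\<close> is 3, so a common
      divisor is 1 or 3. In the latter case 3 divides \<open>2 * p\<close>, which forces
      \<open>p = 3\<close> and \<open>q = 5\<close>.\<close>
    have "q * (q - 1) + 1 = (q + 1) * (q - 2) + 3"
    proof -
      obtain k where "q = 2 + k"
        using q5 le_Suc_ex[of 2 q] by auto
      then show ?thesis by (simp add: algebra_simps)
    qed
    moreover have "r = q * (q - 1) + 1" by (simp add: r_def power2_eq_square right_diff_distrib')
    ultimately have "c dvd (q + 1) * (q - 2) + 3" using c(1) by metis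
    then have "c dvd 3" using dvd_add_right_iff[OF dvd_mult2[OF c(2)]] by blast
    moreover have "prime (3::nat)" by simp
    ultimately consider "c = 1" | "c = 3"
      unfolding prime_nat_iff by blast
    then show "is_unit c"
    proof cases
      case 2
      then have "3 dvd 2 * p" using c(2) p(2) by simp
      moreover have "coprime (3::nat) 2" by (simp add: primes_coprime)
      ultimately have "3 dvd p" by (simp add: coprime_dvd_mult_right_iff)
      then have "p = 3" using p(1) primes_dvd_imp_eq[of 3 p] by simp
      then show ?thesis using p(2) q5 by simp
    qed simp
  qed
  from singer_exists[OF this[unfolded r_def], folded r_def]
  obtain g where g: "g \<in> SU" and gP: "\<forall>P\<in>opts. act g P \<in> opts \<and> (act g ^^ r) P = P \<and>
      (\<forall>i. 0 < i \<longrightarrow> i < r \<longrightarrow> (act g ^^ i) P \<noteq> P)" by (rule bexE)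
  have gopts: "\<And>P. P \<in> opts \<Longrightarrow> act g P \<in> opts"
    and gr: "\<And>P. P \<in> opts \<Longrightarrow> (act g ^^ r) P = P"
    and gi: "\<And>P i. P \<in> opts \<Longrightarrow> 0 < i \<Longrightarrow> i < r \<Longrightarrow> (act g ^^ i) P \<noteq> P"
    using gP by blast+
  have r0: "r > 0" by (simp add: r_def)
  have finO: "finite opts"
    unfolding opts_eq by simp
  obtain R where R: "R \<subseteq> opts" "bij_betw (\<lambda>(i, w). (act g ^^ i) w) ({..<r} \<times> R) opts"
    using free_orbit_representatives[OF finO r0 gopts gr gi] by blast
  have "r * card R = r * (q + 1)"
    using bij_betw_same_card[OF R(2)] card_opts by (simp add: card_cartesian_product r_def mult.commute)
  then have cR: "card R = 2 * p" using r0 p(2) by (metis mult_left_cancel not_gr_zero)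
  have finR: "finite R" using finO R(1) finite_subset by blast
  \<comment> \<open>The numbering groups the representatives into \<open>p\<close> pairs with
    numbers \<open>2 * j\<close> and \<open>2 * j + 1\<close>.\<close>
  obtain \<rho> where \<rho>: "bij_betw \<rho> {0..<2 * p} R"
    using ex_bij_betw_nat_finite[OF finR] cR by auto
  obtain s where s: "nrm s = 1" "\<And>i. s ^ i = 1 \<longleftrightarrow> (q + 1) dvd i"
    using nrm_1_generator by blast
  obtain S where S: "S \<subseteq> nset" "card S = 2"
    "bij_betw (\<lambda>(i, x). s ^ (2 * i) * x) ({..<(q + 1) div 2} \<times> S) nset"
    using nset_orbit[OF s] by blast
  obtain x0 x1 where x01: "S = {x0, x1}" "x0 \<noteq> x1"
    using S(2) unfolding card_2_iff by blast
  have "\<forall>j\<in>{..<p}. \<exists>b\<in>SU. act b (ept x0) = \<rho> (2 * j) \<and> act b (ept x1) = \<rho> (2 * j + 1)"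
  proof
    fix j assume j: "j \<in> {..<p}"
    have m: "2 * j \<in> {0..<2 * p}" "2 * j + 1 \<in> {0..<2 * p}" using j by auto
    then have "\<rho> (2 * j) \<in> opts" "\<rho> (2 * j + 1) \<in> opts"
      using \<rho> R(1) unfolding bij_betw_def by blast+
    moreover have "\<rho> (2 * j) \<noteq> \<rho> (2 * j + 1)"
      using inj_onD[OF bij_betw_imp_inj_on[OF \<rho>] _ m] by auto
    ultimately show "\<exists>b\<in>SU. act b (ept x0) = \<rho> (2 * j) \<and> act b (ept x1) = \<rho> (2 * j + 1)"
      using transitive_on_pairs[of x0 x1] S(1) x01 by auto
  qed
  then obtain b where b: "\<And>j. j \<in> {..<p} \<Longrightarrow> b j \<in> SU" "\<And>j. j \<in> {..<p} \<Longrightarrow> act (b j) (ept x0) = \<rho> (2 * j)"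
    "\<And>j. j \<in> {..<p} \<Longrightarrow> act (b j) (ept x1) = \<rho> (2 * j + 1)" by metis
  have bb: "bij_betw (\<lambda>(j, P). act (b j) P) ({..<p} \<times> ept ` S) R"
  proof -
    have k: "bij_betw (\<lambda>(j, x). 2 * j + (if x = x0 then 0 else 1)) ({..<p} \<times> S) {0..<2 * p}"
    proof (rule bij_betw_byWitness[where f' = "\<lambda>n. (n div 2, if even n then x0 else x1)"])
      show "\<forall>a\<in>{..<p} \<times> S. (\<lambda>n. (n div 2, if even n then x0 else x1)) ((\<lambda>(j, x). 2 * j + (if x = x0 then 0 else 1)) a) = a"
        using x01 by auto
      show "(\<lambda>n. (n div 2, if even n then x0 else x1)) ` {0..<2 * p} \<subseteq> {..<p} \<times> S"
        using x01 by auto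
    qed (use x01 in auto)
    have "bij_betw (\<lambda>(j, x). \<rho> (2 * j + (if x = x0 then 0 else 1))) ({..<p} \<times> S) R"
      using bij_betw_trans[OF k \<rho>] by (simp add: comp_def case_prod_beta')
    moreover have "bij_betw ept S (ept ` S)" by (auto simp: bij_betw_def inj_on_def)
    ultimately show ?thesis by (rule bij_betw_reparam) (use b(2,3) x01 in auto)
  qed
  have SO: "ept ` S \<subseteq> opts" using S(1) ept_opts by auto
  have b1: "bij_betw (\<lambda>(i, L). (act g ^^ i) L) ({..<r} \<times> lam R) lines"
  proof -
    have "bij_betw (\<lambda>(i, w). act (g [^]\<^bsub>SU4 q\<^esub> i) w) ({..<r} \<times> R) opts"
      using R(2) by (simp add: SU_pow[OF g])
    then have "bij_betw (\<lambda>(i, w). act (g [^]\<^bsub>SU4 q\<^esub> i) w) ({..<r} \<times> lam R) (lam opts)"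
      using R(1) SU_pow(1)[OF g] by (intro lam_bij) auto
    then show ?thesis by (simp add: SU_pow[OF g] lam_opts)
  qed
  have b2: "bij_betw (\<lambda>(j, L). act (b j) L) ({..<p} \<times> lam (ept ` S)) (lam R)"
    by (rule lam_bij[OF b(1) SO R(1) bb])
  have lS: "lam (ept ` S) = ells S nset" by (rule lam_ept[OF S(1)])
  have xin: "\<xi> \<in> nset" using xi by (simp add: nset_def)
  have p0: "p > 0" using p(1) prime_gt_0_nat by blast
  have ne2: "preim SU (ell \<xi> \<xi>) (ells S nset) \<noteq> {}"
    using preim_ells_nonempty[OF xin S(1)] xin x01 by auto
  have ne1: "preim SU (ell \<xi> \<xi>) (lam R) \<noteq> {}"
  proof -
    obtain k where k: "k \<in> SU" "act k (ell \<xi> \<xi>) \<in> ells S nset"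
      using ne2 by (auto simp: preim_def)
    have "act (b 0) (act k (ell \<xi> \<xi>)) \<in> lam R"
      using b2 k(2) p0 unfolding bij_betw_def lS by (auto simp: image_def)
    then have "b 0 ** k \<in> preim SU (ell \<xi> \<xi>) (lam R)"
      using k(1) b(1) p0 by (simp add: preim_def act_mult)
    then show ?thesis by blast
  qed
  have "mls_rel (SU4 q) (preim SU (ell \<xi> \<xi>) lines) (preim SU (ell \<xi> \<xi>) (lam R))"
    by (rule mls_preim_powers[OF su_closed_SU g r0 b1 ne1])
  also have "mls_rel (SU4 q) (preim SU (ell \<xi> \<xi>) (lam R)) (preim SU (ell \<xi> \<xi>) (ells S nset))"
    using b(1) b2 ne2 p(1) unfolding lS by (intro mls_preim_single[OF su_closed_SU, of "{..<p}" b]) auto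
  also have "mls_rel (SU4 q) (preim SU (ell \<xi> \<xi>) (ells S nset)) (preim SU (ell \<xi> \<xi>) {ell \<xi> \<xi>})"
    by (rule mls_ells(2)[OF xin s(1) S])
  finally show ?thesis by (simp add: preim_lines[OF xin] stab_def \<omega>_def)
qed

lemma has_MLS_PSU4:
  assumes "mls_rel (SU4 q) SU stab"
  shows "has_MLS (PSU4 q :: ('a^4^4) set monoid)"
proof -
  interpret group "SU4 q :: ('a^4^4) monoid" by (rule group_SU4)
  have "mls_rel (SU4 q) (carrier (SU4 q :: ('a^4^4) monoid)) (group_center (SU4 q))"
    using mls_rel_trans[OF assms mls_stab_center] by simp
  then show ?thesis
    unfolding PSU4_def by (intro has_MLS_quotient group_center_normal) (auto simp: group_center_def)
qed

end

theorem theorem4p5: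
  fixes q :: nat
  assumes "odd q"
    and "\<exists>p k. prime p \<and> k \<ge> 1 \<and> q = p ^ k"
    and "CARD('a::{field,finite}) = q ^ 2"
  shows "(prime (q ^ 2 - q + 1) \<longrightarrow> has_MLS (PSU4 q :: ('a ^4^4) set monoid))
       \<and> ((q > 5 \<and> (\<exists>p. prime p \<and> q + 1 = 2 * p)) \<longrightarrow> has_MLS (PSU4 q :: ('a ^4^4) set monoid))"
proof -
  interpret hermitian_field q "TYPE('a)"
    using assms by unfold_locales
  obtain \<xi> where \<xi>: "nrm \<xi> = -1"
    using nrm_surj[of "-1"] by auto
  interpret hermitian_frame q "TYPE('a)" \<xi> by unfold_locales (fact \<xi>)
  have "has_MLS (PSU4 q :: ('a ^4^4) set monoid)" if "prime (q ^ 2 - q + 1)"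
    using has_MLS_PSU4 mls_lines_case1[OF that, of \<xi>] \<xi> by (simp add: stab_def \<omega>_def nset_def)
  moreover have "has_MLS (PSU4 q :: ('a ^4^4) set monoid)" if "q > 5" "prime p" "q + 1 = 2 * p" for p
    using has_MLS_PSU4 mls_lines_case2[OF that(2,3,1)] by blast
  ultimately show ?thesis by blast
qed

end
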